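(* Let $\Omega\subset\mathbb{R}^3$ be a compact polyhedral domain with $\partial\Omega=D\cup N$, where $N$ is a union of closed faces of $\partial\Omega$ and $D=\partial\Omega\setminus N$ is nonempty. Suppose that a closed face contained in $N$ and a face whose relative interior is contained in $D$ share a $1$-dimensional edge as boundary, and that the dihedral angle measured in $\Omega$ between these two faces is greater than or equal to $\pi$ (and less than $2\pi$). Then there exist mixed data $f\in W^{1,2}(\partial\Omega)$ and $g\in L^2(N)$ for which there is no function $u$ with $\triangle u=0$ in $\Omega$, $u\to f$ nontangentially a.e. on $D$, $\partial_\nu u\to g$ nontangentially a.e. on $N$, and $(\nabla u)^*\in L^2(\partial\Omega)$.
   Context: A compact polyhedral domain is the interior $\Omega$, assumed connected, of a compact polyhedron of $\mathbb{R}^3$. Two distinct faces sharing an edge are allowed to be coplanar (dihedral angle $\pi$). Surface measure is $ds$; $\nu=\nu_P$ is the outer unit normal at a.e. $P\in\partial\Omega$; $L^2$ and $W^{1,2}$ on the boundary are taken with respect to $ds$. Fix $\alpha>0$. The nontangential approach region at $P\in\partial\Omega$ is $\Gamma(P)=\{X\in\Omega:|X-P|<(1+\alpha)\,\mathrm{dist}(X,\partial\Omega)\}$, and $w^*(P)=\sup_{X\in\Gamma(P)}|w(X)|$; different $\alpha$ give comparable $L^p$ norms, so $\alpha$ is suppressed. "$u\to f$ nontangentially" at $P$ means $\lim_{\Gamma(P)\ni X\to P}u(X)=f(P)$, and "$\partial_\nu u\to g$ nontangentially" at $P$ means $\lim_{\Gamma(P)\ni X\to P}\nu_P\cdot\nabla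 u(X)=g(P)$. *)

theory Defs
  imports "HOL-Analysis.Analysis"
begin

subsection \<open>Polyhedral domains and their faces\<close>

text \<open>A compact polyhedron need not be convex, so this is not the library's \<^const>\<open>polyhedron\<close>.\<close>

definition compact_polyhedron :: "(real^3) set \<Rightarrow> bool" where
  "compact_polyhedron K \<longleftrightarrow> (\<exists>\<P>. finite \<P> \<and> (\<forall>P\<in>\<P>. polytope P) \<and> K = \<Union>\<P>)"

definition compact_polyhedral_domain :: "(real^3) set \<Rightarrow> bool" where
  "compact_polyhedral_domain \<Omega> \<longleftrightarrow> (\<exists>K. compact_polyhedron K \<and> \<Omega> = interior K) \<and> connected \<Omega>"

text \<open>A closed face is a planar polygon with connected relative interior, possibly nonconvex or
  with holes.\<close>

definition closed_face :: "(real^3) set \<Rightarrow> bool" where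
  "closed_face F \<longleftrightarrow> compact_polyhedron F \<and> aff_dim F = 2 \<and>
     connected (rel_interior F) \<and> closure (rel_interior F) = F"

text \<open>The faces are part of the data, since adjacent faces may be coplanar and are therefore not
  determined by the domain.\<close>

definition boundary_faces :: "(real^3) set \<Rightarrow> (real^3) set set \<Rightarrow> bool" where
  "boundary_faces \<Omega> \<F> \<longleftrightarrow> finite \<F> \<and> (\<forall>F\<in>\<F>. closed_face F) \<and> \<Union>\<F> = frontier \<Omega> \<and>
     (\<forall>F\<in>\<F>. \<forall>G\<in>\<F>. F \<noteq> G \<longrightarrow> F \<inter> rel_interior G = {})"

definition shared_edge :: "(real^3) set \<Rightarrow> (real^3) set \<Rightarrow> (real^3) set \<Rightarrow> bool" where
  "shared_edge F G e \<longleftrightarrow>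
     (\<exists>x y. x \<noteq> y \<and> e = closed_segment x y) \<and> e \<subseteq> rel_frontier F \<inter> rel_frontier G"

text \<open>In cylindrical coordinates around the edge \<open>e\<close> (axis direction \<open>t\<close>), the face \<open>F\<close> is the half
  plane at angle \<open>0\<close> and \<open>G\<close> the half plane at angle \<open>\<theta>\<close>, near each relative interior point of \<open>e\<close>;
  the wedge between them lies in \<open>\<Omega>\<close>. The vector \<open>b\<close> may have either orientation.\<close>

definition dihedral_angle ::
    "(real^3) set \<Rightarrow> (real^3) set \<Rightarrow> (real^3) set \<Rightarrow> (real^3) set \<Rightarrow> real \<Rightarrow> bool" where
  "dihedral_angle \<Omega> F G e \<theta> \<longleftrightarrow> 0 < \<theta> \<and> \<theta> < 2 * pi \<and>
     (\<exists>t a b. norm t = 1 \<and> norm a = 1 \<and> norm b = 1 \<and> t \<bullet> a = 0 \<and> t \<bullet> b = 0 \<and> a \<bullet> b = 0 \<and>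
       (\<forall>p\<in>rel_interior e. \<exists>\<epsilon>>0.
          e \<inter> ball p \<epsilon> = {p + s *\<^sub>R t | s. True} \<inter> ball p \<epsilon> \<and>
          F \<inter> ball p \<epsilon> = {p + s *\<^sub>R t + r *\<^sub>R a | s r. r \<ge> 0} \<inter> ball p \<epsilon> \<and>
          G \<inter> ball p \<epsilon> =
            {p + s *\<^sub>R t + r *\<^sub>R (cos \<theta> *\<^sub>R a + sin \<theta> *\<^sub>R b) | s r. r \<ge> 0} \<inter> ball p \<epsilon> \<and>
          {p + s *\<^sub>R t + r *\<^sub>R (cos \<phi> *\<^sub>R a + sin \<phi> *\<^sub>R b) | s r \<phi>. r > 0 \<and> 0 < \<phi> \<and> \<phi> < \<theta>}
            \<inter> ball p \<epsilon> \<subseteq> \<Omega>))"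

subsection \<open>Surface measure and unit normal\<close>

text \<open>Surface measure is the sum over the faces of planar Lebesgue measure, transported by an
  isometric parametrization of the plane of the face. It is a Borel measure on the whole space,
  concentrated on the boundary.\<close>

definition plane_chart :: "(real^3) set \<Rightarrow> real^2 \<Rightarrow> real^3" where
  "plane_chart F = (SOME h. (\<forall>x y. dist (h x) (h y) = dist x y) \<and> range h = affine hull F)"

definition surface_measure :: "(real^3) set set \<Rightarrow> (real^3) measure" where
  "surface_measure \<F> =
     measure_of UNIV (sets borel) (\<lambda>A. \<Sum>F\<in>\<F>. emeasure lborel (plane_chart F -` (A \<inter> F)))"

text \<open>Determined at every point in the relative interior of a face.\<close>

definition outer_normal :: "(real^3) set \<Rightarrow> real^3 \<Rightarrow> real^3" where
  "outer_normal \<Omega> P = (THE n. norm n = 1 \<and>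
     (\<exists>\<epsilon>>0. \<Omega> \<inter> ball P \<epsilon> = {X \<in> ball P \<epsilon>. (X - P) \<bullet> n < 0}))"

subsection \<open>Gradient and harmonic functions\<close>

definition grad :: "(real^3 \<Rightarrow> real) \<Rightarrow> real^3 \<Rightarrow> real^3" where
  "grad u x = (\<chi> i. frechet_derivative u (at x) (axis i 1))"

definition laplacian :: "(real^3 \<Rightarrow> real) \<Rightarrow> real^3 \<Rightarrow> real" where
  "laplacian u x = trace (jacobian (grad u) (at x))"

definition harmonic_on :: "(real^3 \<Rightarrow> real) \<Rightarrow> (real^3) set \<Rightarrow> bool" where
  "harmonic_on u \<Omega> \<longleftrightarrow>
     (\<forall>x\<in>\<Omega>. u differentiable (at x) \<and> grad u differentiable (at x)) \<and>
     continuous_on \<Omega> (\<lambda>x. jacobian (grad u) (at x)) \<and> (\<forall>x\<in>\<Omega>. laplacian u x = 0)"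

subsection \<open>Boundary function spaces\<close>

definition L2_on :: "(real^3) measure \<Rightarrow> (real^3) set \<Rightarrow> (real^3 \<Rightarrow> 'b::euclidean_space) \<Rightarrow> bool" where
  "L2_on M A f \<longleftrightarrow> set_borel_measurable M A f \<and> set_integrable M A (\<lambda>P. (norm (f P))\<^sup>2)"

definition tangential_grad :: "(real^3) set \<Rightarrow> (real^3 \<Rightarrow> real) \<Rightarrow> real^3 \<Rightarrow> real^3" where
  "tangential_grad \<Omega> h P = grad h P - (outer_normal \<Omega> P \<bullet> grad h P) *\<^sub>R outer_normal \<Omega> P"

text \<open>\<open>W\<^sup>1\<^sup>,\<^sup>2(\<partial>\<Omega>)\<close> as the completion of the restrictions to \<open>\<partial>\<Omega>\<close> of \<open>C\<^sup>1\<close> functions, in the norm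
  given by the function and its tangential gradient in \<open>L\<^sup>2(\<partial>\<Omega>)\<close>.\<close>

definition W12_boundary :: "(real^3) set \<Rightarrow> (real^3) set set \<Rightarrow> (real^3 \<Rightarrow> real) \<Rightarrow> bool" where
  "W12_boundary \<Omega> \<F> f \<longleftrightarrow> L2_on (surface_measure \<F>) (frontier \<Omega>) f \<and>
     (\<exists>G h. L2_on (surface_measure \<F>) (frontier \<Omega>) G \<and>
        (\<forall>k::nat. (\<forall>x. h k differentiable (at x)) \<and> continuous_on UNIV (grad (h k))) \<and>
        (\<lambda>k. \<integral>\<^sup>+P\<in>frontier \<Omega>. ennreal ((h k P - f P)\<^sup>2) \<partial>surface_measure \<F>) \<longlonglongrightarrow> 0 \<and>
        (\<lambda>k. \<integral>\<^sup>+P\<in>frontier \<Omega>. ennreal ((norm (tangential_grad \<Omega> (h k) P - G P))\<^sup>2)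
               \<partial>surface_measure \<F>) \<longlonglongrightarrow> 0)"

subsection \<open>Nontangential approach\<close>

definition approach_region :: "real \<Rightarrow> (real^3) set \<Rightarrow> real^3 \<Rightarrow> (real^3) set" where
  "approach_region \<alpha> \<Omega> P = {X \<in> \<Omega>. norm (X - P) < (1 + \<alpha>) * infdist X (frontier \<Omega>)}"

definition nontangential_max ::
    "real \<Rightarrow> (real^3) set \<Rightarrow> (real^3 \<Rightarrow> real^3) \<Rightarrow> real^3 \<Rightarrow> ennreal" where
  "nontangential_max \<alpha> \<Omega> w P = (SUP X\<in>approach_region \<alpha> \<Omega> P. ennreal (norm (w X)))"

definition mixed_solution :: "real \<Rightarrow> (real^3) set \<Rightarrow> (real^3) set set \<Rightarrow> (real^3) set \<Rightarrow> (real^3) set \<Rightarrow>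
    (real^3 \<Rightarrow> real) \<Rightarrow> (real^3 \<Rightarrow> real) \<Rightarrow> (real^3 \<Rightarrow> real) \<Rightarrow> bool" where
  "mixed_solution \<alpha> \<Omega> \<F> D N f g u \<longleftrightarrow>
     harmonic_on u \<Omega> \<and>
     (AE P in surface_measure \<F>. P \<in> D \<longrightarrow>
        (u \<longlongrightarrow> f P) (at P within approach_region \<alpha> \<Omega> P)) \<and>
     (AE P in surface_measure \<F>. P \<in> N \<longrightarrow>
        ((\<lambda>X. outer_normal \<Omega> P \<bullet> grad u X) \<longlongrightarrow> g P) (at P within approach_region \<alpha> \<Omega> P)) \<and>
     (\<integral>\<^sup>+P\<in>frontier \<Omega>. (nontangential_max \<alpha> \<Omega> (grad u) P)\<^sup>2 \<partial>surface_measure \<F>) < \<infinity>"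

end

theory Submission
  imports Defs
begin

text \<open>
  The obstruction is local, at one interior point \<open>p\<close> of the edge. In cylindrical coordinates
  \<open>(r, \<phi>, z)\<close> around the edge the domain contains the wedge \<open>0 < \<phi> < \<theta>\<close>, the Neumann face \<open>F\<close> is
  \<open>\<phi> = 0\<close> and the Dirichlet face \<open>G\<close> is \<open>\<phi> = \<theta>\<close>. With \<open>\<beta> = \<pi> / (2 \<theta>)\<close> the function
  \<open>r\<^sup>\<beta> cos (\<beta> \<phi>)\<close> is harmonic and satisfies both homogeneous boundary conditions, and so does its
  Kelvin transform \<open>r\<^sup>\<beta> cos (\<beta> \<phi>) \<bar>X - z0\<bar>\<close> to the power \<open>- 1 - 2 \<beta>\<close>, a pole at the point \<open>z0\<close> of
  the edge. Take \<open>f = 0\<close> and suppose that \<open>u\<close> solves the mixed problem. Green's identity for \<open>u\<close> and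
  the pole, truncated away from the edge at \<open>r \<approx> \<epsilon>\<close> and at a fixed distance from \<open>z0\<close>, bounds the
  pairing of \<open>g\<close> with the pole by a constant independent of \<open>z0\<close> plus an error that lives on
  \<open>\<epsilon> < r < 2 \<epsilon>\<close>. The hypothesis \<open>\<theta> \<ge> \<pi>\<close> means \<open>\<beta> \<le> 1/2\<close>, and this is precisely what makes the error,
  averaged over \<open>z0\<close> in a short segment of the edge, tend to \<open>0\<close> with \<open>\<epsilon>\<close> when \<open>(\<nabla>u)\<^sup>*\<close> is square
  integrable. So the pairing of \<open>g\<close> with the pole stays bounded on average as \<open>z0\<close> approaches \<open>p\<close>.
  But the pole grows along \<open>F\<close> like the distance to the power \<open>- 1 - \<beta>\<close>, which is not square
  integrable, and the neumann_datum \<open>g = r\<close> to the power \<open>\<beta>/2 - 1\<close> on the sector \<open>\<bar>z\<bar> < r\<close> is in \<open>L\<^sup>2\<close> and makes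
  the pairing blow up.

  Green's identity is \<open>sector_flux_derivative\<close>, written as a formula for the derivative in \<open>\<phi>\<close> of the
  flux through the half plane at angle \<open>\<phi>\<close>: no surface integrals in space are needed, and the
  boundary conditions enter only through the limits of that flux as \<open>\<phi>\<close> tends to \<open>0\<close> and to \<open>\<theta>\<close>
  (\<open>test_inequality\<close>). The coordinate curves \<open>\<phi> \<rightarrow> 0\<close> and \<open>\<phi> \<rightarrow> \<theta>\<close> approach the faces
  nontangentially for every \<open>\<alpha> > 0\<close> because \<open>\<theta> \<ge> \<pi>\<close>, and for the same reason \<open>\<nabla>u\<close> in the whole wedge
  is controlled by finitely many dilates of \<open>(\<nabla>u)\<^sup>*\<close> on the two faces
  (\<open>gradient_majorant\<close>). The truncated pole is estimated in \<open>residual_bound\<close>, the averaging argument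
  is \<open>gradient_not_square_integrable\<close>, and the last part carries surface measure, normal and almost
  everywhere statements over to coordinates in the half planes.
\<close>

section \<open>Box integrals and the trace in an orthonormal frame\<close>

lemma grad_has_derivative:
  assumes "u differentiable (at x)"
  shows "(u has_derivative (\<lambda>v. grad u x \<bullet> v)) (at x)"
proof -
  have D: "(u has_derivative frechet_derivative u (at x)) (at x)"
    using assms frechet_derivative_works by blast
  then have lin: "linear (frechet_derivative u (at x))"
    by (rule has_derivative_linear)
  have "frechet_derivative u (at x) v = grad u x \<bullet> v" for v
  proof -
    have "frechet_derivative u (at x) v = frechet_derivative u (at x) (\<Sum>i\<in>UNIV. v $ i *\<^sub>R axis i 1)"
      using basis_expansion[of v] by (simp add: scalar_mult_eq_scaleR)
    also have "\<dots> = (\<Sum>i\<in>UNIV. v $ i * frechet_derivative u (at x) (axis i 1))"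
      using lin by (simp add: linear_sum linear_cmul)
    also have "\<dots> = grad u x \<bullet> v"
      by (simp add: inner_vec_def grad_def mult.commute)
    finally show ?thesis .
  qed
  then have "frechet_derivative u (at x) = (\<lambda>v. grad u x \<bullet> v)" by auto
  with D show ?thesis by simp
qed

text \<open>The trace is invariant under the orthogonal change of basis whose rows are the frame.\<close>
lemma trace_orthonormal_frame:
  fixes H :: "real^3^3" and t a b :: "real^3"
  assumes "norm t = 1" "norm a = 1" "norm b = 1" "t \<bullet> a = 0" "t \<bullet> b = 0" "a \<bullet> b = 0"
  shows "trace H = t \<bullet> (H *v t) + a \<bullet> (H *v a) + b \<bullet> (H *v b)"
proof -
  define Q :: "real^3^3" where "Q = vector [t, a, b]"
  have Q: "Q $ 1 = t" "Q $ 2 = a" "Q $ 3 = b" by (auto simp: Q_def)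
  have n: "t \<bullet> t = 1" "a \<bullet> a = 1" "b \<bullet> b = 1"
    using assms by (simp_all add: dot_square_norm)
  have row: "(Q ** transpose Q) $ i $ j = Q $ i \<bullet> Q $ j" for i j
    by (simp add: matrix_matrix_mult_def transpose_def inner_vec_def)
  have "Q ** transpose Q = mat 1"
    using n assms by (simp add: vec_eq_iff forall_3 row Q mat_def inner_commute[of a t] inner_commute[of b t] inner_commute[of b a])
  then have QQ: "transpose Q ** Q = mat 1" by (simp add: matrix_left_right_inverse)
  have "trace H = trace ((H ** transpose Q) ** Q)"
    by (simp add: QQ flip: matrix_mul_assoc)
  also have "\<dots> = trace (Q ** (H ** transpose Q))" by (rule trace_mul_sym)
  also have "\<dots> = (\<Sum>i\<in>UNIV. Q $ i \<bullet> (H *v (Q $ i)))"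
    by (simp add: trace_def matrix_matrix_mult_def inner_vec_def matrix_vector_mult_def transpose_def)
  also have "\<dots> = t \<bullet> (H *v t) + a \<bullet> (H *v a) + b \<bullet> (H *v b)"
    by (simp add: sum_3 Q)
  finally show ?thesis .
qed

lemma integral_box_fst_derivative:
  fixes P P' :: "real \<times> real \<Rightarrow> real"
  assumes r: "r1 \<le> r2" and c: "continuous_on (cbox (r1, z1) (r2, z2)) P'"
    and d: "\<And>r z. (r, z) \<in> cbox (r1, z1) (r2, z2) \<Longrightarrow>
        ((\<lambda>r. P (r, z)) has_real_derivative P' (r, z)) (at r)"
    and v: "\<And>z. P (r1, z) = 0" "\<And>z. P (r2, z) = 0"
  shows "integral (cbox (r1, z1) (r2, z2)) P' = 0"
proof -
  have inner: "integral (cbox r1 r2) (\<lambda>r. P' (r, z)) = 0" if "z \<in> cbox z1 z2" for z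
  proof -
    have "((\<lambda>r. P' (r, z)) has_integral P (r2, z) - P (r1, z)) {r1..r2}"
    proof (rule fundamental_theorem_of_calculus[OF r])
      fix r assume "r \<in> {r1..r2}"
      then have "(r, z) \<in> cbox (r1, z1) (r2, z2)" using that by simp
      from d[OF this] show "((\<lambda>r. P (r, z)) has_vector_derivative P' (r, z)) (at r within {r1..r2})"
        by (simp only: has_real_derivative_iff_has_vector_derivative has_vector_derivative_at_within)
    qed
    from integral_unique[OF this] show ?thesis by (simp only: v cbox_interval diff_self)
  qed
  have "integral (cbox (r1, z1) (r2, z2)) P' =
      integral (cbox r1 r2) (\<lambda>r. integral (cbox z1 z2) (\<lambda>z. P' (r, z)))"
    by (rule integral_prod_continuous[OF c])
  also have "\<dots> = integral (cbox z1 z2) (\<lambda>z. integral (cbox r1 r2) (\<lambda>r. P' (r, z)))"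
    using integral_swap_continuous[where f="\<lambda>r z. P' (r, z)" and a=r1 and b=r2 and c=z1 and d=z2, unfolded case_prod_eta, OF c]
    by this
  also have "\<dots> = integral (cbox z1 z2) (\<lambda>z. 0)"
    using inner by (rule integral_cong)
  finally show ?thesis by (simp only: integral_0)
qed

lemma integral_box_snd_derivative:
  fixes P P' :: "real \<times> real \<Rightarrow> real"
  assumes r: "z1 \<le> z2" and c: "continuous_on (cbox (r1, z1) (r2, z2)) P'"
    and d: "\<And>r z. (r, z) \<in> cbox (r1, z1) (r2, z2) \<Longrightarrow>
        ((\<lambda>z. P (r, z)) has_real_derivative P' (r, z)) (at z)"
    and v: "\<And>r. P (r, z1) = 0" "\<And>r. P (r, z2) = 0"
  shows "integral (cbox (r1, z1) (r2, z2)) P' = 0"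
proof -
  have inner: "integral (cbox z1 z2) (\<lambda>z. P' (r, z)) = 0" if "r \<in> cbox r1 r2" for r
  proof -
    have "((\<lambda>z. P' (r, z)) has_integral P (r, z2) - P (r, z1)) {z1..z2}"
    proof (rule fundamental_theorem_of_calculus[OF r])
      fix z assume "z \<in> {z1..z2}"
      then have "(r, z) \<in> cbox (r1, z1) (r2, z2)" using that by simp
      from d[OF this] show "((\<lambda>z. P (r, z)) has_vector_derivative P' (r, z)) (at z within {z1..z2})"
        by (simp only: has_real_derivative_iff_has_vector_derivative has_vector_derivative_at_within)
    qed
    from integral_unique[OF this] show ?thesis by (simp only: v cbox_interval diff_self)
  qed
  have "integral (cbox (r1, z1) (r2, z2)) P' =
      integral (cbox r1 r2) (\<lambda>r. integral (cbox z1 z2) (\<lambda>z. P' (r, z)))"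
    by (rule integral_prod_continuous[OF c])
  also have "\<dots> = integral (cbox r1 r2) (\<lambda>r. 0)"
    using inner by (rule integral_cong)
  finally show ?thesis by (simp only: integral_0)
qed

section \<open>Cylindrical coordinates and Green's identity in a sector\<close>

text \<open>Cylindrical coordinates with axis \<open>p + \<real> t\<close>. A point of the half plane at angle \<open>\<phi>\<close> is given by the
  pair \<open>x = (r, z)\<close>, so that one and the same pair space parametrizes both faces and all the half
  planes between them, isometrically.\<close>
locale orthonormal_frame =
  fixes p t a b :: "real^3"
  assumes frame: "norm t = 1" "norm a = 1" "norm b = 1" "t \<bullet> a = 0" "t \<bullet> b = 0" "a \<bullet> b = 0"
begin

definition radial :: "real \<Rightarrow> real^3" where "radial \<phi> = cos \<phi> *\<^sub>R a + sin \<phi> *\<^sub>R b"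
definition angular :: "real \<Rightarrow> real^3" where "angular \<phi> = (- sin \<phi>) *\<^sub>R a + cos \<phi> *\<^sub>R b"
definition cyl :: "real \<Rightarrow> real \<times> real \<Rightarrow> real^3" where
  "cyl \<phi> x = p + snd x *\<^sub>R t + fst x *\<^sub>R radial \<phi>"

lemma frame_inner [simp]: "t \<bullet> t = 1" "a \<bullet> a = 1" "b \<bullet> b = 1" "t \<bullet> a = 0" "t \<bullet> b = 0" "a \<bullet> b = 0"
  "a \<bullet> t = 0" "b \<bullet> t = 0" "b \<bullet> a = 0"
  using frame by (simp_all add: dot_square_norm inner_commute)

lemma radial_inner: "radial \<phi> \<bullet> radial \<psi> = cos (\<phi> - \<psi>)"
  by (simp add: radial_def inner_add_left inner_add_right cos_diff)
lemma angular_inner: "angular \<phi> \<bullet> angular \<psi> = cos (\<phi> - \<psi>)"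
  by (simp add: angular_def inner_add_left inner_add_right inner_diff_left inner_diff_right cos_diff)
lemma radial_inner_angular: "radial \<phi> \<bullet> angular \<psi> = sin (\<phi> - \<psi>)"
  by (simp add: radial_def angular_def inner_add_left inner_add_right inner_diff_left inner_diff_right sin_diff)
lemma t_radial [simp]: "t \<bullet> radial \<phi> = 0" "radial \<phi> \<bullet> t = 0" by (simp_all add: radial_def inner_add_left inner_add_right)
lemma t_angular [simp]: "t \<bullet> angular \<phi> = 0" "angular \<phi> \<bullet> t = 0" by (simp_all add: angular_def inner_add_left inner_add_right inner_diff_left inner_diff_right)
lemma norm_radial [simp]: "norm (radial \<phi>) = 1" using radial_inner[of \<phi> \<phi>] by (simp add: norm_eq_sqrt_inner)
lemma norm_angular [simp]: "norm (angular \<phi>) = 1" using angular_inner[of \<phi> \<phi>] by (simp add: norm_eq_sqrt_inner)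

lemma trace_cylindrical: "trace H = t \<bullet> (H *v t) + radial \<phi> \<bullet> (H *v radial \<phi>) + angular \<phi> \<bullet> (H *v angular \<phi>)"
  by (rule trace_orthonormal_frame) (use frame in \<open>simp_all add: radial_inner_angular\<close>)

lemma radial_vector_derivative: "(radial has_vector_derivative angular \<phi>) (at \<phi>)"
  unfolding radial_def[abs_def] angular_def by (auto intro!: derivative_eq_intros)
lemma angular_vector_derivative: "(angular has_vector_derivative - radial \<phi>) (at \<phi>)"
  unfolding radial_def angular_def[abs_def] by (auto intro!: derivative_eq_intros)

lemma cyl_vector_derivatives:
  "((\<lambda>r. cyl \<phi> (r, z)) has_vector_derivative radial \<phi>) (at r)"
  "((\<lambda>z. cyl \<phi> (r, z)) has_vector_derivative t) (at z)"
  "((\<lambda>\<phi>. cyl \<phi> x) has_vector_derivative fst x *\<^sub>R angular \<phi>) (at \<phi>)"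
  unfolding cyl_def
  by (auto intro!: derivative_eq_intros radial_vector_derivative)

lemma continuous_cyl: "continuous_on S (\<lambda>(\<phi>, x). cyl \<phi> x)"
  unfolding cyl_def radial_def case_prod_unfold by (intro continuous_intros)

end

lemma function_along_path:
  assumes "(c has_vector_derivative v) (at s)" "u differentiable (at (c s))"
  shows "((\<lambda>s. u (c s)) has_real_derivative grad u (c s) \<bullet> v) (at s)"
  using vector_derivative_diff_chain_within[where f=c and S=UNIV and g=u, OF assms(1)]
    grad_has_derivative[OF assms(2)]
  by (simp add: has_real_derivative_iff_has_vector_derivative o_def has_derivative_at_withinI)

lemma grad_along_path:
  assumes "(c has_vector_derivative v) (at s)" "grad u differentiable (at (c s))"
    and "(w has_vector_derivative w') (at s)"
  shows "((\<lambda>s. grad u (c s) \<bullet> w s) has_real_derivative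
     w s \<bullet> (jacobian (grad u) (at (c s)) *v v) + grad u (c s) \<bullet> w') (at s)"
proof -
  have "((\<lambda>s. grad u (c s)) has_vector_derivative jacobian (grad u) (at (c s)) *v v) (at s)"
    using vector_derivative_diff_chain_within[where f=c and S=UNIV and g="grad u", OF assms(1)]
      assms(2)[THEN jacobian_works[THEN iffD1]]
    by (simp add: o_def has_derivative_at_withinI)
  from bounded_bilinear.has_vector_derivative[OF bounded_bilinear_inner this assms(3)] show ?thesis
    by (simp add: has_real_derivative_iff_has_vector_derivative inner_commute add.commute)
qed

context orthonormal_frame begin

text \<open>Green's identity for \<open>u\<close> and \<open>\<psi> cos (\<beta> \<phi>)\<close>, in differential form. Multiplied by the radial weight,
  the Laplace equation reads \<open>r (u\<^sub>r\<^sub>r + u\<^sub>z\<^sub>z) + u\<^sub>r + u\<^sub>\<phi>\<^sub>\<phi> / r = 0\<close>, and after multiplication by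
  \<open>\<psi> cos (\<beta> \<phi>)\<close> the derivatives in \<open>r\<close> and \<open>z\<close> can be moved to \<open>\<psi>\<close>, up to \<open>\<partial>\<^sub>r\<close> and \<open>\<partial>\<^sub>z\<close> of functions
  vanishing on the boundary of the box. What remains in \<open>\<phi>\<close> is the derivative of the flux.\<close>
lemma sector_flux_derivative:
  fixes \<psi> \<psi>r \<psi>z \<psi>rr \<psi>zz :: "real \<times> real \<Rightarrow> real" and r1 r2 z1 z2 :: real
  defines "B \<equiv> cbox (r1, z1) (r2, z2)"
  assumes h: "harmonic_on u \<Omega>" and r: "0 < r1" "r1 \<le> r2" "z1 \<le> z2"
    and dom: "\<And>\<phi> x. 0 < \<phi> \<Longrightarrow> \<phi> < \<theta> \<Longrightarrow> x \<in> B \<Longrightarrow> cyl \<phi> x \<in> \<Omega>"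
    and d: "\<And>r z. (r, z) \<in> B \<Longrightarrow> ((\<lambda>r. \<psi> (r, z)) has_real_derivative \<psi>r (r, z)) (at r)"
      "\<And>r z. (r, z) \<in> B \<Longrightarrow> ((\<lambda>r. \<psi>r (r, z)) has_real_derivative \<psi>rr (r, z)) (at r)"
      "\<And>r z. (r, z) \<in> B \<Longrightarrow> ((\<lambda>z. \<psi> (r, z)) has_real_derivative \<psi>z (r, z)) (at z)"
      "\<And>r z. (r, z) \<in> B \<Longrightarrow> ((\<lambda>z. \<psi>z (r, z)) has_real_derivative \<psi>zz (r, z)) (at z)"
    and c: "continuous_on B \<psi>" "continuous_on B \<psi>r" "continuous_on B \<psi>rr" "continuous_on B \<psi>zz"
    and v: "\<And>z. \<psi> (r1, z) = 0" "\<And>z. \<psi>r (r1, z) = 0" "\<And>z. \<psi> (r2, z) = 0" "\<And>z. \<psi>r (r2, z) = 0"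
      "\<And>r. \<psi> (r, z1) = 0" "\<And>r. \<psi>z (r, z1) = 0" "\<And>r. \<psi> (r, z2) = 0" "\<And>r. \<psi>z (r, z2) = 0"
    and \<phi>: "0 < \<phi>" "\<phi> < \<theta>"
  shows "((\<lambda>\<phi>. integral B (\<lambda>x. \<psi> x * (grad u (cyl \<phi> x) \<bullet> angular \<phi>) * cos (\<beta> * \<phi>)
                + \<beta> * \<psi> x / fst x * u (cyl \<phi> x) * sin (\<beta> * \<phi>))) has_real_derivative
     - integral B (\<lambda>x. u (cyl \<phi> x) * cos (\<beta> * \<phi>) *
          (fst x * \<psi>rr x + \<psi>r x + fst x * \<psi>zz x - \<beta>\<^sup>2 * \<psi> x / fst x))) (at \<phi>)"
proof -
  define H where "H x = jacobian (grad u) (at x)" for x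
  have hu: "u differentiable (at x)" "grad u differentiable (at x)" "trace (H x) = 0" if "x \<in> \<Omega>" for x
    using h that by (auto simp: harmonic_on_def laplacian_def H_def)
  have cH: "continuous_on \<Omega> H" using h by (simp add: harmonic_on_def H_def)
  have cu: "continuous_on \<Omega> u" "continuous_on \<Omega> (grad u)"
    by (intro continuous_at_imp_continuous_on ballI differentiable_imp_continuous_within hu; assumption)+
  let ?U = "{0<..<\<theta>}"
  have img: "(\<lambda>(\<phi>, x). cyl \<phi> x) ` (?U \<times> B) \<subseteq> \<Omega>" using dom by auto
  have C: "continuous_on (?U \<times> B) (\<lambda>y. f (cyl (fst y) (snd y)))"
    if "continuous_on \<Omega> f" for f :: "real^3 \<Rightarrow> 'c::topological_space"
    using continuous_on_compose2[OF that continuous_cyl img] by (simp add: case_prod_unfold)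
  have C1: "continuous_on (?U \<times> B) (\<lambda>y. f (snd y))"
    if "continuous_on B f" for f :: "real \<times> real \<Rightarrow> real"
    by (rule continuous_on_compose2[OF that]) (auto intro!: continuous_intros)
  have B1: "fst x > 0" if "x \<in> B" for x using that r by (cases x) (auto simp: B_def)
  note CI = C[OF cu(1)] C[OF cu(2)] C[OF cH] C1[OF c(1)] C1[OF c(2)] C1[OF c(3)] C1[OF c(4)]
  have cep: "continuous_on S angular" "continuous_on S radial" for S
    unfolding radial_def[abs_def] angular_def[abs_def] by (intro continuous_intros)+
  have E: "continuous_on (?U \<times> B) (\<lambda>y. angular (fst y))"  "continuous_on (?U \<times> B) (\<lambda>y. radial (fst y))"
    by (rule continuous_on_compose2[OF cep(1)[of UNIV]] continuous_on_compose2[OF cep(2)[of UNIV]];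
        auto intro!: continuous_intros)+
  have mv: "continuous_on S (\<lambda>y. (M y :: real^3^3) *v (w y))"
    if "continuous_on S M" "continuous_on S w" for S and M :: "real \<times> real \<times> real \<Rightarrow> real^3^3" and w
    unfolding matrix_vector_mult_def by (intro continuous_intros that)
  have slice: "continuous_on B (\<lambda>x. f (\<phi>, x))" if "continuous_on (?U \<times> B) f" "\<phi> \<in> ?U"
    for f :: "real \<times> real \<times> real \<Rightarrow> real" and \<phi>
    by (rule continuous_on_compose2[OF that(1)]) (use that(2) in \<open>auto intro!: continuous_intros\<close>)
  define f where "f \<phi> x = \<psi> x * (grad u (cyl \<phi> x) \<bullet> angular \<phi>) * cos (\<beta> * \<phi>)
                + \<beta> * \<psi> x / fst x * u (cyl \<phi> x) * sin (\<beta> * \<phi>)" for \<phi> x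
  define f' where "f' \<phi> x = \<psi> x * cos (\<beta> * \<phi>) * (fst x * (angular \<phi> \<bullet> (H (cyl \<phi> x) *v angular \<phi>))
       - grad u (cyl \<phi> x) \<bullet> radial \<phi> + \<beta>\<^sup>2 * u (cyl \<phi> x) / fst x)" for \<phi> x
  have "((\<lambda>\<phi>. integral B (f \<phi>)) has_real_derivative integral B (f' \<phi>)) (at \<phi> within ?U)"
    unfolding B_def
  proof (rule leibniz_rule_field_derivative)
    fix \<phi> x assume \<phi>: "\<phi> \<in> ?U" and x: "x \<in> cbox (r1, z1) (r2, z2)"
    then have x': "cyl \<phi> x \<in> \<Omega>" "fst x > 0" using dom r B1 by (auto simp: B_def)
    show "((\<lambda>\<phi>. f \<phi> x) has_real_derivative f' \<phi> x) (at \<phi> within ?U)"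
    proof -
      have Dg: "((\<lambda>\<phi>. grad u (cyl \<phi> x) \<bullet> angular \<phi>) has_real_derivative
          angular \<phi> \<bullet> (H (cyl \<phi> x) *v (fst x *\<^sub>R angular \<phi>)) + grad u (cyl \<phi> x) \<bullet> - radial \<phi>) (at \<phi>)"
        unfolding H_def
        by (rule grad_along_path[OF cyl_vector_derivatives(3) hu(2)[OF x'(1)] angular_vector_derivative])
      have Du: "((\<lambda>\<phi>. u (cyl \<phi> x)) has_real_derivative grad u (cyl \<phi> x) \<bullet> (fst x *\<^sub>R angular \<phi>)) (at \<phi>)"
        by (rule function_along_path[OF cyl_vector_derivatives(3) hu(1)[OF x'(1)]])
      have "((\<lambda>\<phi>. f \<phi> x) has_real_derivative f' \<phi> x) (at \<phi>)"
        unfolding f_def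
        apply (rule DERIV_cong)
         apply (rule derivative_intros Dg Du)+
        using x'(2) by (simp add: f'_def matrix_vector_mult_scaleR field_simps power2_eq_square)
      then show ?thesis by (rule has_field_derivative_at_within)
    qed
  next
    fix \<phi> assume \<phi>: "\<phi> \<in> ?U"
    have "continuous_on (?U \<times> B) (\<lambda>y. f (fst y) (snd y))"
      unfolding f_def by (intro continuous_intros CI E) (auto dest: B1)
    from slice[OF this \<phi>] show "f \<phi> integrable_on cbox (r1, z1) (r2, z2)"
      unfolding B_def by (intro integrable_continuous) (simp add: case_prod_unfold)
  next
    show "continuous_on (?U \<times> cbox (r1, z1) (r2, z2)) (\<lambda>(x, y). f' x y)"
      unfolding f'_def case_prod_unfold B_def[symmetric]
      by (intro continuous_intros CI E mv) (auto dest: B1)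
  qed (use \<phi> in auto)
  then have D: "((\<lambda>\<phi>. integral B (f \<phi>)) has_real_derivative integral B (f' \<phi>)) (at \<phi>)"
    using \<phi> at_within_open[of \<phi> ?U] by auto
  define Pr where "Pr x = cos (\<beta> * \<phi>) * (\<psi> x * (grad u (cyl \<phi> x) \<bullet> radial \<phi> + fst x * (radial \<phi> \<bullet> (H (cyl \<phi> x) *v radial \<phi>)))
       - u (cyl \<phi> x) * (\<psi>r x + fst x * \<psi>rr x))" for x
  define Qz where "Qz x = cos (\<beta> * \<phi>) * fst x * (\<psi> x * (t \<bullet> (H (cyl \<phi> x) *v t)) - u (cyl \<phi> x) * \<psi>zz x)" for x
  have \<phi>U: "\<phi> \<in> ?U" using \<phi> by auto
  have cPr: "continuous_on B Pr"
  proof -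
    have "continuous_on (?U \<times> B) (\<lambda>(\<phi>, x). cos (\<beta> * \<phi>) * (\<psi> x * (grad u (cyl \<phi> x) \<bullet> radial \<phi> + fst x * (radial \<phi> \<bullet> (H (cyl \<phi> x) *v radial \<phi>)))
       - u (cyl \<phi> x) * (\<psi>r x + fst x * \<psi>rr x)))"
      unfolding case_prod_unfold by (intro continuous_intros CI E mv)
    from slice[OF this \<phi>U] show ?thesis by (simp add: Pr_def[abs_def])
  qed
  have cQz: "continuous_on B Qz"
  proof -
    have "continuous_on (?U \<times> B) (\<lambda>(\<phi>, x). cos (\<beta> * \<phi>) * fst x * (\<psi> x * (t \<bullet> (H (cyl \<phi> x) *v t)) - u (cyl \<phi> x) * \<psi>zz x))"
      unfolding case_prod_unfold by (intro continuous_intros CI E mv)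
    from slice[OF this \<phi>U] show ?thesis by (simp add: Qz_def[abs_def])
  qed
  have iP: "integral B Pr = 0"
    unfolding B_def
  proof (rule integral_box_fst_derivative[OF r(2) cPr[unfolded B_def]])
    fix r z assume x: "(r, z) \<in> cbox (r1, z1) (r2, z2)"
    then have x': "cyl \<phi> (r, z) \<in> \<Omega>" using dom \<phi> by (auto simp: B_def)
    have "((\<lambda>r. cos (\<beta> * \<phi>) * r * (\<psi> (r, z) * (grad u (cyl \<phi> (r, z)) \<bullet> radial \<phi>) - u (cyl \<phi> (r, z)) * \<psi>r (r, z)))
        has_real_derivative Pr (r, z)) (at r)"
      unfolding Pr_def
      apply (rule DERIV_cong)
       apply (rule derivative_intros d(1)[unfolded B_def, OF x] d(2)[unfolded B_def, OF x]
          grad_along_path[OF cyl_vector_derivatives(1) hu(2)[OF x'] has_vector_derivative_const, folded H_def]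
          function_along_path[OF cyl_vector_derivatives(1) hu(1)[OF x']])+
      by (simp add: algebra_simps)
    then show "((\<lambda>r. (\<lambda>x. cos (\<beta> * \<phi>) * fst x * (\<psi> x * (grad u (cyl \<phi> x) \<bullet> radial \<phi>) - u (cyl \<phi> x) * \<psi>r x)) (r, z))
        has_real_derivative Pr (r, z)) (at r)"
      by simp
  qed (use v in auto)
  have iQ: "integral B Qz = 0"
    unfolding B_def
  proof (rule integral_box_snd_derivative[OF r(3) cQz[unfolded B_def]])
    fix r z assume x: "(r, z) \<in> cbox (r1, z1) (r2, z2)"
    then have x': "cyl \<phi> (r, z) \<in> \<Omega>" using dom \<phi> by (auto simp: B_def)
    have "((\<lambda>z. cos (\<beta> * \<phi>) * r * (\<psi> (r, z) * (grad u (cyl \<phi> (r, z)) \<bullet> t) - u (cyl \<phi> (r, z)) * \<psi>z (r, z)))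
        has_real_derivative Qz (r, z)) (at z)"
      unfolding Qz_def
      apply (rule DERIV_cong)
       apply (rule derivative_intros d(3)[unfolded B_def, OF x] d(4)[unfolded B_def, OF x]
          grad_along_path[OF cyl_vector_derivatives(2) hu(2)[OF x'] has_vector_derivative_const, folded H_def]
          function_along_path[OF cyl_vector_derivatives(2) hu(1)[OF x']])+
      by (simp add: algebra_simps)
    then show "((\<lambda>z. (\<lambda>x. cos (\<beta> * \<phi>) * fst x * (\<psi> x * (grad u (cyl \<phi> x) \<bullet> t) - u (cyl \<phi> x) * \<psi>z x)) (r, z))
        has_real_derivative Qz (r, z)) (at z)"
      by simp
  qed (use v in auto)
  define L where "L x = u (cyl \<phi> x) * cos (\<beta> * \<phi>) *
          (fst x * \<psi>rr x + \<psi>r x + fst x * \<psi>zz x - \<beta>\<^sup>2 * \<psi> x / fst x)" for x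
  have cL: "continuous_on B L"
  proof -
    have "continuous_on (?U \<times> B) (\<lambda>(\<phi>, x). u (cyl \<phi> x) * cos (\<beta> * \<phi>) *
          (fst x * \<psi>rr x + \<psi>r x + fst x * \<psi>zz x - \<beta>\<^sup>2 * \<psi> x / fst x))"
      unfolding case_prod_unfold by (intro continuous_intros CI E mv) (auto dest: B1)
    from slice[OF this \<phi>U] show ?thesis by (simp add: L_def[abs_def])
  qed
  have eq: "f' \<phi> x = - (Pr x + Qz x + L x)" if "x \<in> B" for x
  proof -
    have "cyl \<phi> x \<in> \<Omega>" using dom \<phi> that by auto
    then have e: "angular \<phi> \<bullet> (H (cyl \<phi> x) *v angular \<phi>) =
       - (t \<bullet> (H (cyl \<phi> x) *v t)) - radial \<phi> \<bullet> (H (cyl \<phi> x) *v radial \<phi>)"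
      using trace_cylindrical[of "H (cyl \<phi> x)" \<phi>] hu(3) by simp
    show ?thesis
      using B1[OF that] unfolding f'_def Pr_def Qz_def L_def e by (simp add: field_simps)
  qed
  have "integral B (f' \<phi>) = integral B (\<lambda>x. - (Pr x + Qz x + L x))"
    by (rule integral_cong) (rule eq)
  also have "\<dots> = - (integral B Pr + integral B Qz + integral B L)"
    using integrable_continuous[OF cPr[unfolded B_def]] integrable_continuous[OF cQz[unfolded B_def]]
      integrable_continuous[OF cL[unfolded B_def]]
    unfolding integral_neg B_def[symmetric] by (simp only: integral_add integrable_add)
  finally have "integral B (f' \<phi>) = - integral B L" using iP iQ by simp
  with D show ?thesis by (simp add: f_def[abs_def] L_def[abs_def])
qed

end

section \<open>Nontangential approach inside a reflex wedge\<close>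

text \<open>The point at distance \<open>r\<close> from the edge and angle \<open>\<delta>\<close> above a face has distance \<open>r sin \<delta>\<close> or \<open>r\<close> from
  the boundary, and its distance from the face point at \<open>l r\<close> is \<open>r\<close> times the square root below. For
  small \<open>\<delta>\<close> the choice \<open>l = 1\<close> gives a point of the approach region, whatever \<open>\<alpha>\<close> is; for the other angles
  the grid of step \<open>1/n\<close> meets the interval of admissible \<open>l\<close>, whose length is bounded below. The value
  \<open>l = 0\<close> is avoided, as it corresponds to the edge, where \<open>(\<nabla>u)\<^sup>*\<close> is not controlled.\<close>
lemma approach_slopes:
  fixes \<alpha> :: real
  assumes "\<alpha> > 0"
  obtains n :: nat and \<delta>\<^sub>0 where "n > 0" "\<delta>\<^sub>0 > 0" "\<delta>\<^sub>0 \<le> pi / 2"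
    "\<And>\<delta>. 0 < \<delta> \<Longrightarrow> \<delta> < 2 * pi - pi/2 \<Longrightarrow> \<exists>j\<in>{1..n}. sqrt ((cos \<delta> - real j / n)\<^sup>2 + (sin \<delta>)\<^sup>2)
        < (1 + \<alpha>) * (if \<delta> \<le> pi / 2 then sin \<delta> else 1)"
    "\<And>\<delta>. 0 < \<delta> \<Longrightarrow> \<delta> \<le> \<delta>\<^sub>0 \<Longrightarrow> sqrt ((cos \<delta> - 1)\<^sup>2 + (sin \<delta>)\<^sup>2) < (1 + \<alpha>) * sin \<delta>"
proof -
  define d0 where "d0 = arctan \<alpha>"
  have d0: "0 < d0" "d0 < pi / 2" using assms arctan_ubound by (auto simp: d0_def)
  have sd0: "0 < sin d0" using d0 by (intro sin_gt_zero) auto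
  have crit: "sqrt ((cos \<delta> - l)\<^sup>2 + (sin \<delta>)\<^sup>2) < (1 + \<alpha>) * sin \<delta>"
    if "\<bar>cos \<delta> - l\<bar> < \<alpha> * sin \<delta>" "0 < sin \<delta>" for \<delta> l
  proof -
    have "sqrt ((cos \<delta> - l)\<^sup>2 + (sin \<delta>)\<^sup>2) \<le> \<bar>cos \<delta> - l\<bar> + \<bar>sin \<delta>\<bar>"
      by (rule sqrt_sum_squares_le_sum_abs)
    then show ?thesis using that by (simp add: algebra_simps)
  qed
  have small: "sqrt ((cos \<delta> - 1)\<^sup>2 + (sin \<delta>)\<^sup>2) < (1 + \<alpha>) * sin \<delta>" if \<delta>: "0 < \<delta>" "\<delta> \<le> d0" for \<delta>
  proof (rule crit)
    let ?h = "\<delta> / 2"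
    have h: "0 < sin ?h" "0 < cos ?h" using \<delta> d0 by (auto intro!: sin_gt_zero cos_gt_zero)
    have "?h < arctan \<alpha>" using \<delta> by (simp add: d0_def)
    then have "tan ?h < tan (arctan \<alpha>)" using \<delta> d0 arctan_ubound[of \<alpha>] by (intro tan_monotone) auto
    then have "tan ?h < \<alpha>" by (simp only: tan_arctan)
    then have "sin ?h < \<alpha> * cos ?h" using h by (simp add: tan_def pos_divide_less_eq)
    then have "2 * (sin ?h * sin ?h) < 2 * (sin ?h * (\<alpha> * cos ?h))" using h by simp
    moreover have "cos \<delta> = 1 - 2 * (sin ?h * sin ?h)"
      using cos_double_sin[of ?h] by (simp add: power2_eq_square)
    moreover have "sin \<delta> = 2 * sin ?h * cos ?h" using sin_double[of ?h] by simp
    ultimately show "\<bar>cos \<delta> - 1\<bar> < \<alpha> * sin \<delta>" by (simp add: mult_ac)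
    show "0 < sin \<delta>" using \<delta> d0 by (intro sin_gt_zero) auto
  qed
  obtain n :: nat where n: "1 / (\<alpha> * sin d0) + 1 / \<alpha> < real n" using reals_Archimedean2 by blast
  have "0 < 1 / (\<alpha> * sin d0)" "0 < 1 / \<alpha>" using assms sd0 by auto
  then have n': "1 / (\<alpha> * sin d0) < real n" "1 / \<alpha> < real n" "0 < real n" using n by linarith+
  then have n1: "1 / real n < \<alpha> * sin d0" "1 / real n < \<alpha>"
    using assms sd0 by (simp_all add: field_simps)
  show ?thesis
  proof (rule that[of n d0])
    fix \<delta> :: real assume \<delta>: "0 < \<delta>" "\<delta> < 2 * pi - pi/2"
    consider "\<delta> \<le> d0" | "d0 < \<delta>" "\<delta> \<le> pi / 2" | "\<delta> > pi / 2" by linarith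
    then show "\<exists>j\<in>{1..n}. sqrt ((cos \<delta> - real j / n)\<^sup>2 + (sin \<delta>)\<^sup>2)
        < (1 + \<alpha>) * (if \<delta> \<le> pi / 2 then sin \<delta> else 1)"
    proof cases
      case 1
      then show ?thesis using small[OF \<delta>(1) 1] d0 n' by (intro bexI[of _ n]) auto
    next
      case 2
      have c: "0 \<le> cos \<delta>" "cos \<delta> \<le> 1" using 2 d0 by (auto intro!: cos_ge_zero)
      define j where "j = max 1 (nat \<lceil>n * cos \<delta>\<rceil>)"
      have "n * cos \<delta> \<le> n" using c n' by (simp add: mult_left_le)
      then have jn: "j \<in> {1..n}" using n' by (auto simp: j_def nat_le_iff ceiling_le_iff)
      have nc: "0 \<le> n * cos \<delta>" using c n' by auto
      have up: "n * cos \<delta> \<le> real j" unfolding j_def using nc by linarith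
      have lo: "real j \<le> n * cos \<delta> + 1" unfolding j_def using nc by linarith
      have "\<bar>cos \<delta> - real j / n\<bar> = \<bar>n * cos \<delta> - real j\<bar> / n"
      proof -
        have "cos \<delta> - real j / n = (n * cos \<delta> - real j) / n"
          using n' by (simp add: diff_divide_distrib)
        then show ?thesis using n' by (simp only: abs_divide abs_of_pos)
      qed
      also have "\<dots> \<le> 1 / n" using up lo by (intro divide_right_mono) auto
      also have "\<dots> < \<alpha> * sin d0" by (rule n1)
      also have "\<dots> \<le> \<alpha> * sin \<delta>" using 2 d0 assms by (auto intro!: sin_monotone_2pi_le)
      finally show ?thesis using 2 d0 by (intro bexI[OF _ jn]) (auto intro!: crit sin_gt_zero)
    next
      case 3
      have "0 \<le> (2 / n) * (1 + cos \<delta>)"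
      proof -
        have "0 \<le> 1 + cos \<delta>" using cos_ge_minus_one[of \<delta>] by linarith
        then show ?thesis by simp
      qed
      moreover have "(sin \<delta>)\<^sup>2 = 1 - (cos \<delta>)\<^sup>2" by (rule sin_squared_eq)
      ultimately have "(cos \<delta> - real 1 / n)\<^sup>2 + (sin \<delta>)\<^sup>2 \<le> (1 + 1 / n)\<^sup>2"
        by (simp add: power2_eq_square algebra_simps add_divide_distrib diff_divide_distrib)
      then have "sqrt ((cos \<delta> - real 1 / n)\<^sup>2 + (sin \<delta>)\<^sup>2) \<le> 1 + 1 / n"
        using n' by (intro real_le_lsqrt) auto
      also have "\<dots> < 1 + \<alpha>" using n1 by simp
      finally show ?thesis using 3 n' by (intro bexI[of _ 1]) auto
    qed
  qed (use d0 n' small in auto)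
qed

context orthonormal_frame begin

text \<open>A vector orthogonal to the whole frame has zero trace of its outer square, that is, zero norm.\<close>
lemma frame_expansion: "v = (v \<bullet> t) *\<^sub>R t + (v \<bullet> radial \<psi>) *\<^sub>R radial \<psi> + (v \<bullet> angular \<psi>) *\<^sub>R angular \<psi>"
proof -
  define w where "w = v - ((v \<bullet> t) *\<^sub>R t + (v \<bullet> radial \<psi>) *\<^sub>R radial \<psi> + (v \<bullet> angular \<psi>) *\<^sub>R angular \<psi>)"
  have o: "t \<bullet> w = 0" "radial \<psi> \<bullet> w = 0" "angular \<psi> \<bullet> w = 0"
    using radial_inner_angular[of \<psi> \<psi>] radial_inner[of \<psi> \<psi>] angular_inner[of \<psi> \<psi>]
    by (simp_all add: w_def inner_diff_right inner_add_right inner_commute[of v]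
        inner_commute[of "angular \<psi>" "radial \<psi>"])
  define H :: "real^3^3" where "H = (\<chi> i j. w $ i * w $ j)"
  have H: "H *v x = (w \<bullet> x) *\<^sub>R w" for x
    by (simp add: H_def vec_eq_iff matrix_vector_mult_def inner_vec_def sum_distrib_left mult_ac)
  have "trace H = w \<bullet> w" by (simp add: trace_def H_def inner_vec_def)
  also have "trace H = 0" unfolding trace_cylindrical[of H \<psi>] H by (simp add: o)
  finally show ?thesis by (simp add: w_def)
qed

lemma radial_add: "radial (\<psi> + \<delta>) = cos \<delta> *\<^sub>R radial \<psi> + sin \<delta> *\<^sub>R angular \<psi>"
  by (simp add: radial_def angular_def cos_add sin_add scaleR_add_left scaleR_add_right scaleR_diff_left algebra_simps)

lemma half_space_polar:
  assumes "0 < (Y - p) \<bullet> radial \<psi>"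
  obtains r \<phi> z where "0 < r" "\<psi> - pi / 2 < \<phi>" "\<phi> < \<psi> + pi / 2" "Y = cyl \<phi> (r, z)"
proof -
  define A B where "A = (Y - p) \<bullet> radial \<psi>" "B = (Y - p) \<bullet> angular \<psi>"
  define r where "r = sqrt (A\<^sup>2 + B\<^sup>2)"
  have A: "A > 0" using assms by (simp add: A_B_def)
  have r: "r > 0" using A by (simp add: r_def add_pos_nonneg)
  define \<delta> where "\<delta> = arctan (B / A)"
  have "sqrt (1 + (B / A)\<^sup>2) = r / A"
  proof (rule real_sqrt_unique)
    show "(r / A)\<^sup>2 = 1 + (B / A)\<^sup>2"
      using A by (simp add: r_def power_divide add_divide_distrib)
  qed (use A r in auto)
  then have "cos \<delta> = A / r" "sin \<delta> = B / r"
    using A r by (simp_all add: \<delta>_def cos_arctan sin_arctan)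
  then have "r * cos \<delta> = A" "r * sin \<delta> = B" using r by simp_all
  then have "r *\<^sub>R radial (\<psi> + \<delta>) = A *\<^sub>R radial \<psi> + B *\<^sub>R angular \<psi>"
    by (simp only: radial_add scaleR_add_right scaleR_scaleR)
  moreover have "Y - p = ((Y - p) \<bullet> t) *\<^sub>R t + A *\<^sub>R radial \<psi> + B *\<^sub>R angular \<psi>"
    unfolding A_B_def by (rule frame_expansion)
  ultimately have "cyl (\<psi> + \<delta>) (r, (Y - p) \<bullet> t) = Y"
    by (simp add: cyl_def diff_eq_eq ac_simps)
  moreover have "- (pi / 2) < \<delta>" "\<delta> < pi / 2" using arctan_bounded by (auto simp: \<delta>_def)
  ultimately show ?thesis using that[of r "\<psi> + \<delta>" "(Y - p) \<bullet> t"] r by simp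
qed

lemma norm_cyl: "norm (cyl \<phi> x - p) = norm x"
  by (cases x) (simp add: cyl_def norm_eq_sqrt_inner inner_add_left inner_add_right norm_Pair power2_eq_square
       radial_inner[of \<phi> \<phi>, simplified] inner_commute norm_prod_def add.commute flip: power2_eq_square)

lemma dist_cyl: 
  assumes "0 < r"
  shows "norm (cyl \<phi> (r, z) - cyl \<omega> (l * r, z)) = r * sqrt ((cos (\<phi> - \<omega>) - l)\<^sup>2 + (sin (\<phi> - \<omega>))\<^sup>2)"
proof -
  have "cyl \<phi> (r, z) - cyl \<omega> (l * r, z) = r *\<^sub>R (radial \<phi> - l *\<^sub>R radial \<omega>)"
    by (simp add: cyl_def algebra_simps)
  moreover have "(norm (radial \<phi> - l *\<^sub>R radial \<omega>))\<^sup>2 = (cos (\<phi> - \<omega>) - l)\<^sup>2 + (sin (\<phi> - \<omega>))\<^sup>2"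
  proof -
    have "(norm (radial \<phi> - l *\<^sub>R radial \<omega>))\<^sup>2 = 1 - 2 * l * cos (\<phi> - \<omega>) + l * l"
      using cos_minus[of "\<phi> - \<omega>"]
      by (simp add: power2_norm_eq_inner inner_diff_left inner_diff_right radial_inner algebra_simps)
    moreover have "(sin (\<phi> - \<omega>))\<^sup>2 = 1 - (cos (\<phi> - \<omega>))\<^sup>2" by (rule sin_squared_eq)
    ultimately show ?thesis by (simp add: power2_eq_square algebra_simps)
  qed
  ultimately show ?thesis using assms by (simp add: real_sqrt_unique)
qed


end

text \<open>In the ball of radius \<open>\<rho>\<close> around \<open>p\<close> nothing is assumed outside the wedge: several wedges of the
  domain may meet at one edge.\<close>
locale polyhedral_wedge = orthonormal_frame p t a b for p t a b :: "real^3" +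
  fixes \<Omega> :: "(real^3) set" and \<alpha> \<theta> \<rho> :: real
  assumes \<theta>: "pi \<le> \<theta>" "\<theta> < 2 * pi" and \<rho>: "0 < \<rho>" and \<alpha>: "0 < \<alpha>"
    and \<Omega>: "open \<Omega>" "frontier \<Omega> \<noteq> {}"
    and wedge: "\<And>\<phi> x. 0 < fst x \<Longrightarrow> 0 < \<phi> \<Longrightarrow> \<phi> < \<theta> \<Longrightarrow> norm x < \<rho> \<Longrightarrow> cyl \<phi> x \<in> \<Omega>"
begin

text \<open>Since \<open>\<theta> \<ge> \<pi>\<close>, for each \<open>\<psi>\<close> in \<open>[\<pi>/2, \<theta> - \<pi>/2]\<close> the wedge contains the open half space around
  direction \<open>\<psi>\<close>, and the distance of the point from the complement of that half space is
  \<open>r cos (\<phi> - \<psi>)\<close>. The bound \<open>\<rho> / 2\<close> keeps the ball of that radius inside the ball where the geometry is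
  known.\<close>
lemma infdist_frontier_ge:
  assumes \<psi>: "pi / 2 \<le> \<psi>" "\<psi> \<le> \<theta> - pi / 2" and r: "0 < r" and X: "norm (r, z) < \<rho> / 2"
  shows "r * cos (\<phi> - \<psi>) \<le> infdist (cyl \<phi> (r, z)) (frontier \<Omega>)"
  unfolding infdist_notempty[OF \<Omega>(2)]
proof (rule cINF_greatest[OF \<Omega>(2)], rule ccontr)
  fix Y assume Y: "Y \<in> frontier \<Omega>" and "\<not> r * cos (\<phi> - \<psi>) \<le> dist (cyl \<phi> (r, z)) Y"
  then have d: "dist (cyl \<phi> (r, z)) Y < r * cos (\<phi> - \<psi>)" by simp
  have "(cyl \<phi> (r, z) - Y) \<bullet> radial \<psi> \<le> norm (cyl \<phi> (r, z) - Y) * norm (radial \<psi>)"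
    by (rule norm_cauchy_schwarz)
  also have "\<dots> < r * cos (\<phi> - \<psi>)" using d by (simp add: dist_norm)
  also have "\<dots> = (cyl \<phi> (r, z) - p) \<bullet> radial \<psi>"
    by (simp add: cyl_def inner_add_left radial_inner)
  finally have "0 < (Y - p) \<bullet> radial \<psi>" by (simp add: inner_diff_left)
  then obtain r' \<phi>' z' where Y': "0 < r'" "\<psi> - pi / 2 < \<phi>'" "\<phi>' < \<psi> + pi / 2" "Y = cyl \<phi>' (r', z')"
    by (rule half_space_polar)
  have "norm (r', z') = norm (Y - p)" by (simp add: Y' norm_cyl)
  also have "\<dots> \<le> norm (cyl \<phi> (r, z) - p) + dist (cyl \<phi> (r, z)) Y"
    using norm_triangle_sub[of "Y - p" "cyl \<phi> (r, z) - p"] by (simp add: dist_norm norm_minus_commute)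
  also have "\<dots> < norm (r, z) + r * 1"
  proof -
    have "r * cos (\<phi> - \<psi>) \<le> r * 1" using r by (intro mult_left_mono) auto
    then show ?thesis using d by (simp add: norm_cyl)
  qed
  also have "r * 1 \<le> norm (r, z)" using r norm_fst_le[of r z] by simp
  finally have "norm (r', z') < \<rho>" using X by simp
  then have "Y \<in> \<Omega>" using wedge[of "(r', z')" \<phi>'] Y' \<psi> by simp
  with Y \<Omega>(1) show False by (simp add: frontier_def interior_open)
qed

text \<open>The angle \<open>\<delta>\<close> is measured from the face \<open>\<omega>\<close>. The best half space is the one whose direction is
  nearest to \<open>\<phi>\<close>: normal to the face if \<open>\<delta> \<le> \<pi>/2\<close>, and \<open>\<phi>\<close> itself otherwise.\<close>
lemma approach_regionI:
  assumes \<phi>: "0 < \<phi>" "\<phi> < \<theta>" and r: "0 < r" and X: "norm (r, z) < \<rho> / 2"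
    and \<omega>: "\<omega> = 0 \<and> \<delta> = \<phi> \<or> \<omega> = \<theta> \<and> \<delta> = \<theta> - \<phi>" and \<delta>: "\<delta> \<le> \<theta> - pi / 2"
    and s: "sqrt ((cos \<delta> - l)\<^sup>2 + (sin \<delta>)\<^sup>2) < (1 + \<alpha>) * (if \<delta> \<le> pi / 2 then sin \<delta> else 1)"
  shows "cyl \<phi> (r, z) \<in> approach_region \<alpha> \<Omega> (cyl \<omega> (l * r, z))"
proof -
  have \<delta>0: "0 < \<delta>" using \<omega> \<phi> by auto
  define \<psi> where "\<psi> = (if \<omega> = 0 \<and> \<delta> = \<phi> then max (pi / 2) \<phi> else min (\<theta> - pi / 2) \<phi>)"
  have \<psi>: "pi / 2 \<le> \<psi>" "\<psi> \<le> \<theta> - pi / 2" using \<omega> \<theta> \<delta> by (auto simp: \<psi>_def min_def)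
  have "cos (\<phi> - \<psi>) = (if \<delta> \<le> pi / 2 then sin \<delta> else 1)"
  proof (cases "\<omega> = 0 \<and> \<delta> = \<phi>")
    case True
    have "cos (\<phi> - pi / 2) = sin \<phi>" by (simp add: cos_diff)
    moreover have "\<psi> = (if \<delta> \<le> pi / 2 then pi / 2 else \<phi>)"
      using True unfolding \<psi>_def max_def by auto
    ultimately show ?thesis using True by simp
  next
    case False
    then have B: "\<delta> = \<theta> - \<phi>" using \<omega> by auto
    have "\<phi> - (\<theta> - pi / 2) = pi / 2 - \<delta>" using B by simp
    then have "cos (\<phi> - (\<theta> - pi / 2)) = cos (pi / 2 - \<delta>)" by (simp only:)
    also have "\<dots> = sin \<delta>" by (simp add: cos_diff)
    finally have "cos (\<phi> - (\<theta> - pi / 2)) = sin \<delta>" .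
    moreover have "\<psi> = (if \<delta> \<le> pi / 2 then \<theta> - pi / 2 else \<phi>)"
      using False B unfolding \<psi>_def min_def by auto
    ultimately show ?thesis by simp
  qed
  then have "r * (if \<delta> \<le> pi / 2 then sin \<delta> else 1) \<le> infdist (cyl \<phi> (r, z)) (frontier \<Omega>)"
    using infdist_frontier_ge[OF \<psi> r X, of \<phi>] by simp
  then have i: "(1 + \<alpha>) * (r * (if \<delta> \<le> pi / 2 then sin \<delta> else 1)) \<le> (1 + \<alpha>) * infdist (cyl \<phi> (r, z)) (frontier \<Omega>)"
    using \<alpha> by (intro mult_left_mono) auto
  have c: "cos (\<phi> - \<omega>) = cos \<delta>" "(sin (\<phi> - \<omega>))\<^sup>2 = (sin \<delta>)\<^sup>2"
  proof -
    have "\<phi> - \<omega> = \<delta> \<or> \<phi> - \<omega> = - \<delta>" using \<omega> by auto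
    then show "cos (\<phi> - \<omega>) = cos \<delta>" "(sin (\<phi> - \<omega>))\<^sup>2 = (sin \<delta>)\<^sup>2" by auto
  qed
  have "norm (cyl \<phi> (r, z) - cyl \<omega> (l * r, z)) = r * sqrt ((cos \<delta> - l)\<^sup>2 + (sin \<delta>)\<^sup>2)"
    by (simp only: dist_cyl[OF r] c)
  also have "\<dots> < r * ((1 + \<alpha>) * (if \<delta> \<le> pi / 2 then sin \<delta> else 1))"
    using s r by (rule mult_strict_left_mono)
  finally have "norm (cyl \<phi> (r, z) - cyl \<omega> (l * r, z)) < (1 + \<alpha>) * infdist (cyl \<phi> (r, z)) (frontier \<Omega>)"
    using i by (simp only: mult_ac)
  moreover have "cyl \<phi> (r, z) \<in> \<Omega>" using wedge[of "(r, z)" \<phi>] r X \<phi> \<rho> by simp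
  ultimately show ?thesis by (simp add: approach_region_def)
qed

end

section \<open>Surface measure in face coordinates\<close>

text \<open>The charts of the faces are chosen arbitrarily among the isometries, so surface integrals can be
  computed in the coordinates \<open>(r, z)\<close> only because plane Lebesgue measure is invariant under all
  isometries.\<close>
lemma distr_lborel_orthogonal:
  fixes T :: "real^'n::{finite,wellorder} \<Rightarrow> real^'n::_"
  assumes T: "orthogonal_transformation T"
  shows "distr lborel borel T = lborel"
proof (rule lborel_eqI[symmetric])
  fix l u :: "real^'n::_" assume lu: "\<And>b. b \<in> Basis \<Longrightarrow> l \<bullet> b \<le> u \<bullet> b"
  have bij: "bij T" by (rule orthogonal_transformation_bij[OF T])
  have T': "orthogonal_transformation (inv T)" by (rule orthogonal_transformation_inv[OF T])
  have [measurable]: "T \<in> borel_measurable borel"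
    using T by (intro borel_measurable_continuous_onI linear_continuous_on)
      (simp add: orthogonal_transformation_linear linear_linear)
  have eq: "T -` box l u = inv T ` box l u" using bij by (rule bij_vimage_eq_inv_image)
  have fin: "inv T ` box l u \<in> lmeasurable" by (rule measurable_orthogonal_image[OF T' lmeasurable_box])
  have bor: "inv T ` box l u \<in> sets borel"
    using measurable_sets[of T borel borel "box l u"] eq by simp
  have "emeasure (distr lborel borel T) (box l u) = emeasure lborel (inv T ` box l u)"
    by (subst emeasure_distr) (auto simp: eq)
  also have "\<dots> = emeasure lebesgue (inv T ` box l u)" using bor by (simp add: emeasure_lborel_cbox)
  also have "\<dots> = measure lebesgue (inv T ` box l u)"
    using fin by (simp add: emeasure_eq_measure2 fmeasurableD2)
  also have "\<dots> = measure lebesgue (box l u)"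
    by (simp add: measure_orthogonal_image[OF T' lmeasurable_box])
  also have "\<dots> = (\<Prod>b\<in>Basis. (u - l) \<bullet> b)" using lu by (simp add: measure_lborel_box_eq)
  finally show "emeasure (distr lborel borel T) (box l u) = (\<Prod>b\<in>Basis. (u - l) \<bullet> b)" .
qed simp

definition pair_of_vec :: "real^2 \<Rightarrow> real \<times> real" where "pair_of_vec y = (y $ 1, y $ 2)"
definition vec_of_pair :: "real \<times> real \<Rightarrow> real^2" where "vec_of_pair x = vector [fst x, snd x]"

lemma pair_vec [simp]: "pair_of_vec (vec_of_pair x) = x" "vec_of_pair (pair_of_vec y) = y"
  by (simp_all add: pair_of_vec_def vec_of_pair_def vec_eq_iff forall_2)

lemma dist_vec_of_pair: "dist (vec_of_pair x) (vec_of_pair y) = dist x y"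
  by (simp add: dist_vec_def L2_set_def sum_2 vec_of_pair_def dist_prod_def)

lemma measurable_pair_of_vec [measurable]: "pair_of_vec \<in> borel_measurable borel"
  unfolding pair_of_vec_def by (intro borel_measurable_continuous_onI continuous_intros)

lemma distr_lborel_pair_of_vec: "distr lborel borel pair_of_vec = lborel"
proof (rule lborel_eqI[symmetric])
  fix l u :: "real \<times> real" assume lu: "\<And>b. b \<in> Basis \<Longrightarrow> l \<bullet> b \<le> u \<bullet> b"
  have le: "fst l \<le> fst u" "snd l \<le> snd u" using lu[of "(1,0)"] lu[of "(0,1)"]
    by (auto simp: Basis_prod_def inner_prod_def)
  have B: "(Basis :: (real^2) set) = {axis 1 1, axis 2 1}" "(Basis :: (real \<times> real) set) = {(1, 0), (0, 1)}"
    by (auto simp: Basis_vec_def Basis_prod_def) (metis exhaust_2)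
  have eq: "pair_of_vec -` box l u = box (vec_of_pair l) (vec_of_pair u)"
    by (cases l; cases u) (auto simp: pair_of_vec_def vec_of_pair_def mem_box_cart forall_2 mem_box Basis_prod_def inner_prod_def)
  have "emeasure (distr lborel borel pair_of_vec) (box l u) = emeasure lborel (box (vec_of_pair l) (vec_of_pair u))"
    by (subst emeasure_distr) (auto simp: eq)
  also have "\<dots> = (\<Prod>b\<in>Basis. (vec_of_pair u - vec_of_pair l) \<bullet> b)"
    using le by (intro emeasure_lborel_box) (auto simp: B inner_axis vec_of_pair_def)
  also have "\<dots> = (\<Prod>b\<in>Basis. (u - l) \<bullet> b)"
  proof -
    show ?thesis unfolding B by (subst prod.insert; (simp add: axis_eq_axis inner_axis vec_of_pair_def inner_prod_def)?)+
  qed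
  finally show "emeasure (distr lborel borel pair_of_vec) (box l u) = (\<Prod>b\<in>Basis. (u - l) \<bullet> b)" .
qed simp

lemma nn_integral_plane_isometry:
  fixes Q :: "real^2 \<Rightarrow> real \<times> real"
  assumes Q: "\<And>x y. dist (Q x) (Q y) = dist x y" and f [measurable]: "f \<in> borel_measurable borel"
  shows "(\<integral>\<^sup>+y. f (Q y) \<partial>lborel) = (\<integral>\<^sup>+x. f x \<partial>lborel)"
proof -
  define c where "c = vec_of_pair (Q 0)"
  define T where "T y = vec_of_pair (Q y) - c" for y
  have T: "orthogonal_transformation T"
    unfolding orthogonal_transformation_isometry
    by (simp add: T_def c_def dist_diff Q dist_vec_of_pair) (simp add: dist_norm Q[unfolded dist_norm] dist_vec_of_pair[unfolded dist_norm])
  have TQ: "Q y = pair_of_vec (c + T y)" for y by (simp add: T_def)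
  have [measurable]: "T \<in> borel_measurable borel"
    using T by (intro borel_measurable_continuous_onI linear_continuous_on)
      (simp add: orthogonal_transformation_linear linear_linear)
  have "(\<integral>\<^sup>+y. f (Q y) \<partial>lborel) = (\<integral>\<^sup>+y. f (pair_of_vec (c + y)) \<partial>distr lborel borel T)"
    unfolding TQ by (subst nn_integral_distr) auto
  also have "\<dots> = (\<integral>\<^sup>+y. f (pair_of_vec y) \<partial>distr lborel borel ((+) c))"
    unfolding distr_lborel_orthogonal[OF T] by (subst nn_integral_distr) auto
  also have "\<dots> = (\<integral>\<^sup>+x. f x \<partial>distr lborel borel pair_of_vec)"
    unfolding lborel_distr_plus by (subst nn_integral_distr) auto
  finally show ?thesis by (simp only: distr_lborel_pair_of_vec)
qed

lemma plane_chart: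
  assumes "aff_dim F = 2"
  shows "dist (plane_chart F x) (plane_chart F y) = dist x y" "range (plane_chart F) = affine hull F"
proof -
  have "F \<noteq> {}" using assms by auto
  then obtain c where c: "c \<in> affine hull F" using hull_subset by fastforce
  define S where "S = (\<lambda>v. - c + v) ` (affine hull F)"
  have S: "subspace S" unfolding S_def using affine_diffs_subspace[OF affine_affine_hull c] by simp
  have "int (dim S) = aff_dim S" using aff_dim_subspace[OF S] by simp
  also have "\<dots> = 2" unfolding S_def aff_dim_translation_eq using assms by simp
  finally have "dim (UNIV :: (real^2) set) = dim S" by simp
  then obtain f :: "real^2 \<Rightarrow> real^3" where f: "linear f" "f ` UNIV = S" "\<And>x. norm (f x) = norm x"
    using isometries_subspaces[OF subspace_UNIV S] by (metis UNIV_I)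
  let ?P = "\<lambda>h. (\<forall>x y. dist (h x) (h y) = dist x y) \<and> range h = affine hull F"
  have "?P (\<lambda>x. c + f x)"
  proof
    show "\<forall>x y. dist (c + f x) (c + f y) = dist x y"
      using f by (simp add: dist_norm flip: linear_diff)
    have "range (\<lambda>x. c + f x) = (+) c ` S" using f(2) by auto
    then show "range (\<lambda>x. c + f x) = affine hull F" by (simp add: S_def image_image)
  qed
  then have "?P (plane_chart F)" unfolding plane_chart_def by (rule someI[of ?P])
  then show "dist (plane_chart F x) (plane_chart F y) = dist x y" "range (plane_chart F) = affine hull F" by auto
qed

lemma measurable_plane_chart:
  assumes "aff_dim F = 2" shows "plane_chart F \<in> borel_measurable borel"
proof (rule borel_measurable_continuous_onI)
  show "continuous_on UNIV (plane_chart F)"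
    by (rule continuous_onI) (metis plane_chart(1)[OF assms] less_eq_real_def)
qed

lemma
  assumes "finite \<F>" and \<F>: "\<And>F. F \<in> \<F> \<Longrightarrow> closed F" "\<And>F. F \<in> \<F> \<Longrightarrow> aff_dim F = 2"
  shows space_surface_measure: "space (surface_measure \<F>) = UNIV"
    and sets_surface_measure: "sets (surface_measure \<F>) = sets borel"
    and nn_integral_surface_measure: "f \<in> borel_measurable borel \<Longrightarrow>
      (\<integral>\<^sup>+P. f P \<partial>surface_measure \<F>) =
      (\<Sum>F\<in>\<F>. \<integral>\<^sup>+y. f (plane_chart F y) * indicator F (plane_chart F y) \<partial>lborel)"
proof -
  have m: "sets borel \<subseteq> Pow (UNIV :: (real^3) set)" by simp
  have sig: "sigma_sets UNIV (sets borel) = sets (borel :: (real^3) measure)"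
    using sets.sigma_sets_eq[of "borel :: (real^3) measure"] by simp
  show sp: "space (surface_measure \<F>) = UNIV" unfolding surface_measure_def by (simp add: space_measure_of_conv)
  show se: "sets (surface_measure \<F>) = sets borel" unfolding surface_measure_def by (simp add: sig)
  have ms: "borel_measurable (surface_measure \<F>) = (borel_measurable borel :: (real^3 \<Rightarrow> ennreal) set)"
    by (rule measurable_cong_sets) (simp_all add: se)
  have mf: "(\<lambda>y. f (plane_chart F y) * indicator F (plane_chart F y)) \<in> borel_measurable lborel"
    if "F \<in> \<F>" "f \<in> borel_measurable borel" for F and f :: "real^3 \<Rightarrow> ennreal"
  proof -
    note [measurable] = measurable_plane_chart[OF \<F>(2)[OF that(1)]] that(2)
    have [measurable]: "F \<in> sets borel" using \<F>(1)[OF that(1)] by simp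
    show ?thesis by measurable
  qed
  have pre: "plane_chart F -` (A \<inter> F) \<in> sets lborel" if "F \<in> \<F>" "A \<in> sets borel" for F A
  proof -
    have "A \<inter> F \<in> sets borel" using that \<F>(1) by auto
    from measurable_sets[OF measurable_plane_chart[OF \<F>(2)[OF that(1)]] this] show ?thesis by simp
  qed
  have em: "emeasure (surface_measure \<F>) A = (\<Sum>F\<in>\<F>. emeasure lborel (plane_chart F -` (A \<inter> F)))"
    if A: "A \<in> sets borel" for A
    unfolding surface_measure_def
  proof (rule emeasure_measure_of_sigma)
    show "sigma_algebra UNIV (sets (borel :: (real^3) measure))" using sets.sigma_algebra_axioms[where M="borel :: (real^3) measure"] by (simp only: space_borel)
    show "positive (sets borel) (\<lambda>A. \<Sum>F\<in>\<F>. emeasure lborel (plane_chart F -` (A \<inter> F)))"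
      by (simp add: positive_def)
    show "countably_additive (sets borel) (\<lambda>A. \<Sum>F\<in>\<F>. emeasure lborel (plane_chart F -` (A \<inter> F)))"
    proof (rule countably_additiveI)
      fix A :: "nat \<Rightarrow> (real^3) set"
      assume A: "range A \<subseteq> sets borel" "disjoint_family A"
      have "(\<Sum>i. \<Sum>F\<in>\<F>. emeasure lborel (plane_chart F -` (A i \<inter> F))) =
          (\<Sum>F\<in>\<F>. \<Sum>i. emeasure lborel (plane_chart F -` (A i \<inter> F)))"
        by (rule suminf_sum) simp
      also have "\<dots> = (\<Sum>F\<in>\<F>. emeasure lborel (plane_chart F -` ((\<Union>i. A i) \<inter> F)))"
      proof (rule sum.cong[OF refl])
        fix F assume F: "F \<in> \<F>"
        have "plane_chart F -` (A i \<inter> F) \<in> sets lborel" for i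
          using pre[OF F, of "A i"] A(1) by auto
        moreover have "disjoint_family (\<lambda>i. plane_chart F -` (A i \<inter> F))"
          using A(2) by (auto simp: disjoint_family_on_def)
        ultimately have "(\<Sum>i. emeasure lborel (plane_chart F -` (A i \<inter> F))) =
            emeasure lborel (\<Union>i. plane_chart F -` (A i \<inter> F))"
          by (intro suminf_emeasure) auto
        also have "(\<Union>i. plane_chart F -` (A i \<inter> F)) = plane_chart F -` ((\<Union>i. A i) \<inter> F)" by auto
        finally show "(\<Sum>i. emeasure lborel (plane_chart F -` (A i \<inter> F))) =
            emeasure lborel (plane_chart F -` ((\<Union>i. A i) \<inter> F))" .
      qed
      finally show "(\<Sum>i. \<Sum>F\<in>\<F>. emeasure lborel (plane_chart F -` (A i \<inter> F))) =
          (\<Sum>F\<in>\<F>. emeasure lborel (plane_chart F -` ((\<Union>i. A i) \<inter> F)))" .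
    qed
  qed (rule A)
  show "(\<integral>\<^sup>+P. f P \<partial>surface_measure \<F>) =
      (\<Sum>F\<in>\<F>. \<integral>\<^sup>+y. f (plane_chart F y) * indicator F (plane_chart F y) \<partial>lborel)"
    if "f \<in> borel_measurable borel"
    using that
  proof (induction f rule: borel_measurable_induct)
    case (cong f g)
    then have "f = g" by auto
    then show ?case using cong by simp
  next
    case (set A)
    have "(\<integral>\<^sup>+P. indicator A P \<partial>surface_measure \<F>) = (\<Sum>F\<in>\<F>. emeasure lborel (plane_chart F -` (A \<inter> F)))"
      using set by (simp add: se em)
    also have "\<dots> = (\<Sum>F\<in>\<F>. \<integral>\<^sup>+y. indicator (plane_chart F -` (A \<inter> F)) y \<partial>lborel)"
      using pre set by (intro sum.cong) auto
    also have "\<dots> = (\<Sum>F\<in>\<F>. \<integral>\<^sup>+y. indicator A (plane_chart F y) * indicator F (plane_chart F y) \<partial>lborel)"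
      by (intro sum.cong refl nn_integral_cong) (simp add: indicator_def)
    finally show ?case .
  next
    case (mult f c)
    have "(\<integral>\<^sup>+P. c * f P \<partial>surface_measure \<F>) = c * (\<integral>\<^sup>+P. f P \<partial>surface_measure \<F>)"
      using mult by (intro nn_integral_cmult) (simp add: ms)
    also have "\<dots> = (\<Sum>F\<in>\<F>. c * (\<integral>\<^sup>+y. f (plane_chart F y) * indicator F (plane_chart F y) \<partial>lborel))"
      using mult by (simp add: sum_distrib_left)
    also have "\<dots> = (\<Sum>F\<in>\<F>. \<integral>\<^sup>+y. c * (f (plane_chart F y) * indicator F (plane_chart F y)) \<partial>lborel)"
      using mult by (intro sum.cong refl nn_integral_cmult[symmetric] mf)
    finally show ?case by (simp only: mult.assoc)
  next
    case (add f g)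
    have "(\<integral>\<^sup>+P. g P + f P \<partial>surface_measure \<F>) = (\<integral>\<^sup>+P. g P \<partial>surface_measure \<F>) + (\<integral>\<^sup>+P. f P \<partial>surface_measure \<F>)"
      using add by (intro nn_integral_add) (simp_all add: ms)
    also have "\<dots> = (\<Sum>F\<in>\<F>. (\<integral>\<^sup>+y. g (plane_chart F y) * indicator F (plane_chart F y) \<partial>lborel)
        + (\<integral>\<^sup>+y. f (plane_chart F y) * indicator F (plane_chart F y) \<partial>lborel))"
      using add by (simp add: sum.distrib)
    also have "\<dots> = (\<Sum>F\<in>\<F>. \<integral>\<^sup>+y. g (plane_chart F y) * indicator F (plane_chart F y)
        + f (plane_chart F y) * indicator F (plane_chart F y) \<partial>lborel)"
      using add by (intro sum.cong refl nn_integral_add[symmetric] mf)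
    finally show ?case by (simp only: distrib_right)
  next
    case (seq U)
    have "(\<integral>\<^sup>+P. (SUP i. U i) P \<partial>surface_measure \<F>) = (SUP i. \<integral>\<^sup>+P. U i P \<partial>surface_measure \<F>)"
      unfolding SUP_apply using seq(1,3) by (intro nn_integral_monotone_convergence_SUP) (simp_all add: ms)
    also have "\<dots> = (SUP i. \<Sum>F\<in>\<F>. \<integral>\<^sup>+y. U i (plane_chart F y) * indicator F (plane_chart F y) \<partial>lborel)"
      using seq by simp
    also have "\<dots> = (\<Sum>F\<in>\<F>. SUP i. \<integral>\<^sup>+y. U i (plane_chart F y) * indicator F (plane_chart F y) \<partial>lborel)"
      using seq(3)
      by (intro ennreal_SUP_sum monoI nn_integral_mono mult_right_mono) (auto simp: incseq_def le_fun_def)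
    also have "\<dots> = (\<Sum>F\<in>\<F>. \<integral>\<^sup>+y. (SUP i. U i (plane_chart F y) * indicator F (plane_chart F y)) \<partial>lborel)"
      using seq mf
      by (intro sum.cong refl nn_integral_monotone_convergence_SUP[symmetric] monoI)
        (auto intro!: mult_right_mono simp: incseq_def le_fun_def)
    finally show ?case by (simp add: SUP_mult_right_ennreal image_image)
  qed
qed

context orthonormal_frame begin

lemma dist_cyl_same: "dist (cyl \<omega> x) (cyl \<omega> y) = dist x y"
proof -
  have "cyl \<omega> x - cyl \<omega> y = cyl \<omega> (x - y) - p" by (simp add: cyl_def algebra_simps)
  then show ?thesis by (simp add: dist_norm norm_cyl)
qed

lemma cyl_coordinates [simp]:
  "(cyl \<omega> x - p) \<bullet> radial \<omega> = fst x" "(cyl \<omega> x - p) \<bullet> t = snd x"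
  by (simp_all add: cyl_def inner_add_left radial_inner)

lemma measurable_cyl [measurable]: "cyl \<omega> \<in> borel_measurable borel"
  unfolding cyl_def[abs_def] by (intro borel_measurable_continuous_onI continuous_intros)

text \<open>A half disc of the half plane \<open>\<omega>\<close> already spans a plane, and \<open>F\<close> is two-dimensional.\<close>
lemma affine_hull_face:
  assumes "aff_dim F = 2" "0 < \<rho>" and F: "\<And>x. 0 \<le> fst x \<Longrightarrow> norm x < \<rho> \<Longrightarrow> cyl \<omega> x \<in> F"
  shows "affine hull F = range (cyl \<omega>)"
proof (rule sym, rule affine_dim_equal)
  have "t \<noteq> 0" "radial \<omega> \<noteq> 0" using norm_radial[of \<omega>] frame(1) by (metis norm_zero zero_neq_one)+
  then have ind: "independent {t, radial \<omega>}"
    by (intro pairwise_orthogonal_independent) (simp_all add: pairwise_insert orthogonal_def)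
  have ne: "t \<noteq> radial \<omega>" using t_radial(1)[of \<omega>] frame_inner(1) by (metis zero_neq_one)
  have r: "range (cyl \<omega>) = (+) p ` span {t, radial \<omega>}"
  proof safe
    fix r z show "cyl \<omega> (r, z) \<in> (+) p ` span {t, radial \<omega>}"
    proof (rule image_eqI[of _ _ "z *\<^sub>R t + r *\<^sub>R radial \<omega>"])
      show "z *\<^sub>R t + r *\<^sub>R radial \<omega> \<in> span {t, radial \<omega>}"
        by (intro span_add span_scale span_base) simp_all
    qed (simp add: cyl_def)
  next
    fix v assume "v \<in> span {t, radial \<omega>}"
    then obtain z where "v - z *\<^sub>R t \<in> span {radial \<omega>}" by (auto simp: span_insert)
    then obtain r where "v - z *\<^sub>R t = r *\<^sub>R radial \<omega>" by (auto simp: span_singleton)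
    then have "v = z *\<^sub>R t + r *\<^sub>R radial \<omega>" by (simp add: algebra_simps)
    then show "p + v \<in> range (cyl \<omega>)"
      by (intro image_eqI[of _ _ "(r, z)"]) (simp_all add: cyl_def)
  qed
  show "affine (range (cyl \<omega>))" unfolding r using affine_translation subspace_imp_affine subspace_span by blast
  have "dim (span {t, radial \<omega>}) = 2" using dim_span_eq_card_independent[OF ind] ne by simp
  then show "aff_dim (range (cyl \<omega>)) = aff_dim (affine hull F)"
    unfolding r aff_dim_translation_eq using assms(1) aff_dim_subspace[OF subspace_span, of "{t, radial \<omega>}"] by simp
  show "range (cyl \<omega>) \<subseteq> affine hull F"
  proof safe
    fix r z
    define c where "c = \<rho> / 2"
    have c: "0 < c" "c < \<rho>" using assms(2) by (auto simp: c_def)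
    have "{cyl \<omega> 0, cyl \<omega> (c, 0), cyl \<omega> (0, c)} \<subseteq> F"
      using c by (auto intro!: F simp: norm_Pair)
    then have "affine hull {cyl \<omega> 0, cyl \<omega> (c, 0), cyl \<omega> (0, c)} \<subseteq> affine hull F" by (rule hull_mono)
    moreover have "cyl \<omega> (r, z) = (1 - r / c - z / c) *\<^sub>R cyl \<omega> 0 + (r / c) *\<^sub>R cyl \<omega> (c, 0) + (z / c) *\<^sub>R cyl \<omega> (0, c)"
      using c by (simp add: cyl_def algebra_simps)
    then have "cyl \<omega> (r, z) \<in> affine hull {cyl \<omega> 0, cyl \<omega> (c, 0), cyl \<omega> (0, c)}"
      unfolding affine_hull_3
      by (intro CollectI exI[of _ "1 - r / c - z / c"] exI[of _ "r / c"] exI[of _ "z / c"] conjI) auto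
    ultimately show "cyl \<omega> (r, z) \<in> affine hull F" by blast
  qed
qed auto

lemma nn_integral_face:
  assumes F: "aff_dim F = 2" "closed F" "affine hull F = range (cyl \<omega>)" and f: "f \<in> borel_measurable borel"
  shows "(\<integral>\<^sup>+y. f (plane_chart F y) * indicator F (plane_chart F y) \<partial>lborel) =
    (\<integral>\<^sup>+x. f (cyl \<omega> x) * indicator F (cyl \<omega> x) \<partial>lborel)"
proof -
  define Q where "Q y = ((plane_chart F y - p) \<bullet> radial \<omega>, (plane_chart F y - p) \<bullet> t)" for y
  have Q: "cyl \<omega> (Q y) = plane_chart F y" for y
  proof -
    have "plane_chart F y \<in> range (cyl \<omega>)" using plane_chart(2)[OF F(1)] F(3) by auto
    then obtain x where "plane_chart F y = cyl \<omega> x" by auto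
    then show ?thesis by (simp add: Q_def)
  qed
  have "dist (Q x) (Q y) = dist x y" for x y
    using dist_cyl_same[of \<omega> "Q x" "Q y"] by (simp add: Q plane_chart(1)[OF F(1)])
  moreover have "(\<lambda>x. f (cyl \<omega> x) * indicator F (cyl \<omega> x)) \<in> borel_measurable borel"
  proof -
    note [measurable] = f
    have [measurable]: "F \<in> sets borel" using F by simp
    show ?thesis by measurable
  qed
  ultimately show ?thesis using nn_integral_plane_isometry[of Q "\<lambda>x. f (cyl \<omega> x) * indicator F (cyl \<omega> x)"]
    by (simp add: Q)
qed

lemma face_rel_interior:
  assumes "affine hull F = range (cyl \<omega>)" and F: "\<And>x. 0 \<le> fst x \<Longrightarrow> norm x < \<rho> \<Longrightarrow> cyl \<omega> x \<in> F"
    and x: "0 < fst x" "norm x < \<rho>"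
  shows "cyl \<omega> x \<in> rel_interior F"
  unfolding mem_rel_interior_ball
proof (intro conjI exI)
  define e where "e = min (fst x) (\<rho> - norm x)"
  show "cyl \<omega> x \<in> F" using F x by simp
  show "0 < e" using x by (simp add: e_def)
  show "ball (cyl \<omega> x) e \<inter> affine hull F \<subseteq> F"
  proof safe
    fix Y assume Y: "Y \<in> ball (cyl \<omega> x) e" "Y \<in> affine hull F"
    then obtain y where y: "Y = cyl \<omega> y" using assms(1) by auto
    with Y have d: "dist x y < e" by (simp add: dist_cyl_same)
    have "dist (fst x) (fst y) < e" using d dist_fst_le[of x y] by linarith
    then have "0 \<le> fst y" by (auto simp: e_def dist_real_def)
    moreover have "norm y < \<rho>" using d norm_triangle_sub[of y x] by (auto simp: e_def dist_norm norm_minus_commute)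
    ultimately show "Y \<in> F" unfolding y by (rule F)
  qed
qed

end

section \<open>Testing a solution of the mixed problem in the wedge\<close>

context polyhedral_wedge begin

definition region :: "(real \<times> real) set" where "region = {x. 0 < fst x \<and> norm x < \<rho> / 2}"

lemma sector_in_domain:
  assumes "0 < \<phi>" "\<phi> < \<theta>" "x \<in> region" shows "cyl \<phi> x \<in> \<Omega>"
  using assms wedge[of x \<phi>] \<rho> by (auto simp: region_def)

lemma u_increment:
  assumes h: "harmonic_on u \<Omega>" and x: "x \<in> region"
    and S: "\<And>\<phi>. 0 < \<phi> \<Longrightarrow> \<phi> < \<theta> \<Longrightarrow> norm (grad u (cyl \<phi> x)) \<le> S"
    and \<phi>: "0 < \<phi>" "\<phi> < \<phi>'" "\<phi>' < \<theta>"
  shows "\<bar>u (cyl \<phi>' x) - u (cyl \<phi> x)\<bar> \<le> \<theta> * fst x * S"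
proof -
  have d: "((\<lambda>\<phi>. u (cyl \<phi> x)) has_real_derivative grad u (cyl \<omega> x) \<bullet> (fst x *\<^sub>R angular \<omega>)) (at \<omega>)"
    if "0 < \<omega>" "\<omega> < \<theta>" for \<omega>
    using that h sector_in_domain[OF that x]
    by (intro function_along_path cyl_vector_derivatives) (auto simp: harmonic_on_def)
  obtain \<omega> where \<omega>: "\<phi> < \<omega>" "\<omega> < \<phi>'"
      "u (cyl \<phi>' x) - u (cyl \<phi> x) = (\<phi>' - \<phi>) * (grad u (cyl \<omega> x) \<bullet> (fst x *\<^sub>R angular \<omega>))"
  proof -
    have "((\<lambda>\<phi>. u (cyl \<phi> x)) has_real_derivative grad u (cyl \<omega> x) \<bullet> (fst x *\<^sub>R angular \<omega>)) (at \<omega>)"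
      if "\<phi> \<le> \<omega>" "\<omega> \<le> \<phi>'" for \<omega> using that \<phi> by (intro d) auto
    from MVT2[OF \<phi>(2) this] show ?thesis using that by blast
  qed
  have S0: "0 \<le> S" using S[of \<phi>] \<phi> norm_ge_zero[of "grad u (cyl \<phi> x)"] by linarith
  have r: "0 < fst x" using x by (simp add: region_def)
  have "\<bar>grad u (cyl \<omega> x) \<bullet> (fst x *\<^sub>R angular \<omega>)\<bar> \<le> norm (grad u (cyl \<omega> x)) * norm (fst x *\<^sub>R angular \<omega>)"
    by (rule Cauchy_Schwarz_ineq2)
  also have "\<dots> \<le> S * fst x" using S[of \<omega>] \<omega> \<phi> r by (simp add: mult_right_mono)
  finally have "\<bar>u (cyl \<phi>' x) - u (cyl \<phi> x)\<bar> \<le> (\<phi>' - \<phi>) * (S * fst x)"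
    unfolding \<omega>(3) abs_mult using \<phi> by (intro mult_mono) auto
  also have "\<dots> \<le> \<theta> * (S * fst x)" using \<phi> S0 r by (intro mult_right_mono) auto
  finally show ?thesis by (simp add: mult_ac)
qed

text \<open>The Dirichlet datum is \<open>0\<close>, so \<open>u\<close> is bounded by its increment along the arc from the Dirichlet face.\<close>
lemma u_bound:
  assumes h: "harmonic_on u \<Omega>" and x: "x \<in> region"
    and S: "\<And>\<phi>. 0 < \<phi> \<Longrightarrow> \<phi> < \<theta> \<Longrightarrow> norm (grad u (cyl \<phi> x)) \<le> S"
    and lim: "((\<lambda>\<phi>. u (cyl \<phi> x)) \<longlongrightarrow> 0) (at_left \<theta>)"
    and \<phi>: "0 < \<phi>" "\<phi> < \<theta>"
  shows "\<bar>u (cyl \<phi> x)\<bar> \<le> \<theta> * fst x * S"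
proof -
  have "((\<lambda>\<phi>'. \<bar>u (cyl \<phi>' x) - u (cyl \<phi> x)\<bar>) \<longlongrightarrow> \<bar>0 - u (cyl \<phi> x)\<bar>) (at_left \<theta>)"
    by (intro tendsto_intros lim)
  moreover have "eventually (\<lambda>\<phi>'. \<bar>u (cyl \<phi>' x) - u (cyl \<phi> x)\<bar> \<le> \<theta> * fst x * S) (at_left \<theta>)"
    using eventually_at_left_real[OF \<phi>(2)]
    by eventually_elim (use u_increment[OF h x S \<phi>(1)] in auto)
  ultimately show ?thesis using tendsto_upperbound[where F="at_left \<theta>"] by fastforce
qed

definition \<beta> :: real where "\<beta> = pi / (2 * \<theta>)"

lemma \<beta>: "0 < \<beta>" "\<beta> \<le> 1 / 2" "\<beta> * \<theta> = pi / 2"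
  using \<theta> pi_gt_zero by (simp_all add: \<beta>_def field_simps)

text \<open>The flux tends to \<open>- \<integral> g \<psi>\<close> at the Neumann face, where \<open>sin (\<beta> \<phi>)\<close> vanishes, and to \<open>0\<close> at the
  Dirichlet face, where \<open>cos (\<beta> \<phi>)\<close> and \<open>u\<close> vanish. Its variation in between is at most \<open>\<theta>\<close> times the
  supremum of its derivative, which \<open>u_bound\<close> controls; this costs a second factor \<open>\<theta>\<close>.\<close>
lemma test_inequality:
  fixes \<psi> \<psi>r \<psi>z \<psi>rr \<psi>zz S g :: "real \<times> real \<Rightarrow> real" and r1 r2 z1 z2 :: real
  defines "B \<equiv> cbox (r1, z1) (r2, z2)"
  defines "\<Lambda> \<equiv> \<lambda>x. fst x * \<psi>rr x + \<psi>r x + fst x * \<psi>zz x - \<beta>\<^sup>2 * \<psi> x / fst x"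
  assumes h: "harmonic_on u \<Omega>"
    and S[measurable]: "S \<in> borel_measurable borel" and Sint: "set_integrable lborel B S"
    and g[measurable]: "g \<in> borel_measurable borel"
    and bound: "AE x in lborel. x \<in> region \<longrightarrow> (\<forall>\<phi>. 0 < \<phi> \<longrightarrow> \<phi> < \<theta> \<longrightarrow> norm (grad u (cyl \<phi> x)) \<le> S x)"
    and dirichlet: "AE x in lborel. x \<in> region \<longrightarrow> ((\<lambda>\<phi>. u (cyl \<phi> x)) \<longlongrightarrow> 0) (at_left \<theta>)"
    and neumann: "AE x in lborel. x \<in> region \<longrightarrow> ((\<lambda>\<phi>. - b \<bullet> grad u (cyl \<phi> x)) \<longlongrightarrow> g x) (at_right 0)"
    and box: "B \<subseteq> region" "r1 \<le> r2" "z1 \<le> z2"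
    and d: "\<And>r z. (r, z) \<in> B \<Longrightarrow> ((\<lambda>r. \<psi> (r, z)) has_real_derivative \<psi>r (r, z)) (at r)"
      "\<And>r z. (r, z) \<in> B \<Longrightarrow> ((\<lambda>r. \<psi>r (r, z)) has_real_derivative \<psi>rr (r, z)) (at r)"
      "\<And>r z. (r, z) \<in> B \<Longrightarrow> ((\<lambda>z. \<psi> (r, z)) has_real_derivative \<psi>z (r, z)) (at z)"
      "\<And>r z. (r, z) \<in> B \<Longrightarrow> ((\<lambda>z. \<psi>z (r, z)) has_real_derivative \<psi>zz (r, z)) (at z)"
    and c: "continuous_on B \<psi>" "continuous_on B \<psi>r" "continuous_on B \<psi>rr" "continuous_on B \<psi>zz"
    and v: "\<And>z. \<psi> (r1, z) = 0" "\<And>z. \<psi>r (r1, z) = 0" "\<And>z. \<psi> (r2, z) = 0" "\<And>z. \<psi>r (r2, z) = 0"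
      "\<And>r. \<psi> (r, z1) = 0" "\<And>r. \<psi>z (r, z1) = 0" "\<And>r. \<psi> (r, z2) = 0" "\<And>r. \<psi>z (r, z2) = 0"
    and pos: "\<And>x. 0 \<le> \<psi> x" "\<And>x. 0 \<le> g x"
  shows "(\<integral>\<^sup>+x\<in>B. ennreal (g x * \<psi> x) \<partial>lborel) \<le> ennreal (\<theta>\<^sup>2) * (\<integral>\<^sup>+x\<in>B. ennreal (S x * (fst x * \<bar>\<Lambda> x\<bar>)) \<partial>lborel)"
proof -
  have \<theta>0: "0 < \<theta>" using \<theta> pi_gt_zero by linarith
  have B1: "0 < fst x" if "x \<in> B" for x using that box by (auto simp: region_def)
  have [measurable]: "B \<in> sets borel" by (simp add: B_def)
  have cu: "continuous_on \<Omega> u" "continuous_on \<Omega> (grad u)"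
    using h unfolding harmonic_on_def
    by (intro continuous_at_imp_continuous_on ballI differentiable_imp_continuous_within; blast)+
  have cs: "continuous_on B (cyl \<phi>)" for \<phi> unfolding cyl_def[abs_def] by (intro continuous_intros)
  have CU: "continuous_on B (\<lambda>x. u (cyl \<phi> x))" "continuous_on B (\<lambda>x. grad u (cyl \<phi> x))" if "0 < \<phi>" "\<phi> < \<theta>" for \<phi>
    using sector_in_domain[OF that] box
    by (intro continuous_on_compose2[OF cu(1) cs] continuous_on_compose2[OF cu(2) cs]; blast)+
  (* q is the flux density, and L minus the density of its derivative *)
  define q where "q \<phi> x = \<psi> x * (grad u (cyl \<phi> x) \<bullet> angular \<phi>) * cos (\<beta> * \<phi>)
                + \<beta> * \<psi> x / fst x * u (cyl \<phi> x) * sin (\<beta> * \<phi>)" for \<phi> x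
  define L where "L \<phi> x = u (cyl \<phi> x) * cos (\<beta> * \<phi>) * \<Lambda> x" for \<phi> x
  define \<Theta> where "\<Theta> \<phi> = integral B (q \<phi>)" for \<phi>
  have cq: "continuous_on B (q \<phi>)" if "0 < \<phi>" "\<phi> < \<theta>" for \<phi>
    unfolding q_def by (intro continuous_intros CU c that) (auto dest: B1)
  have c\<Lambda>: "continuous_on B \<Lambda>" unfolding \<Lambda>_def by (intro continuous_intros c) (auto dest: B1)
  have cL: "continuous_on B (L \<phi>)" if "0 < \<phi>" "\<phi> < \<theta>" for \<phi>
    unfolding L_def by (intro continuous_intros CU c\<Lambda> that)
  have leb: "set_integrable lborel B f" "integral B f = (LINT x:B|lborel. f x)" if "continuous_on B f" for f :: "real \<times> real \<Rightarrow> real"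
  proof -
    show i: "set_integrable lborel B f"
      using borel_integrable_compact[of B f] that by (simp add: B_def set_integrable_def mult.commute[of _ "f _"] cong: if_cong)
    show "integral B f = (LINT x:B|lborel. f x)" using set_borel_integral_eq_integral(2)[OF i] by simp
  qed
  have good: "AE x in lborel. x \<in> B \<longrightarrow> (\<forall>\<phi>. 0 < \<phi> \<longrightarrow> \<phi> < \<theta> \<longrightarrow> norm (grad u (cyl \<phi> x)) \<le> S x \<and> \<bar>u (cyl \<phi> x)\<bar> \<le> \<theta> * fst x * S x)"
    using bound dirichlet
  proof eventually_elim
    case (elim x)
    then show ?case using box u_bound[OF h, of x "S x"] by blast
  qed
  define C where "C = (LINT x:B|lborel. S x * (fst x * \<bar>\<Lambda> x\<bar>))"
  have Cint: "set_integrable lborel B (\<lambda>x. S x * w x)" if "continuous_on B w" for w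
  proof -
    have "compact B" by (simp add: B_def)
    then have "bounded (w ` B)" using compact_continuous_image[OF that] compact_imp_bounded by blast
    then obtain M where M: "\<And>x. x \<in> B \<Longrightarrow> \<bar>w x\<bar> \<le> M" by (auto simp: bounded_iff)
    show ?thesis
      unfolding set_integrable_def
    proof (rule Bochner_Integration.integrable_bound)
      show "integrable lborel (\<lambda>x. M * (indicat_real B x *\<^sub>R S x))"
        using Sint by (simp add: set_integrable_def)
      have "(\<lambda>x. indicat_real B x *\<^sub>R w x) \<in> borel_measurable borel"
        using leb(1)[OF that] by (auto simp: set_integrable_def dest: borel_measurable_integrable)
      then have "(\<lambda>x. S x * (indicat_real B x *\<^sub>R w x)) \<in> borel_measurable lborel" by simp
      then show "(\<lambda>x. indicat_real B x *\<^sub>R (S x * w x)) \<in> borel_measurable lborel" by (simp add: mult_ac)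
      show "AE x in lborel. norm (indicat_real B x *\<^sub>R (S x * w x)) \<le> norm (M * (indicat_real B x *\<^sub>R S x))"
        by (intro AE_I2) (use M in \<open>fastforce simp: indicator_def abs_mult mult.commute[of "\<bar>S _\<bar>"] intro!: mult_right_mono\<close>)
    qed
  qed
  have cw: "continuous_on B (\<lambda>x. fst x * \<bar>\<Lambda> x\<bar>)" by (intro continuous_intros c\<Lambda>)
  have D\<Theta>: "(\<Theta> has_real_derivative - integral B (L \<phi>)) (at \<phi>)" if "0 < \<phi>" "\<phi> < \<theta>" for \<phi>
    unfolding \<Theta>_def q_def L_def \<Lambda>_def B_def
  proof (rule sector_flux_derivative[OF h _ box(2,3) _ d[unfolded B_def] c[unfolded B_def] v that])
    show "0 < r1" using B1[of "(r1, z1)"] box by (simp add: B_def)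
    show "\<And>\<phi> x. 0 < \<phi> \<Longrightarrow> \<phi> < \<theta> \<Longrightarrow> x \<in> cbox (r1, z1) (r2, z2) \<Longrightarrow> cyl \<phi> x \<in> \<Omega>"
      using sector_in_domain box(1) by (auto simp: B_def)
  qed
  have D\<Theta>b: "\<bar>integral B (L \<phi>)\<bar> \<le> \<theta> * C" if \<phi>: "0 < \<phi>" "\<phi> < \<theta>" for \<phi>
  proof -
    have "\<bar>integral B (L \<phi>)\<bar> \<le> (LINT x|lborel. norm (indicat_real B x *\<^sub>R L \<phi> x))"
      unfolding leb(2)[OF cL[OF \<phi>]] set_lebesgue_integral_def real_norm_def[symmetric]
      by (rule integral_norm_bound)
    also have "\<dots> \<le> (LINT x|lborel. \<theta> * (indicat_real B x *\<^sub>R (S x * (fst x * \<bar>\<Lambda> x\<bar>))))"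
    proof (rule integral_mono_AE)
      show "integrable lborel (\<lambda>x. norm (indicat_real B x *\<^sub>R L \<phi> x))"
        using leb(1)[OF cL[OF \<phi>]] by (intro integrable_norm) (simp add: set_integrable_def)
      show "integrable lborel (\<lambda>x. \<theta> * (indicat_real B x *\<^sub>R (S x * (fst x * \<bar>\<Lambda> x\<bar>))))"
        using Cint[OF cw] by (intro integrable_mult_right) (simp add: set_integrable_def)
      show "AE x in lborel. norm (indicat_real B x *\<^sub>R L \<phi> x) \<le> \<theta> * (indicat_real B x *\<^sub>R (S x * (fst x * \<bar>\<Lambda> x\<bar>)))"
        using good
      proof eventually_elim
        case (elim x)
        show ?case
        proof (cases "x \<in> B")
          case True
          then have "\<bar>u (cyl \<phi> x)\<bar> \<le> \<theta> * fst x * S x" using elim \<phi> by blast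
          then have "\<bar>u (cyl \<phi> x)\<bar> * \<bar>cos (\<beta> * \<phi>)\<bar> * \<bar>\<Lambda> x\<bar> \<le> (\<theta> * fst x * S x) * 1 * \<bar>\<Lambda> x\<bar>"
            by (intro mult_mono) auto
          then show ?thesis using True by (simp add: L_def abs_mult mult_ac)
        qed simp
      qed
    qed
    finally show ?thesis by (simp add: C_def set_lebesgue_integral_def)
  qed
  have inc: "\<bar>\<Theta> \<phi>' - \<Theta> \<phi>\<bar> \<le> \<theta>\<^sup>2 * C" if \<phi>: "0 < \<phi>" "\<phi> < \<phi>'" "\<phi>' < \<theta>" for \<phi> \<phi>'
  proof -
    obtain \<omega> where \<omega>: "\<phi> < \<omega>" "\<omega> < \<phi>'" "\<Theta> \<phi>' - \<Theta> \<phi> = (\<phi>' - \<phi>) * - integral B (L \<omega>)"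
    proof -
      have "(\<Theta> has_real_derivative - integral B (L \<omega>)) (at \<omega>)"
        if "\<phi> \<le> \<omega>" "\<omega> \<le> \<phi>'" for \<omega> using that \<phi> by (intro D\<Theta>) auto
      from MVT2[OF \<phi>(2) this] show ?thesis using that by blast
    qed
    have "\<bar>\<Theta> \<phi>' - \<Theta> \<phi>\<bar> \<le> \<theta> * (\<theta> * C)"
      unfolding \<omega>(3) abs_mult abs_minus_cancel using \<phi> \<omega> D\<Theta>b[of \<omega>] by (intro mult_mono) auto
    then show ?thesis by (simp add: power2_eq_square mult_ac)
  qed
  define dom where "dom x = indicat_real B x *\<^sub>R (S x * ((1 + \<beta> * \<theta>) * \<psi> x))" for x
  have domint: "integrable lborel dom"
    using Cint[of "\<lambda>x. (1 + \<beta> * \<theta>) * \<psi> x"] c by (simp add: dom_def[abs_def] set_integrable_def continuous_intros)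
  have domb: "AE x in lborel. norm (indicat_real B x *\<^sub>R q \<phi> x) \<le> dom x" if \<phi>: "0 < \<phi>" "\<phi> < \<theta>" for \<phi>
    using good
  proof eventually_elim
    case (elim x)
    show ?case
    proof (cases "x \<in> B")
      case True
      then have e: "norm (grad u (cyl \<phi> x)) \<le> S x" "\<bar>u (cyl \<phi> x)\<bar> \<le> \<theta> * fst x * S x" using elim \<phi> by blast+
      have r: "0 < fst x" using B1 True by auto
      have S0: "0 \<le> S x" using e(1) norm_ge_zero order_trans by blast
      have nn: "0 \<le> \<beta> * \<psi> x / fst x * (\<theta> * fst x * S x)"
        using S0 r \<beta>(1) \<theta>0 pos(1)[of x] by simp
      have "\<bar>grad u (cyl \<phi> x) \<bullet> angular \<phi>\<bar> \<le> S x"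
        using Cauchy_Schwarz_ineq2[of "grad u (cyl \<phi> x)" "angular \<phi>"] e by simp
      then have "\<bar>\<psi> x * (grad u (cyl \<phi> x) \<bullet> angular \<phi>) * cos (\<beta> * \<phi>)\<bar> \<le> \<psi> x * S x * 1"
        unfolding abs_mult using pos by (intro mult_mono) auto
      moreover have "\<bar>\<beta> * \<psi> x / fst x * u (cyl \<phi> x) * sin (\<beta> * \<phi>)\<bar> \<le> \<beta> * \<psi> x / fst x * (\<theta> * fst x * S x) * 1"
        unfolding abs_mult using pos(1)[of x] \<beta>(1) r e nn by (intro mult_mono) auto
      ultimately have "\<bar>q \<phi> x\<bar> \<le> \<psi> x * S x + \<beta> * \<psi> x / fst x * (\<theta> * fst x * S x)"
        unfolding q_def by linarith
      also have "\<dots> = S x * ((1 + \<beta> * \<theta>) * \<psi> x)" using r by (simp add: field_simps)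
      finally show ?thesis using True by (simp add: dom_def)
    qed (simp add: dom_def)
  qed
  define e where "e k = \<theta> / (real k + 3)" for k
  have e: "0 < e k" "e k < \<theta> - e k" "\<theta> - e k < \<theta>" "e k < \<theta>" for k
  proof -
    show "0 < e k" using \<theta>0 by (simp add: e_def)
    have "e k \<le> \<theta> / 3" unfolding e_def using \<theta>0 by (intro divide_left_mono) auto
    then show "e k < \<theta> - e k" "\<theta> - e k < \<theta>" "e k < \<theta>" using \<theta>0 \<open>0 < e k\<close> by linarith+
  qed
  have e0: "e \<longlonglongrightarrow> 0" 
    using tendsto_mult_right_zero[OF LIMSEQ_ignore_initial_segment[OF LIMSEQ_inverse_real_of_nat, of 2], of \<theta>]
    by (simp add: e_def[abs_def] divide_inverse add.commute)
  have eR: "filterlim e (at_right 0) sequentially"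
    using e0 e(1) less_imp_neq[OF e(1)] by (auto simp: filterlim_at intro!: always_eventually)
  have eL: "filterlim (\<lambda>k. \<theta> - e k) (at_left \<theta>) sequentially"
    using tendsto_diff[OF tendsto_const e0, of \<theta>] e(3) less_imp_neq[OF e(3)] by (auto simp: filterlim_at intro!: always_eventually)
  have mq: "(\<lambda>x. indicat_real B x *\<^sub>R q \<phi> x) \<in> borel_measurable lborel" if "0 < \<phi>" "\<phi> < \<theta>" for \<phi>
    using leb(1)[OF cq[OF that]] by (auto simp: set_integrable_def dest: borel_measurable_integrable)
  have m\<psi>: "(\<lambda>x. indicat_real B x *\<^sub>R (g x * \<psi> x)) \<in> borel_measurable lborel"
  proof -
    have "(\<lambda>x. indicat_real B x *\<^sub>R \<psi> x) \<in> borel_measurable borel"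
      using leb(1)[OF c(1)] by (auto simp: set_integrable_def dest: borel_measurable_integrable)
    then have "(\<lambda>x. g x * (indicat_real B x *\<^sub>R \<psi> x)) \<in> borel_measurable lborel" by simp
    then show ?thesis by (simp add: mult_ac)
  qed
  have \<Theta>eq: "\<Theta> \<phi> = (LINT x|lborel. indicat_real B x *\<^sub>R q \<phi> x)" if "0 < \<phi>" "\<phi> < \<theta>" for \<phi>
    unfolding \<Theta>_def leb(2)[OF cq[OF that]] set_lebesgue_integral_def ..
  have lim0: "AE x in lborel. (\<lambda>k. indicat_real B x *\<^sub>R q (e k) x) \<longlonglongrightarrow> indicat_real B x *\<^sub>R - (g x * \<psi> x)"
    using good neumann
  proof eventually_elim
    case (elim x)
    show ?case
    proof (cases "x \<in> B")
      case True
      have E: "norm (grad u (cyl (e k) x)) \<le> S x" "\<bar>u (cyl (e k) x)\<bar> \<le> \<theta> * fst x * S x" for k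
        using elim(1) True e[of k] by blast+
      have "((\<lambda>\<phi>. - b \<bullet> grad u (cyl \<phi> x)) \<longlongrightarrow> g x) (at_right 0)" using elim(2) True box(1) by blast
      from filterlim_compose[OF this eR]
      have "(\<lambda>k. - (- b \<bullet> grad u (cyl (e k) x)) * cos (e k)) \<longlonglongrightarrow> - g x * cos 0"
        by (intro tendsto_intros e0)
      then have l1: "(\<lambda>k. cos (e k) * (grad u (cyl (e k) x) \<bullet> b)) \<longlonglongrightarrow> - g x"
        by (simp add: inner_commute mult.commute)
      have l2: "(\<lambda>k. sin (e k) * (grad u (cyl (e k) x) \<bullet> a)) \<longlonglongrightarrow> 0"
      proof (rule Lim_null_comparison)
        show "(\<lambda>k. \<bar>sin (e k)\<bar> * S x) \<longlonglongrightarrow> 0" using tendsto_rabs_zero[OF tendsto_sin[OF e0, simplified]]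
          by (rule tendsto_mult_left_zero)
        show "\<forall>\<^sub>F k in sequentially. norm (sin (e k) * (grad u (cyl (e k) x) \<bullet> a)) \<le> \<bar>sin (e k)\<bar> * S x"
        proof (intro always_eventually allI)
          fix k
          have "\<bar>grad u (cyl (e k) x) \<bullet> a\<bar> \<le> S x"
            using Cauchy_Schwarz_ineq2[of "grad u (cyl (e k) x)" a] E(1)[of k] frame(2) by simp
          then show "norm (sin (e k) * (grad u (cyl (e k) x) \<bullet> a)) \<le> \<bar>sin (e k)\<bar> * S x"
            by (simp add: abs_mult mult_left_mono)
        qed
      qed
      have "(\<lambda>k. cos (e k) * (grad u (cyl (e k) x) \<bullet> b) - sin (e k) * (grad u (cyl (e k) x) \<bullet> a)) \<longlonglongrightarrow> - g x - 0"
        by (intro tendsto_diff l1 l2)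
      then have l3: "(\<lambda>k. grad u (cyl (e k) x) \<bullet> angular (e k)) \<longlonglongrightarrow> - g x"
        by (simp add: angular_def inner_diff_right inner_add_right)
      have l4: "(\<lambda>k. \<beta> * \<psi> x / fst x * u (cyl (e k) x) * sin (\<beta> * e k)) \<longlonglongrightarrow> 0"
      proof (rule Lim_null_comparison)
        have "(\<lambda>k. sin (\<beta> * e k)) \<longlonglongrightarrow> sin (\<beta> * 0)" by (intro tendsto_intros e0)
        then show "(\<lambda>k. \<bar>\<beta> * \<psi> x / fst x\<bar> * (\<theta> * fst x * S x) * \<bar>sin (\<beta> * e k)\<bar>) \<longlonglongrightarrow> 0"
          by (intro tendsto_mult_right_zero tendsto_rabs_zero) simp
        show "\<forall>\<^sub>F k in sequentially. norm (\<beta> * \<psi> x / fst x * u (cyl (e k) x) * sin (\<beta> * e k))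
            \<le> \<bar>\<beta> * \<psi> x / fst x\<bar> * (\<theta> * fst x * S x) * \<bar>sin (\<beta> * e k)\<bar>"
          unfolding real_norm_def abs_mult[of "_ * u _"] abs_mult[of "_ / _" "u _"]
          using E(2) by (intro always_eventually allI mult_right_mono mult_left_mono) auto
      qed
      have "(\<lambda>k. \<psi> x * (grad u (cyl (e k) x) \<bullet> angular (e k)) * cos (\<beta> * e k) + \<beta> * \<psi> x / fst x * u (cyl (e k) x) * sin (\<beta> * e k))
          \<longlonglongrightarrow> \<psi> x * - g x * cos (\<beta> * 0) + 0"
        by (intro tendsto_intros l3 l4 e0)
      then have "(\<lambda>k. q (e k) x) \<longlonglongrightarrow> - (g x * \<psi> x)" by (simp add: q_def mult.commute)
      then show ?thesis using True by simp
    qed simp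
  qed
  have lim1: "AE x in lborel. (\<lambda>k. indicat_real B x *\<^sub>R q (\<theta> - e k) x) \<longlonglongrightarrow> 0"
    using good dirichlet
  proof eventually_elim
    case (elim x)
    show ?case
    proof (cases "x \<in> B")
      case True
      have E: "norm (grad u (cyl (\<theta> - e k) x)) \<le> S x" for k
        using elim(1) True e[of k] by (meson order.strict_trans)
      have "((\<lambda>\<phi>. u (cyl \<phi> x)) \<longlongrightarrow> 0) (at_left \<theta>)" using elim(2) True box(1) by blast
      from filterlim_compose[OF this eL] have u0: "(\<lambda>k. u (cyl (\<theta> - e k) x)) \<longlonglongrightarrow> 0" .
      have l3: "(\<lambda>k. (grad u (cyl (\<theta> - e k) x) \<bullet> angular (\<theta> - e k)) * cos (\<beta> * (\<theta> - e k))) \<longlonglongrightarrow> 0"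
      proof (rule Lim_null_comparison)
        have "(\<lambda>k. cos (\<beta> * (\<theta> - e k))) \<longlonglongrightarrow> cos (\<beta> * (\<theta> - 0))" by (intro tendsto_intros e0)
        then show "(\<lambda>k. S x * \<bar>cos (\<beta> * (\<theta> - e k))\<bar>) \<longlonglongrightarrow> 0"
          by (intro tendsto_mult_right_zero tendsto_rabs_zero) (simp add: \<beta>(3))
        show "\<forall>\<^sub>F k in sequentially. norm ((grad u (cyl (\<theta> - e k) x) \<bullet> angular (\<theta> - e k)) * cos (\<beta> * (\<theta> - e k)))
            \<le> S x * \<bar>cos (\<beta> * (\<theta> - e k))\<bar>"
        proof (intro always_eventually allI)
          fix k
          have "\<bar>grad u (cyl (\<theta> - e k) x) \<bullet> angular (\<theta> - e k)\<bar> \<le> S x"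
            using Cauchy_Schwarz_ineq2[of "grad u (cyl (\<theta> - e k) x)" "angular (\<theta> - e k)"] E[of k] by simp
          then show "norm ((grad u (cyl (\<theta> - e k) x) \<bullet> angular (\<theta> - e k)) * cos (\<beta> * (\<theta> - e k))) \<le> S x * \<bar>cos (\<beta> * (\<theta> - e k))\<bar>"
            by (simp add: abs_mult mult_right_mono)
        qed
      qed
      have "(\<lambda>k. \<psi> x * ((grad u (cyl (\<theta> - e k) x) \<bullet> angular (\<theta> - e k)) * cos (\<beta> * (\<theta> - e k)))
          + \<beta> * \<psi> x / fst x * u (cyl (\<theta> - e k) x) * sin (\<beta> * (\<theta> - e k)))
          \<longlonglongrightarrow> \<psi> x * 0 + \<beta> * \<psi> x / fst x * 0 * sin (\<beta> * (\<theta> - 0))"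
        by (intro tendsto_add tendsto_mult tendsto_diff tendsto_sin tendsto_const l3 u0 e0)
      then have "(\<lambda>k. q (\<theta> - e k) x) \<longlonglongrightarrow> 0" by (simp add: q_def mult_ac)
      then show ?thesis using True by simp
    qed simp
  qed
  have dom0: "AE x in lborel. norm (indicat_real B x *\<^sub>R q (e k) x) \<le> dom x" for k by (intro domb e)
  have dom1: "AE x in lborel. norm (indicat_real B x *\<^sub>R q (\<theta> - e k) x) \<le> dom x" for k
    using e[of k] by (intro domb) auto
  have mf: "(\<lambda>x. indicat_real B x *\<^sub>R - (g x * \<psi> x)) \<in> borel_measurable lborel"
    using borel_measurable_uminus[OF m\<psi>] by (simp only: scaleR_minus_right)
  have m0: "\<And>k. (\<lambda>x. indicat_real B x *\<^sub>R q (e k) x) \<in> borel_measurable lborel" by (intro mq e)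
  have m1: "(\<lambda>x. indicat_real B x *\<^sub>R q (\<theta> - e k) x) \<in> borel_measurable lborel" for k
    using e[of k] by (intro mq) auto
  have m2: "(\<lambda>x. 0 :: real) \<in> borel_measurable (lborel :: (real \<times> real) measure)" by simp
  have i0: "integrable lborel (\<lambda>x. indicat_real B x *\<^sub>R - (g x * \<psi> x))"
    by (rule integrable_dominated_convergence[OF mf m0 domint lim0 dom0])
  have "(\<lambda>k. \<Theta> (e k)) \<longlonglongrightarrow> (LINT x|lborel. indicat_real B x *\<^sub>R - (g x * \<psi> x))"
    unfolding \<Theta>eq[OF e(1) e(4)] by (rule integral_dominated_convergence[OF mf m0 domint lim0 dom0])
  moreover have "(\<lambda>k. \<Theta> (\<theta> - e k)) \<longlonglongrightarrow> (LINT x|(lborel :: (real \<times> real) measure). (0::real))"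
    unfolding \<Theta>eq[OF order.strict_trans[OF e(1) e(2)] e(3)]
    by (rule integral_dominated_convergence[OF m2 m1 domint lim1 dom1])
  ultimately have "(\<lambda>k. \<bar>\<Theta> (\<theta> - e k) - \<Theta> (e k)\<bar>) \<longlonglongrightarrow> \<bar>0 - (LINT x|lborel. indicat_real B x *\<^sub>R - (g x * \<psi> x))\<bar>"
    by (intro tendsto_intros) auto
  moreover have "\<bar>\<Theta> (\<theta> - e k) - \<Theta> (e k)\<bar> \<le> \<theta>\<^sup>2 * C" for k by (intro inc e)
  ultimately have "\<bar>0 - (LINT x|lborel. indicat_real B x *\<^sub>R - (g x * \<psi> x))\<bar> \<le> \<theta>\<^sup>2 * C"
    by (intro LIMSEQ_le_const2) auto
  then have fin: "(LINT x|lborel. indicat_real B x *\<^sub>R (g x * \<psi> x)) \<le> \<theta>\<^sup>2 * C"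
    by simp
  have i1: "integrable lborel (\<lambda>x. indicat_real B x *\<^sub>R (g x * \<psi> x))"
    using integrable_minus[OF i0] by (simp only: scaleR_minus_right minus_minus)
  have "(\<integral>\<^sup>+x\<in>B. ennreal (g x * \<psi> x) \<partial>lborel) = (\<integral>\<^sup>+x. ennreal (indicat_real B x *\<^sub>R (g x * \<psi> x)) \<partial>lborel)"
    by (intro nn_integral_cong) (simp add: indicator_def)
  also have "\<dots> = ennreal (LINT x|lborel. indicat_real B x *\<^sub>R (g x * \<psi> x))"
    using pos by (intro nn_integral_eq_integral i1) (auto intro!: mult_nonneg_nonneg)
  also have "\<dots> \<le> ennreal (\<theta>\<^sup>2 * C)" using fin by (rule ennreal_leI)
  also have "\<dots> = ennreal (\<theta>\<^sup>2) * ennreal C" by (simp add: ennreal_mult')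
  also have "ennreal C = (\<integral>\<^sup>+x. ennreal (indicat_real B x *\<^sub>R (S x * (fst x * \<bar>\<Lambda> x\<bar>))) \<partial>lborel)"
    unfolding C_def set_lebesgue_integral_def
  proof (rule nn_integral_eq_integral[symmetric])
    show "integrable lborel (\<lambda>x. indicat_real B x *\<^sub>R (S x * (fst x * \<bar>\<Lambda> x\<bar>)))"
      using Cint[OF cw] by (simp add: set_integrable_def)
    show "AE x in lborel. 0 \<le> indicat_real B x *\<^sub>R (S x * (fst x * \<bar>\<Lambda> x\<bar>))"
      using good
    proof eventually_elim
      case (elim x)
      then show ?case
        using B1[of x] order_trans[OF norm_ge_zero, of "grad u (cyl (e 0) x)" "S x"] e[of 0]
        by (cases "x \<in> B") (auto intro!: mult_nonneg_nonneg)
    qed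
  qed
  also have "\<dots> = (\<integral>\<^sup>+x\<in>B. ennreal (S x * (fst x * \<bar>\<Lambda> x\<bar>)) \<partial>lborel)"
    by (intro nn_integral_cong) (simp add: indicator_def)
  finally show ?thesis .
qed

end

section \<open>Truncated poles on the edge\<close>

text \<open>The third power of the positive part is the simplest twice continuously differentiable function
  vanishing on a half line; all truncations are built from it.\<close>
definition cube :: "real \<Rightarrow> real" where "cube x = (max 0 x) ^ 3"
definition cube1 :: "real \<Rightarrow> real" where "cube1 x = 3 * (max 0 x)\<^sup>2"
definition cube2 :: "real \<Rightarrow> real" where "cube2 x = 6 * max 0 x"

lemma positive_part_power_derivative:
  assumes "2 \<le> n"
  shows "((\<lambda>x::real. (max 0 x) ^ n) has_real_derivative real n * (max 0 x) ^ (n - 1)) (at x)"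
proof (cases x "0 :: real" rule: linorder_cases)
  case less
  have "((\<lambda>x::real. 0) has_real_derivative 0) (at x)" by simp
  then have "((\<lambda>x::real. (max 0 x) ^ n) has_real_derivative 0) (at x)"
    using less assms by (rule_tac has_field_derivative_transform_within_open[of _ _ _ "{..<0}"]) auto
  then show ?thesis using less assms by (simp add: zero_power)
next
  case equal
  have "((\<lambda>x::real. (max 0 x) ^ n) has_real_derivative 0) (at 0)"
    unfolding has_field_derivative_iff
  proof (rule Lim_null_comparison)
    show "((\<lambda>x::real. \<bar>x\<bar>) \<longlongrightarrow> 0) (at 0)" by (rule tendsto_rabs_zero) (rule tendsto_ident_at)
    have "norm (((max 0 x) ^ n - (max 0 0) ^ n) / (x - 0)) \<le> \<bar>x\<bar>" if "x \<noteq> 0" "\<bar>x\<bar> < 1" for x :: real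
    proof (cases "x > 0")
      case True
      obtain m where m: "n = Suc (Suc m)" using assms by (metis add_2_eq_Suc le_Suc_ex)
      have "x ^ m \<le> 1" using that True by (intro power_le_one) auto
      then show ?thesis using True m by (simp add: mult_left_le)
    qed (use assms in auto)
    then show "\<forall>\<^sub>F x in at (0::real). norm (((max 0 x) ^ n - (max 0 0) ^ n) / (x - 0)) \<le> \<bar>x\<bar>"
      unfolding eventually_at by (intro exI[of _ 1]) (auto simp: dist_real_def)
  qed
  then show ?thesis using equal assms by (simp add: zero_power)
next
  case greater
  have "((\<lambda>x::real. x ^ n) has_real_derivative real n * x ^ (n - 1)) (at x)"
    using DERIV_pow[of n x] by simp
  then have "((\<lambda>x::real. (max 0 x) ^ n) has_real_derivative real n * x ^ (n - 1)) (at x)"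
    using greater by (rule_tac has_field_derivative_transform_within_open[of _ _ _ "{0<..}"]) auto
  then show ?thesis using greater by simp
qed

lemma cube_derivatives:
  "(cube has_real_derivative cube1 x) (at x)" "(cube1 has_real_derivative cube2 x) (at x)"
  using positive_part_power_derivative[of 3 x] DERIV_cmult[OF positive_part_power_derivative[of 2 x], of 3]
  by (simp_all add: cube_def[abs_def] cube1_def[abs_def] cube2_def)

lemma continuous_cubes [continuous_intros]:
  assumes "continuous_on S f"
  shows "continuous_on S (\<lambda>x. cube (f x))" "continuous_on S (\<lambda>x. cube1 (f x))" "continuous_on S (\<lambda>x. cube2 (f x))"
  unfolding cube_def cube1_def cube2_def by (intro continuous_intros assms)+

lemma cube_nonpos [simp]: "x \<le> 0 \<Longrightarrow> cube x = 0" "x \<le> 0 \<Longrightarrow> cube1 x = 0" "x \<le> 0 \<Longrightarrow> cube2 x = 0"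
  by (simp_all add: cube_def cube1_def cube2_def max_absorb1)

lemma cube_bounds:
  shows "0 \<le> cube x" "0 \<le> cube1 x" "0 \<le> cube2 x"
    and "x \<le> 1 \<Longrightarrow> cube x \<le> 1" "x \<le> 1 \<Longrightarrow> cube1 x \<le> 3" "x \<le> 1 \<Longrightarrow> cube2 x \<le> 6"
  by (simp_all add: cube_def cube1_def cube2_def power_le_one)

text \<open>A twice continuously differentiable step from \<open>0\<close> on \<open>r \<le> \<epsilon>\<close> to \<open>1\<close> on \<open>r \<ge> 2 \<epsilon>\<close>, with its first two derivatives.\<close>
definition cutoff :: "real \<Rightarrow> real \<Rightarrow> real" where
  "cutoff \<epsilon> r = 1 - cube (1 - cube ((r - \<epsilon>) / \<epsilon>))"
definition cutoff1 :: "real \<Rightarrow> real \<Rightarrow> real" where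
  "cutoff1 \<epsilon> r = cube1 (1 - cube ((r - \<epsilon>) / \<epsilon>)) * cube1 ((r - \<epsilon>) / \<epsilon>) / \<epsilon>"
definition cutoff2 :: "real \<Rightarrow> real \<Rightarrow> real" where
  "cutoff2 \<epsilon> r = (cube1 (1 - cube ((r - \<epsilon>) / \<epsilon>)) * cube2 ((r - \<epsilon>) / \<epsilon>)
     - cube2 (1 - cube ((r - \<epsilon>) / \<epsilon>)) * (cube1 ((r - \<epsilon>) / \<epsilon>))\<^sup>2) / \<epsilon>\<^sup>2"

lemma cutoff_derivatives:
  assumes "\<epsilon> > 0"
  shows "(cutoff \<epsilon> has_real_derivative cutoff1 \<epsilon> r) (at r)" "(cutoff1 \<epsilon> has_real_derivative cutoff2 \<epsilon> r) (at r)"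
proof -
  have e: "((\<lambda>r. (r - \<epsilon>) / \<epsilon>) has_real_derivative 1 / \<epsilon>) (at r)"
    by (rule DERIV_cong, (rule derivative_intros)+) (use assms in simp_all)
  note C = DERIV_chain2[OF cube_derivatives(1) e] DERIV_chain2[OF cube_derivatives(2) e]
  note D = DERIV_diff[OF DERIV_const[of 1] C(1)]
  show "(cutoff \<epsilon> has_real_derivative cutoff1 \<epsilon> r) (at r)"
    unfolding cutoff_def[abs_def] cutoff1_def
    by (rule DERIV_cong[OF DERIV_diff[OF DERIV_const DERIV_chain2[OF cube_derivatives(1) D]]]) simp
  show "(cutoff1 \<epsilon> has_real_derivative cutoff2 \<epsilon> r) (at r)"
    unfolding cutoff1_def[abs_def] cutoff2_def
    by (rule DERIV_cong[OF DERIV_cdivide[OF DERIV_mult[OF DERIV_chain2[OF cube_derivatives(2) D] C(2)]]])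
      (use assms in \<open>simp add: field_simps power2_eq_square\<close>)
qed

lemma cutoff_low: "\<epsilon> > 0 \<Longrightarrow> r \<le> \<epsilon> \<Longrightarrow> cutoff \<epsilon> r = 0" "\<epsilon> > 0 \<Longrightarrow> r \<le> \<epsilon> \<Longrightarrow> cutoff1 \<epsilon> r = 0"
  by (simp_all add: cutoff_def cutoff1_def divide_nonpos_pos) (simp add: cube_def)

lemma cutoff_high:
  assumes "\<epsilon> > 0" "2 * \<epsilon> \<le> r"
  shows "cutoff \<epsilon> r = 1" "cutoff1 \<epsilon> r = 0" "cutoff2 \<epsilon> r = 0"
proof -
  have "1 \<le> (r - \<epsilon>) / \<epsilon>" using assms by (simp add: field_simps)
  then have "1 \<le> cube ((r - \<epsilon>) / \<epsilon>)" by (simp add: cube_def)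
  then show "cutoff \<epsilon> r = 1" "cutoff1 \<epsilon> r = 0" "cutoff2 \<epsilon> r = 0"
    by (simp_all add: cutoff_def cutoff1_def cutoff2_def)
qed

lemma cutoff_bounds:
  assumes "\<epsilon> > 0"
  shows "0 \<le> cutoff \<epsilon> r" "cutoff \<epsilon> r \<le> 1" "\<bar>cutoff1 \<epsilon> r\<bar> \<le> 9 / \<epsilon>" "\<bar>cutoff2 \<epsilon> r\<bar> \<le> 72 / \<epsilon>\<^sup>2"
proof -
  let ?y = "(r - \<epsilon>) / \<epsilon>" 
  note p = cube_bounds(1-3)
  have c1: "1 - cube ?y \<le> 1" using p by simp
  note b = cube_bounds(4-6)[OF c1]
  show "0 \<le> cutoff \<epsilon> r" "cutoff \<epsilon> r \<le> 1" using b p by (simp_all add: cutoff_def)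
  show "\<bar>cutoff1 \<epsilon> r\<bar> \<le> 9 / \<epsilon>"
  proof (cases "r \<le> 2 * \<epsilon>")
    case True
    then have "?y \<le> 1" using assms by (simp add: field_simps)
    note b' = cube_bounds(4-6)[OF this]
    have "\<bar>cube1 (1 - cube ?y) * cube1 ?y\<bar> \<le> 3 * 3" unfolding abs_mult using b b' p by (intro mult_mono) auto
    then show ?thesis using assms by (simp add: cutoff1_def divide_right_mono)
  qed (use assms cutoff_high(2)[of \<epsilon> r] in simp)
  show "\<bar>cutoff2 \<epsilon> r\<bar> \<le> 72 / \<epsilon>\<^sup>2"
  proof (cases "r \<le> 2 * \<epsilon>")
    case True
    then have "?y \<le> 1" using assms by (simp add: field_simps)
    note b' = cube_bounds(4-6)[OF this]
    have "\<bar>cube1 (1 - cube ?y) * cube2 ?y\<bar> \<le> 3 * 6" unfolding abs_mult using b b' p by (intro mult_mono) auto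
    moreover have "(cube1 ?y)\<^sup>2 \<le> 3\<^sup>2" using b' p by (intro power_mono) auto
    then have "\<bar>cube2 (1 - cube ?y) * (cube1 ?y)\<^sup>2\<bar> \<le> 6 * 3\<^sup>2"
      unfolding abs_mult using b b' p by (intro mult_mono) auto
    ultimately have "\<bar>cube1 (1 - cube ?y) * cube2 ?y - cube2 (1 - cube ?y) * (cube1 ?y)\<^sup>2\<bar> \<le> 72" by simp
    then show ?thesis using assms by (simp add: cutoff2_def divide_right_mono)
  qed (use assms cutoff_high(3)[of \<epsilon> r] in simp)
qed

lemma continuous_cutoff [continuous_intros]:
  assumes "\<epsilon> > 0" "continuous_on S f"
  shows "continuous_on S (\<lambda>x. cutoff \<epsilon> (f x))" "continuous_on S (\<lambda>x. cutoff1 \<epsilon> (f x))" "continuous_on S (\<lambda>x. cutoff2 \<epsilon> (f x))"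
  unfolding cutoff_def cutoff1_def cutoff2_def using assms(1) by (intro continuous_intros assms(2); simp)+

text \<open>The radial factor of the Kelvin transform as a function of the squared distance \<open>\<tau>\<close> from the pole,
  truncated to vanish for \<open>\<tau> \<ge> R\<^sup>2\<close>, with its first two derivatives.\<close>
definition pole :: "real \<Rightarrow> real \<Rightarrow> real \<Rightarrow> real" where
  "pole R s \<tau> = cube (1 - \<tau> / R\<^sup>2) * \<tau> powr (- s)"
definition pole1 :: "real \<Rightarrow> real \<Rightarrow> real \<Rightarrow> real" where
  "pole1 R s \<tau> = - (cube1 (1 - \<tau> / R\<^sup>2) / R\<^sup>2) * \<tau> powr (- s) - s * cube (1 - \<tau> / R\<^sup>2) * \<tau> powr (- s - 1)"
definition pole2 :: "real \<Rightarrow> real \<Rightarrow> real \<Rightarrow> real" where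
  "pole2 R s \<tau> = cube2 (1 - \<tau> / R\<^sup>2) / R\<^sup>2 / R\<^sup>2 * \<tau> powr (- s)
     + 2 * s * (cube1 (1 - \<tau> / R\<^sup>2) / R\<^sup>2) * \<tau> powr (- s - 1)
     + s * (s + 1) * cube (1 - \<tau> / R\<^sup>2) * \<tau> powr (- s - 2)"

lemma powr_derivative:
  "0 < x \<Longrightarrow> ((\<lambda>x::real. x powr c) has_real_derivative c * x powr (c - 1)) (at x)"
  using has_real_derivative_powr[of x c] by simp

lemma pole_derivatives:
  assumes "0 < \<tau>" "R \<noteq> 0"
  shows "(pole R s has_real_derivative pole1 R s \<tau>) (at \<tau>)" "(pole1 R s has_real_derivative pole2 R s \<tau>) (at \<tau>)"
proof -
  note P = powr_derivative[OF assms(1)]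
  have e: "((\<lambda>\<tau>. 1 - \<tau> / R\<^sup>2) has_real_derivative - (1 / R\<^sup>2)) (at \<tau>)"
    using DERIV_diff[OF DERIV_const[of 1] DERIV_cdivide[OF DERIV_ident]] by simp
  define Q where "Q = R\<^sup>2"
  have Q: "Q \<noteq> 0" using assms by (simp add: Q_def)
  note C = DERIV_chain2[OF cube_derivatives(1) e] DERIV_chain2[OF cube_derivatives(2) e]
  show "(pole R s has_real_derivative pole1 R s \<tau>) (at \<tau>)"
    unfolding pole_def[abs_def] pole1_def
    by (rule DERIV_cong[OF DERIV_mult[OF C(1) P]]) (simp add: algebra_simps)
  show "(pole1 R s has_real_derivative pole2 R s \<tau>) (at \<tau>)"
    unfolding pole1_def[abs_def] pole2_def Q_def[symmetric]
    by (rule DERIV_cong[OF DERIV_diff[OF DERIV_mult[OF DERIV_minus[OF DERIV_cdivide[OF C(2)[folded Q_def]]] P]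
       DERIV_mult[OF DERIV_cmult[OF C(1)[folded Q_def]] P]]])
      (use assms Q in \<open>simp add: field_simps\<close>)
qed

lemma pole_outside: "R \<noteq> 0 \<Longrightarrow> R\<^sup>2 \<le> \<tau> \<Longrightarrow> pole R s \<tau> = 0 \<and> pole1 R s \<tau> = 0 \<and> pole2 R s \<tau> = 0"
  by (simp add: pole_def pole1_def pole2_def field_simps)

text \<open>In the last bound \<open>4 \<tau> k'' + (4 + 4 s) k'\<close> is the Laplacian of \<open>k\<close> in dimension \<open>2 s + 2\<close>, applied to a
  function of the squared radius. It annihilates \<open>\<tau>\<close> to the power \<open>- s\<close>, so only derivatives of the
  truncation survive and one order of singularity is gained.\<close>
lemma pole_bounds:
  assumes s: "0 \<le> s" "s \<le> 1" and \<tau>: "0 < \<tau>" and R: "0 < R"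
  shows "0 \<le> pole R s \<tau>" "pole R s \<tau> \<le> \<tau> powr (- s)" "\<bar>pole1 R s \<tau>\<bar> \<le> 4 * \<tau> powr (- s - 1)"
    "\<bar>4 * \<tau> * pole2 R s \<tau> + (4 + 4 * s) * pole1 R s \<tau>\<bar> \<le> 48 / R\<^sup>2 * \<tau> powr (- s)"
proof -
  define y where "y = 1 - \<tau> / R\<^sup>2"
  have y: "y \<le> 1" using \<tau> R by (simp add: y_def)
  note p = cube_bounds(1-3)[of y] and b = cube_bounds(4-6)[OF y]
  have pw: "\<tau> powr (- s) = \<tau> * \<tau> powr (- s - 1)" "\<tau> powr (- s - 1) = \<tau> * \<tau> powr (- s - 2)"
  proof -
    have e: "\<tau> powr (1 + c) = \<tau> * \<tau> powr c" for c using \<tau> by (simp add: powr_add)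
    have "1 + (- s - 1) = - s" "1 + (- s - 2) = - s - 1" by simp_all
    then show "\<tau> powr (- s) = \<tau> * \<tau> powr (- s - 1)" "\<tau> powr (- s - 1) = \<tau> * \<tau> powr (- s - 2)"
      using e[of "- s - 1"] e[of "- s - 2"] by (simp_all only:)
  qed
  show "0 \<le> pole R s \<tau>" "pole R s \<tau> \<le> \<tau> powr (- s)" using p b by (simp_all add: pole_def y_def[symmetric] mult_left_le_one_le)
  show "\<bar>pole1 R s \<tau>\<bar> \<le> 4 * \<tau> powr (- s - 1)"
  proof (cases "\<tau> < R\<^sup>2")
    case True
    then have "\<tau> / R\<^sup>2 \<le> 1" using R by simp
    then have "cube1 y * (\<tau> / R\<^sup>2) \<le> 3 * 1" using p b \<tau> R by (intro mult_mono) auto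
    moreover have "s * cube y \<le> 1 * 1" using s p b by (intro mult_mono) auto
    moreover have "0 \<le> cube1 y * (\<tau> / R\<^sup>2)" "0 \<le> s * cube y" using p s \<tau> by auto
    ultimately have "\<bar>- (cube1 y * (\<tau> / R\<^sup>2)) - s * cube y\<bar> \<le> 4" by linarith
    then have "\<bar>- (cube1 y * (\<tau> / R\<^sup>2)) - s * cube y\<bar> * \<tau> powr (- s - 1) \<le> 4 * \<tau> powr (- s - 1)"
      by (rule mult_right_mono) simp
    moreover have "pole1 R s \<tau> = (- (cube1 y * (\<tau> / R\<^sup>2)) - s * cube y) * \<tau> powr (- s - 1)"
      unfolding pole1_def y_def[symmetric] pw(1) by (simp add: algebra_simps)
    ultimately show ?thesis by (simp add: abs_mult)
  qed (use pole_outside[of R \<tau> s] R in simp)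
  show "\<bar>4 * \<tau> * pole2 R s \<tau> + (4 + 4 * s) * pole1 R s \<tau>\<bar> \<le> 48 / R\<^sup>2 * \<tau> powr (- s)"
  proof (cases "\<tau> < R\<^sup>2")
    case True
    have e: "4 * \<tau> * pole2 R s \<tau> + (4 + 4 * s) * pole1 R s \<tau> =
        (4 * (\<tau> / R\<^sup>2) * cube2 y + (4 * s - 4) * cube1 y) / R\<^sup>2 * \<tau> powr (- s)"
    proof -
      define Q where "Q = R\<^sup>2"
      have "Q \<noteq> 0" using R by (simp add: Q_def)
      then show ?thesis
        unfolding pole2_def pole1_def y_def[symmetric] unfolding pw Q_def[symmetric]
        by (simp add: field_simps power2_eq_square)
    qed
    have "\<tau> / R\<^sup>2 \<le> 1" using True R by simp
    then have "(\<tau> / R\<^sup>2) * cube2 y \<le> 1 * 6" using p b \<tau> R by (intro mult_mono) auto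
    moreover have "0 \<le> (\<tau> / R\<^sup>2) * cube2 y" using p \<tau> by auto
    moreover have "(1 - s) * cube1 y \<le> 1 * 3" using p b s by (intro mult_mono) auto
    moreover have "0 \<le> (1 - s) * cube1 y" using p s by auto
    moreover have "\<bar>4 * (\<tau> / R\<^sup>2) * cube2 y + (4 * s - 4) * cube1 y\<bar> \<le> 48"
    proof -
      have "4 * (\<tau> / R\<^sup>2) * cube2 y + (4 * s - 4) * cube1 y = 4 * ((\<tau> / R\<^sup>2) * cube2 y) - 4 * ((1 - s) * cube1 y)"
        by (simp add: algebra_simps)
      then show ?thesis using calculation by linarith
    qed
    ultimately have m: "\<bar>4 * (\<tau> / R\<^sup>2) * cube2 y + (4 * s - 4) * cube1 y\<bar> \<le> 48" by blast
    have "\<bar>4 * \<tau> * pole2 R s \<tau> + (4 + 4 * s) * pole1 R s \<tau>\<bar> =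
        \<bar>4 * (\<tau> / R\<^sup>2) * cube2 y + (4 * s - 4) * cube1 y\<bar> / R\<^sup>2 * \<tau> powr (- s)"
      unfolding e abs_mult[of _ "\<tau> powr (- s)"] abs_divide by simp
    also have "\<dots> \<le> 48 / R\<^sup>2 * \<tau> powr (- s)"
      using m by (intro mult_right_mono divide_right_mono) auto
    finally show ?thesis .
  qed (use pole_outside[of R \<tau> s] R in simp)
qed


text \<open>The radial part of \<open>r\<^sup>\<beta> cos (\<beta> \<phi>)\<close>, cut off near the edge, with its first two derivatives.\<close>
definition edge_profile :: "real \<Rightarrow> real \<Rightarrow> real \<Rightarrow> real" where
  "edge_profile \<beta> \<epsilon> r = r powr \<beta> * cutoff \<epsilon> r"
definition edge_profile1 :: "real \<Rightarrow> real \<Rightarrow> real \<Rightarrow> real" where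
  "edge_profile1 \<beta> \<epsilon> r = \<beta> * r powr (\<beta> - 1) * cutoff \<epsilon> r + r powr \<beta> * cutoff1 \<epsilon> r"
definition edge_profile2 :: "real \<Rightarrow> real \<Rightarrow> real \<Rightarrow> real" where
  "edge_profile2 \<beta> \<epsilon> r = \<beta> * (\<beta> - 1) * r powr (\<beta> - 2) * cutoff \<epsilon> r
     + 2 * \<beta> * r powr (\<beta> - 1) * cutoff1 \<epsilon> r + r powr \<beta> * cutoff2 \<epsilon> r"

lemma edge_profile_derivatives:
  assumes "0 < \<epsilon>" "0 < r"
  shows "(edge_profile \<beta> \<epsilon> has_real_derivative edge_profile1 \<beta> \<epsilon> r) (at r)" "(edge_profile1 \<beta> \<epsilon> has_real_derivative edge_profile2 \<beta> \<epsilon> r) (at r)"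
proof -
  note P = powr_derivative[OF assms(2)] and C = cutoff_derivatives[OF assms(1)]
  show "(edge_profile \<beta> \<epsilon> has_real_derivative edge_profile1 \<beta> \<epsilon> r) (at r)"
    unfolding edge_profile_def[abs_def] edge_profile1_def
    by (rule DERIV_cong[OF DERIV_mult[OF P C(1)]]) (simp add: algebra_simps)
  show "(edge_profile1 \<beta> \<epsilon> has_real_derivative edge_profile2 \<beta> \<epsilon> r) (at r)"
    unfolding edge_profile1_def[abs_def] edge_profile2_def
    by (rule DERIV_cong[OF DERIV_add[OF DERIV_mult[OF DERIV_cmult[OF P] C(1)] DERIV_mult[OF P C(2)]]])
      (simp add: algebra_simps)
qed

lemma square_derivatives:
  fixes r z z0 :: real
  shows "((\<lambda>r. r\<^sup>2 + (z - z0)\<^sup>2) has_real_derivative 2 * r) (at r)"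
    "((\<lambda>z. r\<^sup>2 + (z - z0)\<^sup>2) has_real_derivative 2 * (z - z0)) (at z)"
  by (auto intro!: derivative_eq_intros)

lemma product_derivatives:
  fixes w w1 w2 k k1 k2 :: "real \<Rightarrow> real" and r z z0 :: real
  defines "\<tau> \<equiv> r\<^sup>2 + (z - z0)\<^sup>2"
  assumes w: "(w has_real_derivative w1 r) (at r)" "(w1 has_real_derivative w2 r) (at r)"
    and k: "(k has_real_derivative k1 \<tau>) (at \<tau>)" "(k1 has_real_derivative k2 \<tau>) (at \<tau>)"
  shows "((\<lambda>r. w r * k (r\<^sup>2 + (z - z0)\<^sup>2)) has_real_derivative w1 r * k \<tau> + 2 * r * w r * k1 \<tau>) (at r)"
    "((\<lambda>r. w1 r * k (r\<^sup>2 + (z - z0)\<^sup>2) + 2 * r * w r * k1 (r\<^sup>2 + (z - z0)\<^sup>2)) has_real_derivative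
        w2 r * k \<tau> + 4 * r * w1 r * k1 \<tau> + w r * (2 * k1 \<tau> + 4 * r\<^sup>2 * k2 \<tau>)) (at r)"
    "((\<lambda>z. w r * k (r\<^sup>2 + (z - z0)\<^sup>2)) has_real_derivative 2 * (z - z0) * w r * k1 \<tau>) (at z)"
    "((\<lambda>z. 2 * (z - z0) * w r * k1 (r\<^sup>2 + (z - z0)\<^sup>2)) has_real_derivative
        w r * (2 * k1 \<tau> + 4 * (z - z0)\<^sup>2 * k2 \<tau>)) (at z)"
proof -
  note sq = square_derivatives[of z z0 r] 
  note K = DERIV_chain2[OF k(1)[unfolded \<tau>_def] sq(1)] DERIV_chain2[OF k(2)[unfolded \<tau>_def] sq(1)]
    DERIV_chain2[OF k(1)[unfolded \<tau>_def] square_derivatives(2)] DERIV_chain2[OF k(2)[unfolded \<tau>_def] square_derivatives(2)]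
  show "((\<lambda>r. w r * k (r\<^sup>2 + (z - z0)\<^sup>2)) has_real_derivative w1 r * k \<tau> + 2 * r * w r * k1 \<tau>) (at r)"
    by (rule DERIV_cong[OF DERIV_mult[OF w(1) K(1)]]) (simp add: \<tau>_def algebra_simps)
  show "((\<lambda>r. w1 r * k (r\<^sup>2 + (z - z0)\<^sup>2) + 2 * r * w r * k1 (r\<^sup>2 + (z - z0)\<^sup>2)) has_real_derivative
        w2 r * k \<tau> + 4 * r * w1 r * k1 \<tau> + w r * (2 * k1 \<tau> + 4 * r\<^sup>2 * k2 \<tau>)) (at r)"
    by (rule DERIV_cong[OF DERIV_add[OF DERIV_mult[OF w(2) K(1)]
          DERIV_mult[OF DERIV_mult[OF DERIV_cmult[OF DERIV_ident] w(1)] K(2)]]])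
      (simp add: \<tau>_def algebra_simps power2_eq_square)
  show "((\<lambda>z. w r * k (r\<^sup>2 + (z - z0)\<^sup>2)) has_real_derivative 2 * (z - z0) * w r * k1 \<tau>) (at z)"
    by (rule DERIV_cong[OF DERIV_cmult[OF K(3)]]) (simp add: \<tau>_def algebra_simps)
  have zz: "((\<lambda>z. 2 * (z - z0) * w r) has_real_derivative 2 * w r) (at z)"
    by (auto intro!: derivative_eq_intros)
  show "((\<lambda>z. 2 * (z - z0) * w r * k1 (r\<^sup>2 + (z - z0)\<^sup>2)) has_real_derivative
        w r * (2 * k1 \<tau> + 4 * (z - z0)\<^sup>2 * k2 \<tau>)) (at z)"
    by (rule DERIV_cong[OF DERIV_mult[OF zz K(4)]]) (simp add: \<tau>_def algebra_simps power2_eq_square)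
qed

text \<open>The right-hand side of Green's identity for the truncated pole: the operator
  \<open>r \<psi>\<^sub>r\<^sub>r + \<psi>\<^sub>r + r \<psi>\<^sub>z\<^sub>z - \<beta>\<^sup>2 \<psi> / r\<close> applied to \<open>\<psi> = w (r) k (r\<^sup>2 + (z - z0)\<^sup>2)\<close>.\<close>
definition residual :: "real \<Rightarrow> real \<Rightarrow> real \<Rightarrow> real \<Rightarrow> real \<times> real \<Rightarrow> real" where
  "residual \<beta> R \<epsilon> z0 x = (let r = fst x; z = snd x; \<tau> = r\<^sup>2 + (z - z0)\<^sup>2; s = \<beta> + 1/2;
      w = edge_profile \<beta> \<epsilon> r; w1 = edge_profile1 \<beta> \<epsilon> r; w2 = edge_profile2 \<beta> \<epsilon> r;
      k = pole R s \<tau>; k1 = pole1 R s \<tau>; k2 = pole2 R s \<tau> in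
      r * (w2 * k + 4 * r * w1 * k1 + w * (2 * k1 + 4 * r\<^sup>2 * k2)) + (w1 * k + 2 * r * w * k1)
       + r * (w * (2 * k1 + 4 * (z - z0)\<^sup>2 * k2)) - \<beta>\<^sup>2 * (w * k) / r)"

text \<open>Because \<open>r\<^sup>\<beta> cos (\<beta> \<phi>)\<close> times the pole is harmonic, the residual contains only derivatives of the two
  truncations: a bounded multiple of the pole from the outer one, and from the inner one a term of
  size \<open>1 / \<epsilon>\<^sup>2\<close> that is confined to \<open>r < 2 \<epsilon>\<close>.\<close>
lemma residual_bound:
  fixes \<beta> R \<epsilon> r z z0 :: real
  assumes \<beta>: "0 < \<beta>" "\<beta> \<le> 1 / 2" and R: "0 < R" and \<epsilon>: "0 < \<epsilon>" "\<epsilon> \<le> r"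
  defines "\<tau> \<equiv> r\<^sup>2 + (z - z0)\<^sup>2" and "s \<equiv> \<beta> + 1 / 2"
  shows "r * \<bar>residual \<beta> R \<epsilon> z0 (r, z)\<bar> \<le>
    r powr (\<beta> + 2) * (48 / R\<^sup>2 + (if r < 2 * \<epsilon> then 234 / \<epsilon>\<^sup>2 else 0)) * \<tau> powr (- s)"
proof -
  have r: "0 < r" using \<epsilon> by simp
  have \<tau>: "0 < \<tau>" "r\<^sup>2 \<le> \<tau>" using r by (auto simp: \<tau>_def add_pos_nonneg)
  have s: "0 \<le> s" "s \<le> 1" using \<beta> by (auto simp: s_def)
  define A where "A = r powr \<beta>"
  define c c1 c2 k k1 k2 where d: "c = cutoff \<epsilon> r" "c1 = cutoff1 \<epsilon> r" "c2 = cutoff2 \<epsilon> r"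
    "k = pole R s \<tau>" "k1 = pole1 R s \<tau>" "k2 = pole2 R s \<tau>"
  define w w1 w2 where W: "w = edge_profile \<beta> \<epsilon> r" "w1 = edge_profile1 \<beta> \<epsilon> r" "w2 = edge_profile2 \<beta> \<epsilon> r"
  have pb: "r powr (\<beta> - 1) = A / r" "r powr (\<beta> - 2) = A / r\<^sup>2" "r powr (\<beta> + 2) = A * r\<^sup>2"
    using r by (simp_all add: A_def powr_diff powr_add)
  have w: "w = A * c" "w1 = A * (\<beta> * c / r + c1)" "w2 = A * (\<beta> * (\<beta> - 1) * c / r\<^sup>2 + 2 * \<beta> * c1 / r + c2)"
    unfolding W edge_profile_def edge_profile1_def edge_profile2_def pb d by (simp_all add: A_def[symmetric] field_simps)
  have res: "residual \<beta> R \<epsilon> z0 (r, z) = r * (w2 * k + 4 * r * w1 * k1 + w * (2 * k1 + 4 * r\<^sup>2 * k2))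
      + (w1 * k + 2 * r * w * k1) + r * (w * (2 * k1 + 4 * (z - z0)\<^sup>2 * k2)) - \<beta>\<^sup>2 * (w * k) / r"
    by (simp add: residual_def Let_def d W \<tau>_def s_def)
  have zz: "(z - z0)\<^sup>2 = \<tau> - r\<^sup>2" by (simp add: \<tau>_def)
  have res': "r * residual \<beta> R \<epsilon> z0 (r, z) =
      A * r\<^sup>2 * (c * (4 * \<tau> * k2 + (4 + 4 * s) * k1) + (k * (c2 + (1 + 2 * \<beta>) * c1 / r) + 4 * r * c1 * k1))"
    unfolding res w zz s_def using r by (simp add: field_simps power2_eq_square)
  have "r * \<bar>residual \<beta> R \<epsilon> z0 (r, z)\<bar> = \<bar>r * residual \<beta> R \<epsilon> z0 (r, z)\<bar>"
    using r by (simp add: abs_mult)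
  also have "\<dots> = \<bar>A * r\<^sup>2\<bar> * \<bar>c * (4 * \<tau> * k2 + (4 + 4 * s) * k1) + (k * (c2 + (1 + 2 * \<beta>) * c1 / r) + 4 * r * c1 * k1)\<bar>"
    unfolding res' by (rule abs_mult)
  also have "\<bar>A * r\<^sup>2\<bar> = A * r\<^sup>2" by (simp add: A_def)
  finally have eq: "r * \<bar>residual \<beta> R \<epsilon> z0 (r, z)\<bar> = A * r\<^sup>2 *
      \<bar>c * (4 * \<tau> * k2 + (4 + 4 * s) * k1) + (k * (c2 + (1 + 2 * \<beta>) * c1 / r) + 4 * r * c1 * k1)\<bar>" .
  note cb = cutoff_bounds[OF \<epsilon>(1), of r, folded d] and kb = pole_bounds[OF s \<tau>(1) R, folded d]
  have 1: "\<bar>c * (4 * \<tau> * k2 + (4 + 4 * s) * k1)\<bar> \<le> 1 * (48 / R\<^sup>2 * \<tau> powr (- s))"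
    unfolding abs_mult[of c] using cb kb by (intro mult_mono) auto
  have 2: "\<bar>k * (c2 + (1 + 2 * \<beta>) * c1 / r) + 4 * r * c1 * k1\<bar> \<le> (if r < 2 * \<epsilon> then 234 / \<epsilon>\<^sup>2 else 0) * \<tau> powr (- s)"
  proof (cases "r < 2 * \<epsilon>")
    case True
    have "\<bar>c1 / r\<bar> \<le> (9 / \<epsilon>) / \<epsilon>" unfolding abs_divide using cb r \<epsilon> by (intro frac_le) auto
    then have "\<bar>(1 + 2 * \<beta>) * (c1 / r)\<bar> \<le> 2 * ((9 / \<epsilon>) / \<epsilon>)"
      unfolding abs_mult using \<beta> by (intro mult_mono) auto
    moreover have "2 * ((9 / \<epsilon>) / \<epsilon>) = 18 / \<epsilon>\<^sup>2" by (simp add: power2_eq_square)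
    moreover have "72 / \<epsilon>\<^sup>2 + 18 / \<epsilon>\<^sup>2 = 90 / \<epsilon>\<^sup>2" by (simp flip: add_divide_distrib)
    ultimately have "\<bar>c2 + (1 + 2 * \<beta>) * (c1 / r)\<bar> \<le> 90 / \<epsilon>\<^sup>2" using cb(4) by linarith
    then have "\<bar>c2 + (1 + 2 * \<beta>) * c1 / r\<bar> \<le> 90 / \<epsilon>\<^sup>2" by simp
    then have a: "\<bar>k * (c2 + (1 + 2 * \<beta>) * c1 / r)\<bar> \<le> \<tau> powr (- s) * (90 / \<epsilon>\<^sup>2)"
      unfolding abs_mult[of k] using kb by (intro mult_mono) auto
    have "\<tau> powr (- s - 1) = \<tau> powr (- s) / \<tau>" using \<tau> by (simp add: powr_diff)
    also have "\<dots> \<le> \<tau> powr (- s) / r\<^sup>2" using \<tau> r by (intro divide_left_mono) auto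
    finally have "r * \<tau> powr (- s - 1) \<le> r * (\<tau> powr (- s) / r\<^sup>2)" using r by (intro mult_left_mono) auto
    also have "\<dots> = \<tau> powr (- s) / r" using r by (simp add: power2_eq_square)
    also have "\<dots> \<le> \<tau> powr (- s) / \<epsilon>" using r \<epsilon> by (intro divide_left_mono) auto
    finally have t: "r * \<tau> powr (- s - 1) \<le> \<tau> powr (- s) / \<epsilon>" .
    have "\<bar>4 * r * c1 * k1\<bar> = 4 * (\<bar>c1\<bar> * (r * \<bar>k1\<bar>))" using r by (simp add: abs_mult)
    also have "\<dots> \<le> 4 * (9 / \<epsilon> * (r * (4 * \<tau> powr (- s - 1))))"
      using cb kb r \<epsilon> by (intro mult_left_mono mult_mono) auto
    also have "\<dots> = 144 / \<epsilon> * (r * \<tau> powr (- s - 1))" by simp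
    also have "\<dots> \<le> 144 / \<epsilon> * (\<tau> powr (- s) / \<epsilon>)" using t \<epsilon> by (intro mult_left_mono) auto
    finally have b: "\<bar>4 * r * c1 * k1\<bar> \<le> \<tau> powr (- s) * (144 / \<epsilon>\<^sup>2)" by (simp add: power2_eq_square field_simps)
    have "\<bar>k * (c2 + (1 + 2 * \<beta>) * c1 / r) + 4 * r * c1 * k1\<bar> \<le> \<tau> powr (- s) * (90 / \<epsilon>\<^sup>2) + \<tau> powr (- s) * (144 / \<epsilon>\<^sup>2)"
      by (rule order_trans[OF abs_triangle_ineq add_mono[OF a b]])
    then show ?thesis using True by (simp add: field_simps)
  next
    case False
    then have "c1 = 0" "c2 = 0" using cutoff_high[OF \<epsilon>(1), of r] by (simp_all add: d)
    then show ?thesis using False by simp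
  qed
  have "\<bar>c * (4 * \<tau> * k2 + (4 + 4 * s) * k1) + (k * (c2 + (1 + 2 * \<beta>) * c1 / r) + 4 * r * c1 * k1)\<bar>
      \<le> (48 / R\<^sup>2 + (if r < 2 * \<epsilon> then 234 / \<epsilon>\<^sup>2 else 0)) * \<tau> powr (- s)"
    using order_trans[OF abs_triangle_ineq add_mono[OF 1 2]]
    by (simp only: mult_1 distrib_right[of "48 / R\<^sup>2"])
  then have "A * r\<^sup>2 * \<bar>c * (4 * \<tau> * k2 + (4 + 4 * s) * k1) + (k * (c2 + (1 + 2 * \<beta>) * c1 / r) + 4 * r * c1 * k1)\<bar>
      \<le> A * r\<^sup>2 * ((48 / R\<^sup>2 + (if r < 2 * \<epsilon> then 234 / \<epsilon>\<^sup>2 else 0)) * \<tau> powr (- s))"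
    by (rule mult_left_mono) (simp add: A_def)
  then show ?thesis unfolding eq pb by (simp only: mult.assoc)
qed

section \<open>The Neumann neumann_datum and the pole inequality\<close>

text \<open>The exponent \<open>\<beta>/2 - 1\<close> lies between \<open>- 1\<close>, where square integrability on the sector would fail, and
  \<open>\<beta> - 1\<close>, beyond which the pairing with the pole would converge. Restricting to the sector \<open>\<bar>z\<bar> < r\<close>
  makes \<open>r\<close> comparable to the distance from \<open>p\<close>.\<close>
definition neumann_datum :: "real \<Rightarrow> real \<Rightarrow> real \<times> real \<Rightarrow> real" where
  "neumann_datum \<beta> \<rho> x = (if 0 < fst x \<and> fst x < \<rho> \<and> \<bar>snd x\<bar> < fst x then fst x powr (\<beta> / 2 - 1) else 0)"

lemma measurable_neumann_datum [measurable]: "neumann_datum \<beta> \<rho> \<in> borel_measurable borel"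
  unfolding neumann_datum_def[abs_def] borel_prod[symmetric] by measurable

lemma neumann_datum_nonneg: "0 \<le> neumann_datum \<beta> \<rho> x" by (simp add: neumann_datum_def)

lemma axis_weight_integral:
  fixes \<beta> \<epsilon> z :: real
  assumes "0 < \<beta>" "0 < \<epsilon>"
  shows "(\<integral>\<^sup>+y. ennreal ((\<epsilon> + \<bar>z - y\<bar>) powr (- 1 - 2 * \<beta>)) \<partial>lborel) \<le> ennreal (\<epsilon> powr (- 2 * \<beta>) / \<beta>)"
proof -
  define f where "f y = ennreal ((\<epsilon> + \<bar>y\<bar>) powr (- 1 - 2 * \<beta>))" for y
  have [measurable]: "f \<in> borel_measurable borel" unfolding f_def[abs_def] by measurable
  have half: "(\<integral>\<^sup>+y. f y * indicator {0..} y \<partial>lborel) = ennreal (\<epsilon> powr (- 2 * \<beta>) / (2 * \<beta>))"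
  proof -
    define F where "F y = - ((\<epsilon> + y) powr (- 2 * \<beta>) / (2 * \<beta>))" for y
    have "(\<integral>\<^sup>+y. ennreal ((\<epsilon> + y) powr (- 1 - 2 * \<beta>)) * indicator {0..} y \<partial>lborel) = ennreal (0 - F 0)"
    proof (rule nn_integral_FTC_atLeast)
      show "(F has_real_derivative (\<epsilon> + y) powr (- 1 - 2 * \<beta>)) (at y)" if "0 \<le> y" for y
      proof -
        have e: "((\<lambda>y. \<epsilon> + y) has_real_derivative 1) (at y)" by (auto intro!: derivative_eq_intros)
        have "0 < \<epsilon> + y" using that assms by simp
        have e': "- 2 * \<beta> - 1 = - 1 - 2 * \<beta>" by simp
        from DERIV_chain2[OF powr_derivative[OF \<open>0 < \<epsilon> + y\<close>, of "- 2 * \<beta>"] e]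
        have "((\<lambda>y. (\<epsilon> + y) powr (- 2 * \<beta>)) has_real_derivative - 2 * \<beta> * (\<epsilon> + y) powr (- 1 - 2 * \<beta>)) (at y)"
          unfolding e' mult_1_right .
        from DERIV_cdivide[OF this, of "- 2 * \<beta>"] show ?thesis using assms by (simp add: F_def[abs_def])
      qed
      have "((\<lambda>y. (\<epsilon> + y) powr (- 2 * \<beta>)) \<longlongrightarrow> 0) at_top"
        using assms by (intro tendsto_neg_powr filterlim_tendsto_add_at_top[OF tendsto_const filterlim_ident]) auto
      from tendsto_minus[OF tendsto_divide_zero[OF this, of "2 * \<beta>"]]
      show "(F \<longlongrightarrow> 0) at_top" by (simp add: F_def[abs_def])
    qed (auto)
    also have "(\<integral>\<^sup>+y. ennreal ((\<epsilon> + y) powr (- 1 - 2 * \<beta>)) * indicator {0..} y \<partial>lborel) = (\<integral>\<^sup>+y. f y * indicator {0..} y \<partial>lborel)"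
      by (intro nn_integral_cong) (simp add: f_def indicator_def)
    finally show ?thesis by (simp add: F_def)
  qed
  have "(\<integral>\<^sup>+y. f (z - y) \<partial>lborel) = (\<integral>\<^sup>+y. f y \<partial>lborel)"
    by (subst nn_integral_real_affine[of f "-1" z]) simp_all
  also have "\<dots> \<le> (\<integral>\<^sup>+y. f y * indicator {0..} y + f (- y) * indicator {0..} (- y) \<partial>lborel)"
    by (intro nn_integral_mono) (auto simp: f_def indicator_def)
  also have "\<dots> = (\<integral>\<^sup>+y. f y * indicator {0..} y \<partial>lborel) + (\<integral>\<^sup>+y. f (- y) * indicator {0..} (- y) \<partial>lborel)"
    by (intro nn_integral_add) measurable
  also have "(\<integral>\<^sup>+y. f (- y) * indicator {0..} (- y) \<partial>lborel) = (\<integral>\<^sup>+y. f y * indicator {0..} y \<partial>lborel)"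
    by (subst nn_integral_real_affine[of "\<lambda>y. f y * indicator {0..} y" "-1" 0]) simp_all
  also have "(\<integral>\<^sup>+y. f y * indicator {0..} y \<partial>lborel) + (\<integral>\<^sup>+y. f y * indicator {0..} y \<partial>lborel) =
      ennreal (\<epsilon> powr (- 2 * \<beta>) / \<beta>)"
    unfolding half using assms by (subst ennreal_plus[symmetric]) (auto simp: field_simps)
  finally show ?thesis by (simp add: f_def)
qed

text \<open>Sizes of the two parts of the residual: the outer one is bounded uniformly in the pole, the inner
  one is a kernel of width \<open>\<epsilon>\<close> along the edge.\<close>
lemma pole_kernel_bounds:
  fixes \<beta> r z z0 \<epsilon> :: real
  assumes \<beta>: "0 < \<beta>" "\<beta> \<le> 1 / 2" and \<epsilon>: "0 < \<epsilon>" "\<epsilon> \<le> r"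
  defines "\<tau> \<equiv> r\<^sup>2 + (z - z0)\<^sup>2"
  shows "r powr (\<beta> + 2) * \<tau> powr (- (\<beta> + 1/2)) \<le> r powr (1 - \<beta>)"
    "r < 2 * \<epsilon> \<Longrightarrow> r powr (\<beta> + 2) * (234 / \<epsilon>\<^sup>2) * \<tau> powr (- (\<beta> + 1/2)) \<le>
        3744 * \<epsilon> powr \<beta> * (\<epsilon> + \<bar>z - z0\<bar>) powr (- 1 - 2 * \<beta>)"
proof -
  have r: "0 < r" using \<epsilon> by simp
  have \<tau>: "0 < \<tau>" using r by (auto simp: \<tau>_def add_pos_nonneg)
  have sq: "(y\<^sup>2) powr c = y powr (2 * c)" if "0 < y" for y c :: real
    using that powr_powr[of y 2 c] by (simp add: powr_numeral)
  have "\<tau> powr (- (\<beta> + 1/2)) \<le> (r\<^sup>2) powr (- (\<beta> + 1/2))"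
    using r \<beta> by (intro powr_mono2') (auto simp: \<tau>_def)
  also have "\<dots> = r powr (- 2 * \<beta> - 1)" using r by (simp add: sq)
  finally have "r powr (\<beta> + 2) * \<tau> powr (- (\<beta> + 1/2)) \<le> r powr (\<beta> + 2) * r powr (- 2 * \<beta> - 1)"
    by (rule mult_left_mono) simp
  also have "\<dots> = r powr (1 - \<beta>)" by (simp flip: powr_add)
  finally show "r powr (\<beta> + 2) * \<tau> powr (- (\<beta> + 1/2)) \<le> r powr (1 - \<beta>)" .
  assume r2: "r < 2 * \<epsilon>"
  have "r powr (\<beta> + 2) \<le> (2 * \<epsilon>) powr (\<beta> + 2)" using r r2 \<beta> by (intro powr_mono2) auto
  also have "\<dots> = 2 powr (\<beta> + 2) * \<epsilon> powr (\<beta> + 2)" using \<epsilon> by (simp add: powr_mult)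
  also have "\<dots> \<le> 2 powr 3 * \<epsilon> powr (\<beta> + 2)" using \<beta> by (intro mult_right_mono powr_mono) auto
  also have "\<dots> = 8 * (\<epsilon> powr \<beta> * \<epsilon>\<^sup>2)" using \<epsilon> by (simp add: powr_add powr_numeral)
  finally have 1: "r powr (\<beta> + 2) * (234 / \<epsilon>\<^sup>2) \<le> 8 * (\<epsilon> powr \<beta> * \<epsilon>\<^sup>2) * (234 / \<epsilon>\<^sup>2)"
    by (rule mult_right_mono) simp
  also have "\<dots> = 1872 * \<epsilon> powr \<beta>" using \<epsilon> by simp
  finally have 1: "r powr (\<beta> + 2) * (234 / \<epsilon>\<^sup>2) \<le> 1872 * \<epsilon> powr \<beta>" .
  define y where "y = \<epsilon> + \<bar>z - z0\<bar>"
  have y: "0 < y" using \<epsilon> by (simp add: y_def add_pos_nonneg)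
  have "\<epsilon>\<^sup>2 \<le> r\<^sup>2" using \<epsilon> by (intro power_mono) auto
  moreover have "y\<^sup>2 / 2 \<le> \<epsilon>\<^sup>2 + (z - z0)\<^sup>2"
    using sum_squares_bound[of \<epsilon> "\<bar>z - z0\<bar>"] by (simp add: y_def power2_sum)
  ultimately have "y\<^sup>2 / 2 \<le> \<tau>" by (simp add: \<tau>_def)
  then have "\<tau> powr (- (\<beta> + 1/2)) \<le> (y\<^sup>2 / 2) powr (- (\<beta> + 1/2))"
    using y \<beta> by (intro powr_mono2') auto
  also have "\<dots> = 2 powr (\<beta> + 1/2) * y powr (- 1 - 2 * \<beta>)"
  proof -
    define c where "c = \<beta> + 1/2"
    have e: "2 * (- c) = - 1 - 2 * \<beta>" by (simp add: c_def)
    have "(y\<^sup>2 / 2) powr (- c) = (y\<^sup>2) powr (- c) / 2 powr (- c)" by (rule powr_divide)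
    also have "\<dots> = y powr (- 1 - 2 * \<beta>) / 2 powr (- c)" using y by (simp only: sq e)
    also have "\<dots> = 2 powr c * y powr (- 1 - 2 * \<beta>)" by (simp add: powr_minus divide_inverse)
    finally show ?thesis by (simp add: c_def)
  qed
  also have "\<dots> \<le> 2 powr 1 * y powr (- 1 - 2 * \<beta>)" using \<beta> by (intro mult_right_mono powr_mono) auto
  finally have p: "\<tau> powr (- (\<beta> + 1/2)) \<le> 2 * y powr (- 1 - 2 * \<beta>)" by simp
  have "r powr (\<beta> + 2) * (234 / \<epsilon>\<^sup>2) * \<tau> powr (- (\<beta> + 1/2)) \<le> (1872 * \<epsilon> powr \<beta>) * (2 * y powr (- 1 - 2 * \<beta>))"
    by (rule mult_mono[OF 1 p]) auto
  then show "r powr (\<beta> + 2) * (234 / \<epsilon>\<^sup>2) * \<tau> powr (- (\<beta> + 1/2)) \<le>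
        3744 * \<epsilon> powr \<beta> * (\<epsilon> + \<bar>z - z0\<bar>) powr (- 1 - 2 * \<beta>)"
    by (simp add: y_def)
qed

lemma test_function_lower_bound:
  fixes \<beta> r z z0 \<epsilon> R :: real
  assumes \<beta>: "0 < \<beta>" "\<beta> \<le> 1 / 2" and \<epsilon>: "0 < \<epsilon>" "2 * \<epsilon> \<le> r" and r: "r \<le> R / 4"
    and z: "\<bar>z\<bar> \<le> r" "\<bar>z0\<bar> \<le> r"
  shows "r powr (- 1 - \<beta>) / 40 \<le> edge_profile \<beta> \<epsilon> r * pole R (\<beta> + 1/2) (r\<^sup>2 + (z - z0)\<^sup>2)"
proof -
  define \<tau> where "\<tau> = r\<^sup>2 + (z - z0)\<^sup>2"
  have r0: "0 < r" using \<epsilon> by simp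
  have \<tau>0: "0 < \<tau>" using r0 by (auto simp: \<tau>_def add_pos_nonneg)
  have "\<bar>z - z0\<bar> \<le> 2 * r" using z by linarith
  then have "(z - z0)\<^sup>2 \<le> (2 * r)\<^sup>2" using r0 by (intro abs_le_square_iff[THEN iffD1]) auto
  then have \<tau>: "\<tau> \<le> 5 * r\<^sup>2" by (simp add: \<tau>_def power_mult_distrib)
  have "r\<^sup>2 \<le> (R / 4)\<^sup>2" using r r0 by (intro power_mono) auto
  then have "16 * r\<^sup>2 \<le> R\<^sup>2" by (simp add: power_divide)
  then have "2 * \<tau> \<le> R\<^sup>2" using \<tau> zero_le_power2[of r] by linarith
  moreover have "0 < R" using r r0 by simp
  ultimately have "\<tau> / R\<^sup>2 \<le> 1 / 2" by (simp add: field_simps)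
  then have "(1 / 2) ^ 3 \<le> (1 - \<tau> / R\<^sup>2) ^ 3" by (intro power_mono) auto
  also have "\<dots> \<le> cube (1 - \<tau> / R\<^sup>2)" using \<open>\<tau> / R\<^sup>2 \<le> 1 / 2\<close> by (simp add: cube_def)
  finally have c: "1 / 8 \<le> cube (1 - \<tau> / R\<^sup>2)" by (simp add: power_divide)
  have sq: "(r\<^sup>2) powr c = r powr (2 * c)" for c :: real
    using r0 powr_powr[of r 2 c] by (simp add: powr_numeral)
  have e: "2 * (- (\<beta> + 1/2)) = - 1 - 2 * \<beta>" by simp
  have "r powr (- 1 - 2 * \<beta>) / 5 = 5 powr (- 1) * r powr (- 1 - 2 * \<beta>)" by (simp add: powr_minus)
  also have "\<dots> \<le> 5 powr (- (\<beta> + 1/2)) * r powr (- 1 - 2 * \<beta>)"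
    using \<beta> by (intro mult_right_mono powr_mono) auto
  also have "\<dots> = (5 * r\<^sup>2) powr (- (\<beta> + 1/2))" using r0 by (simp only: powr_mult sq e zero_le_power2)
  also have "\<dots> \<le> \<tau> powr (- (\<beta> + 1/2))" using \<tau> \<tau>0 \<beta> by (intro powr_mono2') auto
  finally have p: "r powr (- 1 - 2 * \<beta>) / 5 \<le> \<tau> powr (- (\<beta> + 1/2))" .
  have "r powr (- 1 - \<beta>) / 40 = r powr \<beta> * (1 / 8 * (r powr (- 1 - 2 * \<beta>) / 5))"
  proof -
    have "\<beta> + (- 1 - 2 * \<beta>) = - 1 - \<beta>" by simp
    then have "r powr (- 1 - \<beta>) = r powr \<beta> * r powr (- 1 - 2 * \<beta>)" by (simp only: flip: powr_add)
    then show ?thesis by simp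
  qed
  also have "\<dots> \<le> r powr \<beta> * (cube (1 - \<tau> / R\<^sup>2) * \<tau> powr (- (\<beta> + 1/2)))"
    using c p by (intro mult_left_mono mult_mono) auto
  also have "\<dots> = edge_profile \<beta> \<epsilon> r * pole R (\<beta> + 1/2) \<tau>"
    using cutoff_high(1)[OF \<epsilon>] by (simp add: edge_profile_def pole_def)
  finally show ?thesis by (simp add: \<tau>_def)
qed


context polyhedral_wedge begin

lemma pole_inequality:
  fixes S g :: "real \<times> real \<Rightarrow> real" and L \<epsilon> z0 :: real
  defines "B \<equiv> cbox (\<epsilon>, - L) (L, L)"
  assumes h: "harmonic_on u \<Omega>"
    and S: "S \<in> borel_measurable borel" and Sint: "set_integrable lborel B S"
    and g: "g \<in> borel_measurable borel" "\<And>x. 0 \<le> g x"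
    and bound: "AE x in lborel. x \<in> region \<longrightarrow> (\<forall>\<phi>. 0 < \<phi> \<longrightarrow> \<phi> < \<theta> \<longrightarrow> norm (grad u (cyl \<phi> x)) \<le> S x)"
    and dirichlet: "AE x in lborel. x \<in> region \<longrightarrow> ((\<lambda>\<phi>. u (cyl \<phi> x)) \<longlongrightarrow> 0) (at_left \<theta>)"
    and neumann: "AE x in lborel. x \<in> region \<longrightarrow> ((\<lambda>\<phi>. - b \<bullet> grad u (cyl \<phi> x)) \<longlongrightarrow> g x) (at_right 0)"
    and L: "4 * L < \<rho>" and \<epsilon>: "0 < \<epsilon>" "\<epsilon> \<le> L" and z0: "\<bar>z0\<bar> \<le> L / 2"
  shows "(\<integral>\<^sup>+x\<in>B. ennreal (g x * (edge_profile \<beta> \<epsilon> (fst x) * pole (L / 2) (\<beta> + 1/2) ((fst x)\<^sup>2 + (snd x - z0)\<^sup>2))) \<partial>lborel)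
    \<le> ennreal (\<theta>\<^sup>2) * (\<integral>\<^sup>+x\<in>B. ennreal (S x * (fst x * \<bar>residual \<beta> (L / 2) \<epsilon> z0 x\<bar>)) \<partial>lborel)"
proof -
  define s where "s = \<beta> + 1/2"
  define \<tau> where "\<tau> x = (fst x)\<^sup>2 + (snd x - z0)\<^sup>2" for x :: "real \<times> real"
  define w w1 w2 k k1 k2 where d: "w = edge_profile \<beta> \<epsilon>" "w1 = edge_profile1 \<beta> \<epsilon>" "w2 = edge_profile2 \<beta> \<epsilon>"
    "k = pole (L / 2) s" "k1 = pole1 (L / 2) s" "k2 = pole2 (L / 2) s"
  define \<psi> where "\<psi> x = w (fst x) * k (\<tau> x)" for x
  define \<psi>r where "\<psi>r x = w1 (fst x) * k (\<tau> x) + 2 * fst x * w (fst x) * k1 (\<tau> x)" for x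
  define \<psi>z where "\<psi>z x = 2 * (snd x - z0) * w (fst x) * k1 (\<tau> x)" for x
  define \<psi>rr where "\<psi>rr x = w2 (fst x) * k (\<tau> x) + 4 * fst x * w1 (fst x) * k1 (\<tau> x)
      + w (fst x) * (2 * k1 (\<tau> x) + 4 * (fst x)\<^sup>2 * k2 (\<tau> x))" for x
  define \<psi>zz where "\<psi>zz x = w (fst x) * (2 * k1 (\<tau> x) + 4 * (snd x - z0)\<^sup>2 * k2 (\<tau> x))" for x
  have L0: "0 < L" using \<epsilon> by simp
  have B: "0 < fst x" "0 < \<tau> x" if "x \<in> B" for x
    using that \<epsilon> by (cases x; auto simp: B_def \<tau>_def add_pos_nonneg)+
  have reg: "B \<subseteq> region"
  proof safe
    fix r z assume x: "(r, z) \<in> B"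
    then have "norm (r, z) \<le> \<bar>r\<bar> + \<bar>z\<bar>" using norm_Pair_le[of r z] by simp
    also have "\<dots> \<le> 2 * L" using x \<epsilon> by (auto simp: B_def)
    finally show "(r, z) \<in> region" using x B[of "(r, z)"] L by (auto simp: region_def)
  qed
  have P: "((\<lambda>r. \<psi> (r, z)) has_real_derivative \<psi>r (r, z)) (at r)"
      "((\<lambda>r. \<psi>r (r, z)) has_real_derivative \<psi>rr (r, z)) (at r)"
      "((\<lambda>z. \<psi> (r, z)) has_real_derivative \<psi>z (r, z)) (at z)"
      "((\<lambda>z. \<psi>z (r, z)) has_real_derivative \<psi>zz (r, z)) (at z)" if "(r, z) \<in> B" for r z
  proof -
    have r: "0 < r" and t: "0 < r\<^sup>2 + (z - z0)\<^sup>2" using B[OF that] by (auto simp: \<tau>_def)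
    have "L / 2 \<noteq> 0" using L0 by simp
    note D = product_derivatives[of w w1 r w2 k k1 z z0 k2]
    have D': "(w has_real_derivative w1 r) (at r)" "(w1 has_real_derivative w2 r) (at r)"
      "(k has_real_derivative k1 (r\<^sup>2 + (z - z0)\<^sup>2)) (at (r\<^sup>2 + (z - z0)\<^sup>2))"
      "(k1 has_real_derivative k2 (r\<^sup>2 + (z - z0)\<^sup>2)) (at (r\<^sup>2 + (z - z0)\<^sup>2))"
      using edge_profile_derivatives[OF \<epsilon>(1) r] pole_derivatives[OF t \<open>L / 2 \<noteq> 0\<close>] by (simp_all add: d)
    show "((\<lambda>r. \<psi> (r, z)) has_real_derivative \<psi>r (r, z)) (at r)"
      "((\<lambda>r. \<psi>r (r, z)) has_real_derivative \<psi>rr (r, z)) (at r)"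
      "((\<lambda>z. \<psi> (r, z)) has_real_derivative \<psi>z (r, z)) (at z)"
      "((\<lambda>z. \<psi>z (r, z)) has_real_derivative \<psi>zz (r, z)) (at z)"
      using D[OF D'] by (simp_all add: \<psi>_def \<psi>r_def \<psi>rr_def \<psi>z_def \<psi>zz_def \<tau>_def)
  qed
  have cw: "continuous_on B (\<lambda>x. w (fst x))" "continuous_on B (\<lambda>x. w1 (fst x))" "continuous_on B (\<lambda>x. w2 (fst x))"
    unfolding d edge_profile_def edge_profile1_def edge_profile2_def using \<epsilon>(1)
    by (intro continuous_intros; force dest: B(1))+
  have ct: "continuous_on B \<tau>" unfolding \<tau>_def[abs_def] by (intro continuous_intros)
  have ck: "continuous_on B (\<lambda>x. k (\<tau> x))" "continuous_on B (\<lambda>x. k1 (\<tau> x))" "continuous_on B (\<lambda>x. k2 (\<tau> x))"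
    unfolding d pole_def pole1_def pole2_def using L0
    by (intro continuous_intros ct; force dest: B(2))+
  have c: "continuous_on B \<psi>" "continuous_on B \<psi>r" "continuous_on B \<psi>rr" "continuous_on B \<psi>zz"
    unfolding \<psi>_def[abs_def] \<psi>r_def[abs_def] \<psi>rr_def[abs_def] \<psi>zz_def[abs_def]
    by (intro continuous_intros cw ck)+
  have w0: "w \<epsilon> = 0" "w1 \<epsilon> = 0" using cutoff_low[OF \<epsilon>(1), of \<epsilon>] by (simp_all add: d edge_profile_def edge_profile1_def)
  have k0: "k y = 0" "k1 y = 0" if "(L / 2)\<^sup>2 \<le> y" for y
    using pole_outside[of "L / 2" y s] that L0 by (simp_all add: d)
  have t1: "(L / 2)\<^sup>2 \<le> \<tau> (L, z)" for z
  proof -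
    have "(L / 2)\<^sup>2 \<le> L\<^sup>2" using L0 by (intro power_mono) auto
    then show ?thesis by (simp add: \<tau>_def add_increasing2)
  qed
  have t2: "(L / 2)\<^sup>2 \<le> \<tau> (r, L)" "(L / 2)\<^sup>2 \<le> \<tau> (r, - L)" for r
  proof -
    have "(L / 2)\<^sup>2 \<le> (L - z0)\<^sup>2" "(L / 2)\<^sup>2 \<le> (- L - z0)\<^sup>2"
      using z0 L0 by (auto intro!: abs_le_square_iff[THEN iffD1])
    then show "(L / 2)\<^sup>2 \<le> \<tau> (r, L)" "(L / 2)\<^sup>2 \<le> \<tau> (r, - L)" by (simp_all add: \<tau>_def add_increasing)
  qed
  have pos: "0 \<le> \<psi> x" for x
    using cutoff_bounds(1)[OF \<epsilon>(1)] cube_bounds(1) by (simp add: \<psi>_def d edge_profile_def pole_def)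
  have "(\<integral>\<^sup>+x\<in>B. ennreal (g x * \<psi> x) \<partial>lborel) \<le> ennreal (\<theta>\<^sup>2) * (\<integral>\<^sup>+x\<in>B. ennreal (S x *
      (fst x * \<bar>fst x * \<psi>rr x + \<psi>r x + fst x * \<psi>zz x - \<beta>\<^sup>2 * \<psi> x / fst x\<bar>)) \<partial>lborel)"
    unfolding B_def
  proof (rule test_inequality[OF h S Sint[unfolded B_def] g(1) bound dirichlet neumann reg[unfolded B_def] \<epsilon>(2) _ P[unfolded B_def] c[unfolded B_def]])
    show "- L \<le> L" using L0 by simp
  qed (use w0 k0[OF t1] k0[OF t2(1)] k0[OF t2(2)] pos g(2) in \<open>simp_all add: \<psi>_def \<psi>r_def \<psi>z_def\<close>)
  then show ?thesis
    by (simp add: \<psi>_def \<psi>r_def \<psi>rr_def \<psi>zz_def residual_def Let_def d s_def \<tau>_def)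
qed

end

section \<open>Averaging over poles: the gradient is not square integrable\<close>

context polyhedral_wedge begin

definition half_box :: "real \<Rightarrow> (real \<times> real) set" where
  "half_box L = {x. 0 < fst x \<and> fst x \<le> L \<and> \<bar>snd x\<bar> \<le> L}"

lemma measurable_half_box [measurable]: "half_box L \<in> sets borel"
proof -
  have "half_box L = {0<..L} \<times> {- L..L}" by (auto simp: half_box_def)
  then show ?thesis by (simp add: borel_Times)
qed

lemma measurable_strip [measurable]: "{x :: real \<times> real. fst x < c} \<in> sets borel"
proof -
  have "{x :: real \<times> real. fst x < c} = {..<c} \<times> UNIV" by auto
  then show ?thesis by (simp add: borel_Times)
qed

lemma emeasure_strip:
  assumes "0 < \<epsilon>" "0 < L"
  shows "emeasure lborel (half_box L \<inter> {x. fst x < 2 * \<epsilon>}) \<le> ennreal (4 * L * \<epsilon>)"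
proof -
  have "half_box L \<inter> {x. fst x < 2 * \<epsilon>} \<subseteq> {0..2 * \<epsilon>} \<times> {- L..L}"
    by (auto simp: half_box_def)
  then have "emeasure lborel (half_box L \<inter> {x. fst x < 2 * \<epsilon>}) \<le> emeasure lborel ({0..2 * \<epsilon>} \<times> {- L..L})"
    by (intro emeasure_mono) (auto simp: borel_Times)
  also have "\<dots> = emeasure lborel {0..2 * \<epsilon>} * emeasure lborel {- L..L}"
    by (simp add: lborel_prod[symmetric] lborel.emeasure_pair_measure_Times)
  also have "\<dots> = ennreal (4 * L * \<epsilon>)" using assms by (simp flip: ennreal_mult add: mult_ac)
  finally show ?thesis .
qed

text \<open>The Cauchy-Schwarz inequality on a strip of area proportional to \<open>\<epsilon>\<close>, in the additive form
  \<open>S \<le> c S\<^sup>2 + 1 / c\<close>; the parameter \<open>\<mu>\<close> will later make the second summand small.\<close>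
lemma strip_integral_bound:
  fixes S :: "real \<times> real \<Rightarrow> real"
  assumes S[measurable]: "S \<in> borel_measurable borel" and S0: "\<And>x. 0 \<le> S x"
    and \<epsilon>: "0 < \<epsilon>" and L: "0 < L" and \<mu>: "0 < \<mu>"
  shows "(\<integral>\<^sup>+x\<in>half_box L \<inter> {x. fst x < 2 * \<epsilon>}. ennreal (S x) \<partial>lborel) \<le>
    ennreal (sqrt \<epsilon>) * (ennreal \<mu> * (\<integral>\<^sup>+x\<in>half_box L \<inter> {x. fst x < 2 * \<epsilon>}. ennreal ((S x)\<^sup>2) \<partial>lborel) + ennreal (4 * L / \<mu>))"
proof -
  let ?A = "half_box L \<inter> {x. fst x < 2 * \<epsilon>}"
  have [measurable]: "?A \<in> sets borel" by (intro sets.Int measurable_half_box measurable_strip)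
  define q where "q = sqrt \<epsilon>"
  have q: "0 < q" "q * q = \<epsilon>" using \<epsilon> by (simp_all add: q_def)
  have pt: "S x \<le> \<mu> * q * (S x)\<^sup>2 + 1 / (\<mu> * q)" for x
  proof -
    define c where "c = \<mu> * q"
    have c: "0 < c" using \<mu> q by (simp add: c_def)
    have "0 \<le> (c * S x - 1)\<^sup>2 + c * S x" using c S0[of x] by simp
    then have "c * S x \<le> c * (c * (S x)\<^sup>2) + 1" by (simp add: power2_eq_square algebra_simps)
    then have "S x \<le> c * (S x)\<^sup>2 + 1 / c" using c by (simp add: field_simps)
    then show ?thesis by (simp add: c_def)
  qed
  have "(\<integral>\<^sup>+x\<in>?A. ennreal (S x) \<partial>lborel) \<le>
      (\<integral>\<^sup>+x. ennreal (\<mu> * q) * (ennreal ((S x)\<^sup>2) * indicator ?A x) + ennreal (1 / (\<mu> * q)) * indicator ?A x \<partial>lborel)"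
  proof (rule nn_integral_mono)
    fix x
    show "ennreal (S x) * indicator ?A x \<le> ennreal (\<mu> * q) * (ennreal ((S x)\<^sup>2) * indicator ?A x) + ennreal (1 / (\<mu> * q)) * indicator ?A x"
      using ennreal_leI[OF pt[of x]] \<mu> q by (simp add: indicator_def ennreal_plus ennreal_mult)
  qed
  also have "\<dots> = ennreal (\<mu> * q) * (\<integral>\<^sup>+x\<in>?A. ennreal ((S x)\<^sup>2) \<partial>lborel) + ennreal (1 / (\<mu> * q)) * emeasure lborel ?A"
    by (subst nn_integral_add) (auto simp: nn_integral_cmult)
  also have "\<dots> \<le> ennreal (\<mu> * q) * (\<integral>\<^sup>+x\<in>?A. ennreal ((S x)\<^sup>2) \<partial>lborel) + ennreal (1 / (\<mu> * q)) * ennreal (4 * L * \<epsilon>)"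
    by (intro add_mono mult_left_mono emeasure_strip \<epsilon> L) auto
  also have "ennreal (1 / (\<mu> * q)) * ennreal (4 * L * \<epsilon>) = ennreal q * ennreal (4 * L / \<mu>)"
    using \<mu> q L \<epsilon> by (simp add: q(2)[symmetric] field_simps flip: ennreal_mult)
  also have "ennreal (\<mu> * q) = ennreal q * ennreal \<mu>" using \<mu> q by (simp add: ennreal_mult mult.commute)
  finally show ?thesis by (simp add: q_def distrib_left mult.assoc)
qed

lemma strip_square_integral_tendsto:
  fixes S :: "real \<times> real \<Rightarrow> real"
  assumes S[measurable]: "S \<in> borel_measurable borel"
    and fin: "(\<integral>\<^sup>+x\<in>half_box L. ennreal ((S x)\<^sup>2) \<partial>lborel) < \<infinity>"
  shows "(\<lambda>k. \<integral>\<^sup>+x\<in>half_box L \<inter> {x. fst x < 2 * inverse (real (Suc k))}. ennreal ((S x)\<^sup>2) \<partial>lborel) \<longlonglongrightarrow> 0"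
proof -
  let ?A = "\<lambda>k. half_box L \<inter> {x. fst x < 2 * inverse (real (Suc k))}"
  have [measurable]: "?A k \<in> sets borel" for k by (intro sets.Int measurable_half_box measurable_strip)
  have "(\<lambda>k. \<integral>\<^sup>+x\<in>?A k. ennreal ((S x)\<^sup>2) \<partial>lborel) \<longlonglongrightarrow> (\<integral>\<^sup>+x. 0 \<partial>(lborel :: (real \<times> real) measure))"
  proof (rule nn_integral_dominated_convergence[where w="\<lambda>x. ennreal ((S x)\<^sup>2) * indicator (half_box L) x"])
    show "(\<integral>\<^sup>+x\<in>half_box L. ennreal ((S x)\<^sup>2) \<partial>lborel) < \<infinity>" by (rule fin)
    show "AE x in lborel. (\<lambda>k. ennreal ((S x)\<^sup>2) * indicator (?A k) x) \<longlonglongrightarrow> 0"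
    proof (intro AE_I2 tendsto_eventually)
      fix x :: "real \<times> real"
      show "\<forall>\<^sub>F k in sequentially. ennreal ((S x)\<^sup>2) * indicator (?A k) x = 0"
      proof (cases "x \<in> half_box L")
        case True
        then have "0 < fst x / 2" by (simp add: half_box_def)
        with LIMSEQ_inverse_real_of_nat have "\<forall>\<^sub>F k in sequentially. inverse (real (Suc k)) < fst x / 2"
          by (rule order_tendstoD(2))
        then show ?thesis by eventually_elim (simp add: indicator_def)
      qed simp
    qed
    show "(\<lambda>x. ennreal ((S x)\<^sup>2) * indicator (?A k) x) \<in> borel_measurable lborel" for k by measurable
    show "AE x in lborel. ennreal ((S x)\<^sup>2) * indicator (?A k) x \<le> ennreal ((S x)\<^sup>2) * indicator (half_box L) x" for k
      by (intro AE_I2) (simp add: indicator_def)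
  qed auto
  then show ?thesis by simp
qed

text \<open>For \<open>2 \<epsilon> \<le> \<delta>\<close> and a pole \<open>y\<close> in \<open>[0, \<delta>]\<close>, the pairing of the datum with the pole is at least a multiple
  of \<open>\<delta>\<close> to the power \<open>- \<beta>/2\<close>, because of a rectangle of size \<open>\<delta>\<close> next to \<open>p\<close> alone. It is bounded by a
  constant plus the error \<open>K \<epsilon> y\<close>. Integrated over \<open>y\<close>, the error is at most a multiple of \<open>\<epsilon>\<close> to the power
  \<open>1/2 - \<beta>\<close> times a quantity tending to \<open>0\<close>; this is where \<open>\<beta> \<le> 1/2\<close>, that is \<open>\<theta> \<ge> \<pi>\<close>, is decisive. Letting
  first \<open>\<epsilon>\<close> and then \<open>\<delta>\<close> tend to \<open>0\<close> gives the contradiction.\<close>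
lemma gradient_not_square_integrable:
  fixes S :: "real \<times> real \<Rightarrow> real" and L :: real
  assumes h: "harmonic_on u \<Omega>"
    and S[measurable]: "S \<in> borel_measurable borel" and S0: "\<And>x. 0 \<le> S x"
    and bound: "AE x in lborel. x \<in> region \<longrightarrow> (\<forall>\<phi>. 0 < \<phi> \<longrightarrow> \<phi> < \<theta> \<longrightarrow> norm (grad u (cyl \<phi> x)) \<le> S x)"
    and dirichlet: "AE x in lborel. x \<in> region \<longrightarrow> ((\<lambda>\<phi>. u (cyl \<phi> x)) \<longlongrightarrow> 0) (at_left \<theta>)"
    and neumann: "AE x in lborel. x \<in> region \<longrightarrow> ((\<lambda>\<phi>. - b \<bullet> grad u (cyl \<phi> x)) \<longlongrightarrow> neumann_datum \<beta> (L / 8) x) (at_right 0)"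
    and L: "0 < L" "4 * L < \<rho>"
    and fin: "(\<integral>\<^sup>+x\<in>half_box L. ennreal ((S x)\<^sup>2) \<partial>lborel) < \<infinity>"
  shows False
proof -
  have \<theta>0: "0 < \<theta>" using \<theta> pi_gt_zero by linarith
  define Q where "Q = half_box L"
  have Qm[measurable]: "Q \<in> sets borel" by (simp add: Q_def measurable_half_box)
  define J where "J = (\<integral>\<^sup>+x\<in>Q. ennreal (S x) \<partial>lborel)"
  have QL: "half_box L \<inter> {x. fst x < 2 * L} = Q" using L by (auto simp: half_box_def Q_def)
  have "J \<le> ennreal (sqrt L) * (ennreal 1 * (\<integral>\<^sup>+x\<in>Q. ennreal ((S x)\<^sup>2) \<partial>lborel) + ennreal (4 * L / 1))"
    using strip_integral_bound[OF S S0 L(1) L(1), of 1] by (simp add: J_def QL)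
  also have "\<dots> < \<infinity>" using fin by (simp add: Q_def ennreal_mult_less_top)
  finally have J: "J < \<infinity>" .
  define c1 where "c1 = 48 / (L / 2)\<^sup>2 * L powr (1 - \<beta>)"
  define W where "W \<epsilon> y x = 3744 * \<epsilon> powr \<beta> * (\<epsilon> + \<bar>snd x - y\<bar>) powr (- 1 - 2 * \<beta>)" for \<epsilon> y and x :: "real \<times> real"
  define K where "K \<epsilon> y = (\<integral>\<^sup>+x\<in>Q \<inter> {x. fst x < 2 * \<epsilon>}. ennreal (S x) * ennreal (W \<epsilon> y x) \<partial>lborel)" for \<epsilon> y
  have c1: "0 \<le> c1" by (simp add: c1_def)
  have W0: "0 \<le> W \<epsilon> y x" for \<epsilon> y x by (simp add: W_def)
  have QB: "cbox (\<epsilon>, - L) (L, L) \<subseteq> Q" if "0 < \<epsilon>" for \<epsilon>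
    using that by (auto simp: Q_def half_box_def)
  have upper: "ennreal ((2 * \<delta>) powr (- (\<beta> / 2)) / 80) \<le> ennreal (\<theta>\<^sup>2) * (ennreal c1 * J + K \<epsilon> y)"
    if \<delta>: "0 < \<delta>" "2 * \<delta> < L / 8" and \<epsilon>: "0 < \<epsilon>" "2 * \<epsilon> \<le> \<delta>" and y: "0 \<le> y" "y \<le> \<delta>" for \<delta> \<epsilon> y
  proof -
    let ?B = "cbox (\<epsilon>, - L) (L, L)"
    let ?psi = "\<lambda>x. edge_profile \<beta> \<epsilon> (fst x) * pole (L / 2) (\<beta> + 1/2) ((fst x)\<^sup>2 + (snd x - y)\<^sup>2)"
    define m where "m = (2 * \<delta>) powr (- 2 - \<beta> / 2) / 40"
    have low: "m \<le> neumann_datum \<beta> (L / 8) x * ?psi x" if x: "x \<in> box (\<delta>, - \<delta>) (2 * \<delta>, \<delta>)" for x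
    proof -
      obtain r z where rz: "x = (r, z)" by (cases x)
      have r: "\<delta> < r" "r < 2 * \<delta>" "\<bar>z\<bar> < \<delta>" using x by (auto simp: rz mem_box Basis_prod_def inner_prod_def)
      have "m \<le> r powr (- 2 - \<beta> / 2) / 40"
        unfolding m_def using r \<delta> \<beta> by (intro divide_right_mono powr_mono2') auto
      also have "\<dots> = r powr (\<beta> / 2 - 1) * (r powr (- 1 - \<beta>) / 40)"
      proof -
        have "(\<beta> / 2 - 1) + (- 1 - \<beta>) = - 2 - \<beta> / 2" by simp
        then have "r powr (- 2 - \<beta> / 2) = r powr (\<beta> / 2 - 1) * r powr (- 1 - \<beta>)" by (simp only: flip: powr_add)
        then show ?thesis by simp
      qed
      also have "\<dots> \<le> r powr (\<beta> / 2 - 1) * ?psi x"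
        using test_function_lower_bound[OF \<beta>(1,2) \<epsilon>(1), of r "L / 2" z y] r \<epsilon> \<delta> y
        by (intro mult_left_mono) (auto simp: rz)
      also have "r powr (\<beta> / 2 - 1) = neumann_datum \<beta> (L / 8) x" using r \<delta> by (simp add: neumann_datum_def rz)
      finally show ?thesis .
    qed
    have m0: "0 \<le> m" by (simp add: m_def)
    have "ennreal ((2 * \<delta>) powr (- (\<beta> / 2)) / 80) = ennreal m * ennreal (2 * \<delta>\<^sup>2)"
    proof -
      have "(2 * \<delta>) powr (- (\<beta> / 2)) = (2 * \<delta>) powr (- 2 - \<beta> / 2) * (2 * \<delta>) powr 2"
        by (simp flip: powr_add)
      also have "(2 * \<delta>) powr 2 = 4 * \<delta>\<^sup>2" using \<delta> by (simp add: powr_numeral power_mult_distrib)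
      finally have "(2 * \<delta>) powr (- (\<beta> / 2)) / 80 = m * (2 * \<delta>\<^sup>2)" by (simp add: m_def)
      then show ?thesis using m0 by (simp flip: ennreal_mult)
    qed
    also have "ennreal (2 * \<delta>\<^sup>2) = emeasure lborel (box (\<delta>, - \<delta>) (2 * \<delta>, \<delta>))"
    proof -
      have "box (\<delta>, - \<delta>) (2 * \<delta>, \<delta>) = box \<delta> (2 * \<delta>) \<times> box (- \<delta>) \<delta>"
        by (auto simp: mem_box Basis_prod_def inner_prod_def)
      then have "emeasure lborel (box (\<delta>, - \<delta>) (2 * \<delta>, \<delta>)) = emeasure lborel {\<delta><..<2 * \<delta>} * emeasure lborel {- \<delta><..<\<delta>}"
        by (simp add: lborel_prod[symmetric] lborel.emeasure_pair_measure_Times)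
      then show ?thesis using \<delta> by (simp add: power2_eq_square mult_ac flip: ennreal_mult)
    qed
    also have "ennreal m * emeasure lborel (box (\<delta>, - \<delta>) (2 * \<delta>, \<delta>)) = (\<integral>\<^sup>+x\<in>box (\<delta>, - \<delta>) (2 * \<delta>, \<delta>). ennreal m \<partial>lborel)"
      by (simp add: nn_integral_cmult_indicator)
    also have "\<dots> \<le> (\<integral>\<^sup>+x\<in>?B. ennreal (neumann_datum \<beta> (L / 8) x * ?psi x) \<partial>lborel)"
    proof (rule nn_integral_mono)
      fix x :: "real \<times> real"
      have "x \<in> ?B" if "x \<in> box (\<delta>, - \<delta>) (2 * \<delta>, \<delta>)"
        using that \<delta> \<epsilon> by (cases x) (auto simp: mem_box Basis_prod_def inner_prod_def)
      then show "ennreal m * indicator (box (\<delta>, - \<delta>) (2 * \<delta>, \<delta>)) x \<le> ennreal (neumann_datum \<beta> (L / 8) x * ?psi x) * indicator ?B x"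
        using low[of x] by (auto simp: indicator_def ennreal_leI)
    qed
    also have "\<dots> \<le> ennreal (\<theta>\<^sup>2) * (\<integral>\<^sup>+x\<in>?B. ennreal (S x * (fst x * \<bar>residual \<beta> (L / 2) \<epsilon> y x\<bar>)) \<partial>lborel)"
    proof (rule pole_inequality[OF h S _ measurable_neumann_datum neumann_datum_nonneg bound dirichlet neumann L(2) \<epsilon>(1)])
      show "set_integrable lborel ?B S"
        unfolding set_integrable_def
      proof (rule integrableI_bounded)
        show "(\<lambda>x. indicat_real ?B x *\<^sub>R S x) \<in> borel_measurable lborel" by measurable
        have "(\<integral>\<^sup>+x. ennreal (norm (indicat_real ?B x *\<^sub>R S x)) \<partial>lborel) \<le> J"
          unfolding J_def using QB[OF \<epsilon>(1)] S0 by (intro nn_integral_mono) (auto simp: indicator_def)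
        then show "(\<integral>\<^sup>+x. ennreal (norm (indicat_real ?B x *\<^sub>R S x)) \<partial>lborel) < \<infinity>" using J by (rule le_less_trans)
      qed
    qed (use \<epsilon> \<delta> y L in auto)
    also have "(\<integral>\<^sup>+x\<in>?B. ennreal (S x * (fst x * \<bar>residual \<beta> (L / 2) \<epsilon> y x\<bar>)) \<partial>lborel) \<le>
        (\<integral>\<^sup>+x. ennreal c1 * (ennreal (S x) * indicator Q x) + ennreal (S x) * ennreal (W \<epsilon> y x) * indicator (Q \<inter> {x. fst x < 2 * \<epsilon>}) x \<partial>lborel)"
    proof (rule nn_integral_mono)
      fix x :: "real \<times> real"
      obtain r z where rz: "x = (r, z)" by (cases x)
      show "ennreal (S x * (fst x * \<bar>residual \<beta> (L / 2) \<epsilon> y x\<bar>)) * indicator ?B x \<le>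
        ennreal c1 * (ennreal (S x) * indicator Q x) + ennreal (S x) * ennreal (W \<epsilon> y x) * indicator (Q \<inter> {x. fst x < 2 * \<epsilon>}) x"
      proof (cases "x \<in> ?B")
        case True
        then have xQ: "x \<in> Q" using QB[OF \<epsilon>(1)] by blast
        have r: "\<epsilon> \<le> r" "r \<le> L" using True by (auto simp: rz)
        have r0: "0 < r" using r \<epsilon> by simp
        note k = pole_kernel_bounds[OF \<beta>(1,2) \<epsilon>(1) r(1), of z y]
        define T where "T = (r\<^sup>2 + (z - y)\<^sup>2) powr (- (\<beta> + 1/2))"
        have "r * \<bar>residual \<beta> (L / 2) \<epsilon> y x\<bar> \<le>
            r powr (\<beta> + 2) * (48 / (L / 2)\<^sup>2 + (if r < 2 * \<epsilon> then 234 / \<epsilon>\<^sup>2 else 0)) * T"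
          unfolding rz T_def using L by (intro residual_bound \<beta> \<epsilon>(1) r(1)) simp
        also have "\<dots> = 48 / (L / 2)\<^sup>2 * (r powr (\<beta> + 2) * T) + r powr (\<beta> + 2) * (if r < 2 * \<epsilon> then 234 / \<epsilon>\<^sup>2 else 0) * T"
          by (simp add: algebra_simps)
        also have "\<dots> \<le> c1 + (if r < 2 * \<epsilon> then W \<epsilon> y x else 0)"
        proof (rule add_mono)
          have "r powr (\<beta> + 2) * T \<le> r powr (1 - \<beta>)" unfolding T_def by (rule k(1))
          also have "\<dots> \<le> L powr (1 - \<beta>)" using r0 r \<beta> by (intro powr_mono2) auto
          finally show "48 / (L / 2)\<^sup>2 * (r powr (\<beta> + 2) * T) \<le> c1"
            unfolding c1_def by (intro mult_left_mono) auto
          show "r powr (\<beta> + 2) * (if r < 2 * \<epsilon> then 234 / \<epsilon>\<^sup>2 else 0) * T \<le> (if r < 2 * \<epsilon> then W \<epsilon> y x else 0)"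
            using k(2) by (auto simp: W_def T_def rz)
        qed
        finally have "S x * (r * \<bar>residual \<beta> (L / 2) \<epsilon> y x\<bar>) \<le> S x * (c1 + (if r < 2 * \<epsilon> then W \<epsilon> y x else 0))"
          using S0 by (intro mult_left_mono) auto
        then have "ennreal (S x * (fst x * \<bar>residual \<beta> (L / 2) \<epsilon> y x\<bar>)) \<le> ennreal (S x * (c1 + (if r < 2 * \<epsilon> then W \<epsilon> y x else 0)))"
          by (intro ennreal_leI) (simp add: rz)
        also have "\<dots> = ennreal c1 * ennreal (S x) + ennreal (S x) * ennreal (if r < 2 * \<epsilon> then W \<epsilon> y x else 0)"
          using S0[of x] c1 W0[of \<epsilon> y x] by (simp add: distrib_left ennreal_plus ennreal_mult mult.commute)
        finally show ?thesis using True xQ by (cases "r < 2 * \<epsilon>") (simp_all add: rz)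
      qed simp
    qed
    also have "\<dots> = ennreal c1 * J + K \<epsilon> y"
    proof -
      have [measurable]: "W \<epsilon> y \<in> borel_measurable borel"
        unfolding W_def[abs_def] borel_prod[symmetric] by measurable
      have [measurable]: "Q \<inter> {x. fst x < 2 * \<epsilon>} \<in> sets borel" by (intro sets.Int measurable_strip Qm)
      show ?thesis unfolding J_def K_def by (subst nn_integral_add) (auto simp: nn_integral_cmult)
    qed
    finally show ?thesis by (simp add: mult_left_mono)
  qed
  have avg: "(\<integral>\<^sup>+y. K \<epsilon> y \<partial>lborel) \<le> ennreal (3744 / \<beta> * \<epsilon> powr (- \<beta>)) * (\<integral>\<^sup>+x\<in>Q \<inter> {x. fst x < 2 * \<epsilon>}. ennreal (S x) \<partial>lborel)"
    if \<epsilon>: "0 < \<epsilon>" for \<epsilon>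
  proof -
    let ?A = "Q \<inter> {x. fst x < 2 * \<epsilon>}"
    have [measurable]: "?A \<in> sets borel" by (intro sets.Int measurable_strip Qm)
    have Wm: "(\<lambda>p. W \<epsilon> (snd p) (fst p)) \<in> borel_measurable (borel \<Otimes>\<^sub>M borel)"
      unfolding W_def borel_prod[symmetric] by measurable
    have "(\<integral>\<^sup>+y. K \<epsilon> y \<partial>lborel) = (\<integral>\<^sup>+x. (\<integral>\<^sup>+y. ennreal (S x) * ennreal (W \<epsilon> y x) * indicator ?A x \<partial>lborel) \<partial>lborel)"
      unfolding K_def
    proof (rule lborel_pair.Fubini')
      show "(\<lambda>(x, y). ennreal (S x) * ennreal (W \<epsilon> y x) * indicator ?A x) \<in> borel_measurable (lborel \<Otimes>\<^sub>M lborel)"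
        using Wm by (simp add: case_prod_unfold) measurable
    qed
    also have "\<dots> \<le> (\<integral>\<^sup>+x. ennreal (3744 / \<beta> * \<epsilon> powr (- \<beta>)) * (ennreal (S x) * indicator ?A x) \<partial>lborel)"
    proof (rule nn_integral_mono)
      fix x :: "real \<times> real"
      have split: "(\<integral>\<^sup>+y. ennreal (S x) * ennreal (W \<epsilon> y x) * indicator ?A x \<partial>lborel) =
          ennreal (S x) * indicator ?A x * (\<integral>\<^sup>+y. ennreal (3744 * \<epsilon> powr \<beta>) * ennreal ((\<epsilon> + \<bar>snd x - y\<bar>) powr (- 1 - 2 * \<beta>)) \<partial>lborel)"
        by (subst nn_integral_cmult[symmetric]) (auto simp: W_def ennreal_mult mult_ac intro!: nn_integral_cong)
      have "(\<integral>\<^sup>+y. ennreal (3744 * \<epsilon> powr \<beta>) * ennreal ((\<epsilon> + \<bar>snd x - y\<bar>) powr (- 1 - 2 * \<beta>)) \<partial>lborel)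
          = ennreal (3744 * \<epsilon> powr \<beta>) * (\<integral>\<^sup>+y. ennreal ((\<epsilon> + \<bar>snd x - y\<bar>) powr (- 1 - 2 * \<beta>)) \<partial>lborel)"
        by (rule nn_integral_cmult) measurable
      also have "\<dots> \<le> ennreal (3744 * \<epsilon> powr \<beta>) * ennreal (\<epsilon> powr (- 2 * \<beta>) / \<beta>)"
        by (intro mult_left_mono axis_weight_integral \<beta> \<epsilon>) simp
      also have "\<dots> = ennreal (3744 / \<beta> * \<epsilon> powr (- \<beta>))"
      proof -
        have "\<epsilon> powr \<beta> * \<epsilon> powr (- 2 * \<beta>) = \<epsilon> powr (- \<beta>)" by (simp flip: powr_add)
        then have "3744 * \<epsilon> powr \<beta> * (\<epsilon> powr (- 2 * \<beta>) / \<beta>) = 3744 / \<beta> * \<epsilon> powr (- \<beta>)" by simp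
        then show ?thesis using \<beta>(1) by (simp flip: ennreal_mult)
      qed
      finally have "ennreal (S x) * indicator ?A x * (\<integral>\<^sup>+y. ennreal (3744 * \<epsilon> powr \<beta>) * ennreal ((\<epsilon> + \<bar>snd x - y\<bar>) powr (- 1 - 2 * \<beta>)) \<partial>lborel)
          \<le> ennreal (S x) * indicator ?A x * ennreal (3744 / \<beta> * \<epsilon> powr (- \<beta>))"
        by (rule mult_left_mono) simp
      then show "(\<integral>\<^sup>+y. ennreal (S x) * ennreal (W \<epsilon> y x) * indicator ?A x \<partial>lborel) \<le>
          ennreal (3744 / \<beta> * \<epsilon> powr (- \<beta>)) * (ennreal (S x) * indicator ?A x)"
        unfolding split by (simp only: mult.commute)
    qed
    also have "\<dots> = ennreal (3744 / \<beta> * \<epsilon> powr (- \<beta>)) * (\<integral>\<^sup>+x\<in>?A. ennreal (S x) \<partial>lborel)"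
      by (rule nn_integral_cmult) measurable
    finally show ?thesis .
  qed
  have small: "\<exists>\<epsilon>>0. \<epsilon> \<le> \<eta> \<and> (\<integral>\<^sup>+y. K \<epsilon> y \<partial>lborel) \<le> ennreal \<eta>" if \<eta>: "0 < \<eta>" for \<eta>
  proof -
    define C where "C = 3744 / \<beta>"
    have C: "0 < C" using \<beta> by (simp add: C_def)
    (* makes the second summand of the strip bound, multiplied by C, equal to \<eta> / 2 *)
    define \<mu> where "\<mu> = 8 * L * C / \<eta>"
    have \<mu>: "0 < \<mu>" using C L \<eta> by (simp add: \<mu>_def)
    let ?I = "\<lambda>\<epsilon>. \<integral>\<^sup>+x\<in>Q \<inter> {x. fst x < 2 * \<epsilon>}. ennreal ((S x)\<^sup>2) \<partial>lborel"
    have "0 < ennreal (\<eta> / (2 * C * \<mu>))" using \<eta> C \<mu> by simp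
    with strip_square_integral_tendsto[OF S fin]
    have e1: "\<forall>\<^sub>F k in sequentially. ?I (inverse (real (Suc k))) < ennreal (\<eta> / (2 * C * \<mu>))"
      unfolding Q_def by (rule order_tendstoD(2))
    have "0 < min \<eta> 1" using \<eta> by simp
    with LIMSEQ_inverse_real_of_nat have e2: "\<forall>\<^sub>F k in sequentially. inverse (real (Suc k)) < min \<eta> 1"
      by (rule order_tendstoD(2))
    obtain k where k: "?I (inverse (real (Suc k))) < ennreal (\<eta> / (2 * C * \<mu>))" "inverse (real (Suc k)) < min \<eta> 1"
      using eventually_conj[OF e1 e2] eventually_happens'[OF sequentially_bot] by blast
    define \<epsilon> where "\<epsilon> = inverse (real (Suc k))"
    have \<epsilon>: "0 < \<epsilon>" "\<epsilon> \<le> \<eta>" "\<epsilon> \<le> 1" using k(2) by (auto simp: \<epsilon>_def)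
    have "\<epsilon> powr (- \<beta>) * sqrt \<epsilon> = \<epsilon> powr (1/2 - \<beta>)"
      using \<epsilon> by (simp add: powr_half_sqrt[symmetric] flip: powr_add)
    also have "\<dots> \<le> 1" using \<epsilon> \<beta> by (intro powr_le1) auto
    finally have le1: "C * \<epsilon> powr (- \<beta>) * sqrt \<epsilon> \<le> C" using C by (simp add: mult.assoc mult_left_le)
    have "(\<integral>\<^sup>+y. K \<epsilon> y \<partial>lborel) \<le> ennreal (C * \<epsilon> powr (- \<beta>)) * (ennreal (sqrt \<epsilon>) * (ennreal \<mu> * ?I \<epsilon> + ennreal (4 * L / \<mu>)))"
      unfolding C_def
      by (rule order_trans[OF avg[OF \<epsilon>(1)]], rule mult_left_mono,
          rule strip_integral_bound[OF S S0 \<epsilon>(1) L(1) \<mu>, folded Q_def]) simp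
    also have "\<dots> = ennreal (C * \<epsilon> powr (- \<beta>) * sqrt \<epsilon>) * (ennreal \<mu> * ?I \<epsilon> + ennreal (4 * L / \<mu>))"
      using C \<epsilon> by (simp add: ennreal_mult mult.assoc)
    also have "\<dots> \<le> ennreal C * (ennreal \<mu> * ennreal (\<eta> / (2 * C * \<mu>)) + ennreal (4 * L / \<mu>))"
      using k(1) le1 by (intro mult_mono add_mono mult_left_mono ennreal_leI) (auto simp: \<epsilon>_def)
    also have "\<dots> = ennreal (C * (\<mu> * (\<eta> / (2 * C * \<mu>)) + 4 * L / \<mu>))"
      using C \<mu> \<eta> L by (simp flip: ennreal_mult ennreal_plus)
    also have "C * (\<mu> * (\<eta> / (2 * C * \<mu>)) + 4 * L / \<mu>) = \<eta>"
      using C \<eta> L by (simp add: \<mu>_def field_simps)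
    finally show ?thesis using \<epsilon> by blast
  qed
  obtain j where j: "J = ennreal j" "0 \<le> j" using J by (cases J) auto
  define T where "T = \<theta>\<^sup>2 * (c1 * j + 1)"
  have T0: "0 \<le> T" using c1 j by (simp add: T_def)
  define X where "X = 80 * (T + 1)"
  have X: "0 < X" using T0 by (simp add: X_def)
  (* so small that the lower bound of the pairing exceeds the constant T *)
  define \<delta> where "\<delta> = min (L / 16) (X powr (- 2 / \<beta>)) / 2"
  have \<delta>: "0 < \<delta>" "2 * \<delta> < L / 8" "2 * \<delta> \<le> X powr (- 2 / \<beta>)" using L X by (auto simp: \<delta>_def)
  have "X = (X powr (- 2 / \<beta>)) powr (- (\<beta> / 2))"
    using X \<beta>(1) by (simp add: powr_powr)
  also have "\<dots> \<le> (2 * \<delta>) powr (- (\<beta> / 2))" using \<delta> \<beta>(1) by (intro powr_mono2') auto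
  finally have big: "T + 1 \<le> (2 * \<delta>) powr (- (\<beta> / 2)) / 80" by (simp add: X_def)
  have "0 < \<delta> / 2" using \<delta> by simp
  from small[OF this] obtain \<epsilon> where \<epsilon>: "0 < \<epsilon>" "\<epsilon> \<le> \<delta> / 2" "(\<integral>\<^sup>+y. K \<epsilon> y \<partial>lborel) \<le> ennreal (\<delta> / 2)"
    by blast
  have [measurable]: "K \<epsilon> \<in> borel_measurable borel"
  proof -
    have Wm: "(\<lambda>p. W \<epsilon> (fst p) (snd p)) \<in> borel_measurable (borel \<Otimes>\<^sub>M borel)"
      unfolding W_def borel_prod[symmetric] by measurable
    have [measurable]: "Q \<inter> {x. fst x < 2 * \<epsilon>} \<in> sets borel" by (intro sets.Int measurable_strip Qm)
    have "K \<epsilon> \<in> borel_measurable lborel"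
      unfolding K_def
    proof (rule lborel.borel_measurable_nn_integral)
      show "(\<lambda>(y, x). ennreal (S x) * ennreal (W \<epsilon> y x) * indicator (Q \<inter> {x. fst x < 2 * \<epsilon>}) x) \<in> borel_measurable (lborel \<Otimes>\<^sub>M lborel)"
        using Wm by (simp add: case_prod_unfold) measurable
    qed
    then show ?thesis by simp
  qed
  have "ennreal ((T + 1) * \<delta>) = (\<integral>\<^sup>+y\<in>{0..\<delta>}. ennreal (T + 1) \<partial>lborel)"
    using T0 \<delta> by (simp add: nn_integral_cmult_indicator ennreal_mult)
  also have "\<dots> \<le> (\<integral>\<^sup>+y. ennreal (\<theta>\<^sup>2) * (ennreal (c1 * j) * indicator {0..\<delta>} y + K \<epsilon> y) \<partial>lborel)"
  proof (rule nn_integral_mono)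
    fix y :: real
    show "ennreal (T + 1) * indicator {0..\<delta>} y \<le> ennreal (\<theta>\<^sup>2) * (ennreal (c1 * j) * indicator {0..\<delta>} y + K \<epsilon> y)"
    proof (cases "y \<in> {0..\<delta>}")
      case True
      have "ennreal (T + 1) \<le> ennreal ((2 * \<delta>) powr (- (\<beta> / 2)) / 80)" using big by (rule ennreal_leI)
      also have "\<dots> \<le> ennreal (\<theta>\<^sup>2) * (ennreal c1 * J + K \<epsilon> y)"
        using True \<epsilon> by (intro upper \<delta>) auto
      finally show ?thesis using True c1 j by (simp add: ennreal_mult)
    qed simp
  qed
  also have "\<dots> = ennreal (\<theta>\<^sup>2) * (ennreal (c1 * j) * ennreal \<delta> + (\<integral>\<^sup>+y. K \<epsilon> y \<partial>lborel))"
    using \<delta> by (simp add: nn_integral_cmult nn_integral_add nn_integral_cmult_indicator)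
  also have "\<dots> \<le> ennreal (\<theta>\<^sup>2) * (ennreal (c1 * j) * ennreal \<delta> + ennreal (\<delta> / 2))"
    by (intro mult_left_mono add_left_mono \<epsilon>(3)) simp
  also have "\<dots> = ennreal (\<theta>\<^sup>2 * (c1 * j * \<delta> + \<delta> / 2))"
    using c1 j \<delta> by (simp add: ennreal_mult ennreal_plus)
  finally have "(T + 1) * \<delta> \<le> \<theta>\<^sup>2 * (c1 * j * \<delta> + \<delta> / 2)"
    using c1 j \<delta> by (subst (asm) ennreal_le_iff) auto
  also have "\<dots> \<le> T * \<delta>" using \<delta> by (simp add: T_def algebra_simps)
  finally show False using \<delta> by (simp add: algebra_simps)
qed

end

section \<open>Square integrability on the boundary\<close>

text \<open>The maximal function is lower semicontinuous: each \<open>X\<close> is admissible for an open set of \<open>P\<close>.\<close>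
lemma measurable_nontangential_max: "nontangential_max \<alpha> \<Omega> w \<in> borel_measurable borel"
proof (rule borel_measurableI_greater)
  fix c :: ennreal
  let ?U = "\<lambda>X. {P. norm (X - P) < (1 + \<alpha>) * infdist X (frontier \<Omega>)}"
  have "{P \<in> space borel. c < nontangential_max \<alpha> \<Omega> w P} = (\<Union>X\<in>{X \<in> \<Omega>. c < ennreal (norm (w X))}. ?U X)"
    by (auto simp: nontangential_max_def less_SUP_iff approach_region_def)
  moreover have "open (?U X)" for X by (intro open_Collect_less continuous_intros)
  ultimately show "{P \<in> space borel. c < nontangential_max \<alpha> \<Omega> w P} \<in> sets borel"
    by (simp add: open_UN)
qed

lemma square_sum_ennreal: "(a + b :: ennreal)\<^sup>2 \<le> 4 * a\<^sup>2 + 4 * b\<^sup>2"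
proof -
  have 1: "(a + b)\<^sup>2 \<le> 4 * b\<^sup>2" if "a \<le> b" for a b :: ennreal
  proof -
    have "a + b \<le> 2 * b" using that by (simp add: mult_2 add_right_mono)
    then have "(a + b)\<^sup>2 \<le> (2 * b)\<^sup>2" by (rule power_mono) simp
    then show ?thesis by (simp add: power_mult_distrib)
  qed
  show ?thesis
  proof (cases "a \<le> b")
    case True
    then show ?thesis using order_trans[OF 1[OF True]] by (simp add: add_increasing)
  next
    case False
    then have "b \<le> a" by simp
    from order_trans[OF 1[OF this]] show ?thesis by (simp add: add_increasing2 add.commute)
  qed
qed

lemma square_integrable_sum:
  fixes f :: "'i \<Rightarrow> 'a \<Rightarrow> ennreal"
  assumes "finite I" "\<And>i. i \<in> I \<Longrightarrow> f i \<in> borel_measurable M" "A \<in> sets M"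
    and "\<And>i. i \<in> I \<Longrightarrow> (\<integral>\<^sup>+x\<in>A. (f i x)\<^sup>2 \<partial>M) < \<infinity>"
  shows "(\<integral>\<^sup>+x\<in>A. (\<Sum>i\<in>I. f i x)\<^sup>2 \<partial>M) < \<infinity>"
  using assms(1,2,4)
proof (induction I)
  case (insert i I)
  note [measurable] = assms(3) insert.prems(1)
  have "(\<integral>\<^sup>+x\<in>A. (\<Sum>i\<in>insert i I. f i x)\<^sup>2 \<partial>M) \<le>
      (\<integral>\<^sup>+x. 4 * ((f i x)\<^sup>2 * indicator A x) + 4 * ((\<Sum>i\<in>I. f i x)\<^sup>2 * indicator A x) \<partial>M)"
    using insert(1,2) by (intro nn_integral_mono) (auto simp: indicator_def square_sum_ennreal)
  also have "\<dots> = 4 * (\<integral>\<^sup>+x\<in>A. (f i x)\<^sup>2 \<partial>M) + 4 * (\<integral>\<^sup>+x\<in>A. (\<Sum>i\<in>I. f i x)\<^sup>2 \<partial>M)"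
    by (simp add: nn_integral_add nn_integral_cmult)
  also have "\<dots> < \<infinity>" using insert by (simp add: ennreal_mult_less_top)
  finally show ?case .
qed simp

lemma nn_integral_scale_fst:
  fixes f :: "real \<times> real \<Rightarrow> ennreal"
  assumes f[measurable]: "f \<in> borel_measurable borel" and l: "0 < l"
  shows "(\<integral>\<^sup>+x. f (l * fst x, snd x) \<partial>lborel) = ennreal (1 / l) * (\<integral>\<^sup>+x. f x \<partial>lborel)"
proof -
  have fm: "f \<in> borel_measurable (lborel \<Otimes>\<^sub>M lborel)" using f by (simp add: lborel_prod)
  have fl: "(\<lambda>x. f (l * fst x, snd x)) \<in> borel_measurable (lborel \<Otimes>\<^sub>M lborel)"
  proof -
    have "(\<lambda>x :: real \<times> real. (l * fst x, snd x)) \<in> borel_measurable borel"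
      by (intro borel_measurable_continuous_onI continuous_intros)
    from measurable_compose[OF this f] show ?thesis unfolding lborel_prod by simp
  qed
  have inner: "(\<integral>\<^sup>+r. f (l * r, z) \<partial>lborel) = ennreal (1 / l) * (\<integral>\<^sup>+r. f (r, z) \<partial>lborel)" for z
  proof -
    have [measurable]: "(\<lambda>r. f (r, z)) \<in> borel_measurable borel" by measurable
    have "(\<integral>\<^sup>+r. f (r, z) \<partial>lborel) = ennreal l * (\<integral>\<^sup>+r. f (l * r, z) \<partial>lborel)"
      using nn_integral_real_affine[of "\<lambda>r. f (r, z)" l 0] l by simp
    then have "ennreal (1 / l) * (\<integral>\<^sup>+r. f (r, z) \<partial>lborel) = (ennreal (1 / l) * ennreal l) * (\<integral>\<^sup>+r. f (l * r, z) \<partial>lborel)"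
      by (simp add: mult.assoc)
    also have "ennreal (1 / l) * ennreal l = 1" using l by (simp flip: ennreal_mult)
    finally show ?thesis by simp
  qed
  have "(\<integral>\<^sup>+x. f (l * fst x, snd x) \<partial>lborel) = (\<integral>\<^sup>+z. \<integral>\<^sup>+r. f (l * r, z) \<partial>lborel \<partial>lborel)"
    using lborel_pair.nn_integral_snd[OF fl] by (simp add: lborel_prod)
  also have "\<dots> = ennreal (1 / l) * (\<integral>\<^sup>+z. \<integral>\<^sup>+r. f (r, z) \<partial>lborel \<partial>lborel)"
    unfolding inner
    by (intro nn_integral_cmult lborel.borel_measurable_nn_integral measurable_pair_swap[OF fm])
  also have "(\<integral>\<^sup>+z. \<integral>\<^sup>+r. f (r, z) \<partial>lborel \<partial>lborel) = (\<integral>\<^sup>+x. f x \<partial>lborel)"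
    using lborel_pair.nn_integral_snd[OF fm] by (simp add: lborel_prod)
  finally show ?thesis .
qed

lemma neumann_datum_square_integrable:
  assumes "0 < \<beta>" "0 < \<rho>"
  shows "(\<integral>\<^sup>+x. ennreal ((neumann_datum \<beta> \<rho> x)\<^sup>2) \<partial>lborel) < \<infinity>"
proof -
  have m: "(\<lambda>x. ennreal ((neumann_datum \<beta> \<rho> x)\<^sup>2)) \<in> borel_measurable (lborel \<Otimes>\<^sub>M lborel)"
    unfolding lborel_prod by measurable
  have "(\<integral>\<^sup>+x. ennreal ((neumann_datum \<beta> \<rho> x)\<^sup>2) \<partial>lborel) = (\<integral>\<^sup>+r. \<integral>\<^sup>+z. ennreal ((neumann_datum \<beta> \<rho> (r, z))\<^sup>2) \<partial>lborel \<partial>lborel)"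
    using lborel.nn_integral_fst[OF m] by (simp add: lborel_prod)
  also have "\<dots> \<le> (\<integral>\<^sup>+r. ennreal (2 * r powr (\<beta> - 1)) * indicator {0..\<rho>} r \<partial>lborel)"
  proof (rule nn_integral_mono)
    fix r :: real
    show "(\<integral>\<^sup>+z. ennreal ((neumann_datum \<beta> \<rho> (r, z))\<^sup>2) \<partial>lborel) \<le> ennreal (2 * r powr (\<beta> - 1)) * indicator {0..\<rho>} r"
    proof (cases "0 < r \<and> r < \<rho>")
      case True
      then have r: "0 < r" "r < \<rho>" by auto
      have "(\<integral>\<^sup>+z. ennreal ((neumann_datum \<beta> \<rho> (r, z))\<^sup>2) \<partial>lborel) = (\<integral>\<^sup>+z. ennreal ((r powr (\<beta> / 2 - 1))\<^sup>2) * indicator {- r<..<r} z \<partial>lborel)"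
        using r by (intro nn_integral_cong) (auto simp: neumann_datum_def indicator_def)
      also have "\<dots> = ennreal ((r powr (\<beta> / 2 - 1))\<^sup>2 * (2 * r))"
        using r by (simp add: nn_integral_cmult_indicator flip: ennreal_mult)
      also have "(r powr (\<beta> / 2 - 1))\<^sup>2 * (2 * r) = 2 * r powr (\<beta> - 1)"
      proof -
        have "(r powr (\<beta> / 2 - 1))\<^sup>2 = r powr (\<beta> - 2)"
          by (simp add: power2_eq_square flip: powr_add)
        moreover have "r * r powr (\<beta> - 2) = r powr (\<beta> - 1)"
          using powr_mult_base[of r "\<beta> - 2"] r by simp
        ultimately show ?thesis by (simp add: mult_ac)
      qed
      finally show ?thesis using r by simp
    next
      case False
      then have "neumann_datum \<beta> \<rho> (r, z) = 0" for z by (auto simp: neumann_datum_def)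
      then show ?thesis by simp
    qed
  qed
  also have "\<dots> = ennreal (2 * (\<rho> powr \<beta> / \<beta>))"
  proof (rule nn_integral_has_integral_lebesgue')
    have "((\<lambda>x. x powr (\<beta> - 1)) has_integral \<rho> powr (\<beta> - 1 + 1) / (\<beta> - 1 + 1)) {0..\<rho>}"
      using assms by (intro has_integral_powr_from_0) auto
    from has_integral_mult_right[OF this, of 2]
    show "((\<lambda>x. 2 * x powr (\<beta> - 1)) has_integral 2 * (\<rho> powr \<beta> / \<beta>)) {0..\<rho>}" by simp
  qed auto
  also have "\<dots> < \<infinity>" by simp
  finally show ?thesis .
qed

lemma W12_boundary_zero: "W12_boundary \<Omega> \<F> (\<lambda>_. 0)"
proof -
  have g: "grad (\<lambda>_. 0) = (\<lambda>_. 0)" by (simp add: grad_def fun_eq_iff vec_eq_iff)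
  have t: "tangential_grad \<Omega> (\<lambda>_. 0) = (\<lambda>_. 0)" by (simp add: tangential_grad_def g fun_eq_iff)
  have z: "L2_on (surface_measure \<F>) A (\<lambda>_. 0 :: 'b::euclidean_space)" for A
    by (simp add: L2_on_def set_borel_measurable_def set_integrable_def)
  show ?thesis
    unfolding W12_boundary_def
    by (intro conjI z exI[of _ "\<lambda>_. 0"] exI[of _ "\<lambda>_ _. 0"]) (simp_all add: g t)
qed

section \<open>The outer normal on a face\<close>

lemma closed_compact_polyhedron: "compact_polyhedron K \<Longrightarrow> closed K"
  unfolding compact_polyhedron_def by (metis closed_Union polytope_imp_closed)

lemma outer_normal_eqI:
  assumes n: "norm n = 1" and e: "0 < e" "\<Omega> \<inter> ball P e = {X \<in> ball P e. (X - P) \<bullet> n < 0}"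
  shows "outer_normal \<Omega> P = n"
  unfolding outer_normal_def
proof (rule the_equality)
  show "norm n = 1 \<and> (\<exists>\<epsilon>>0. \<Omega> \<inter> ball P \<epsilon> = {X \<in> ball P \<epsilon>. (X - P) \<bullet> n < 0})" using n e by blast
next
  fix m assume m: "norm m = 1 \<and> (\<exists>\<epsilon>>0. \<Omega> \<inter> ball P \<epsilon> = {X \<in> ball P \<epsilon>. (X - P) \<bullet> m < 0})"
  then obtain d where d: "0 < d" "\<Omega> \<inter> ball P d = {X \<in> ball P d. (X - P) \<bullet> m < 0}" by blast
  show "m = n"
  proof (rule ccontr)
    assume "m \<noteq> n"
    then have k: "0 < norm (m - n)" by simp
    define c where "c = min d e / (2 * norm (m - n))"
    have c: "0 < c" using d e k by (simp add: c_def)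
    define X where "X = P + c *\<^sub>R (m - n)"
    have "dist P X = min d e / 2" using c k d e by (simp add: X_def dist_norm c_def)
    then have X: "X \<in> ball P d" "X \<in> ball P e" using d e by auto
    have "m \<bullet> m = 1" "n \<bullet> n = 1" using m n by (simp_all add: dot_square_norm)
    moreover have "0 < (m - n) \<bullet> (m - n)" using k by simp
    ultimately have mn: "m \<bullet> n < 1" by (simp add: inner_diff_left inner_diff_right inner_commute)
    have "(X - P) \<bullet> n = c * (m \<bullet> n - 1)" using \<open>n \<bullet> n = 1\<close> by (simp add: X_def inner_diff_left)
    then have "(X - P) \<bullet> n < 0" using c mn by (simp add: mult_pos_neg)
    then have "X \<in> \<Omega>" using X e by blast
    then have "(X - P) \<bullet> m < 0" using X d by blast
    moreover have "(X - P) \<bullet> m = c * (1 - m \<bullet> n)"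
      using \<open>m \<bullet> m = 1\<close> by (simp add: X_def inner_diff_left inner_diff_right inner_commute)
    ultimately show False using c mn by (simp add: mult_less_0_iff)
  qed
qed

context polyhedral_wedge begin

text \<open>Only the side of \<open>F\<close> inside the wedge is known to belong to the domain. The other side of a small
  disc of \<open>F\<close> does not meet the boundary, so it lies either inside or outside the domain; in the first
  case a full ball would lie in the closed polyhedron \<open>K\<close>, and the face would be interior.\<close>
lemma outer_normal_face:
  assumes faces: "boundary_faces \<Omega> \<F>" and F: "F \<in> \<F>" and K: "closed K" "\<Omega> = interior K"
    and Fl: "F \<inter> ball p \<rho> = {cyl 0 y | y. 0 \<le> fst y} \<inter> ball p \<rho>"
    and P: "cyl 0 x \<in> rel_interior F" and x: "0 < fst x" "norm x < \<rho>"
  shows "outer_normal \<Omega> (cyl 0 x) = - b"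
proof -
  define P where "P = cyl 0 x"
  have er0: "radial 0 = a" "radial (pi / 2) = b" "angular 0 = b" by (simp_all add: radial_def angular_def)
  have Pb: "(P - p) \<bullet> b = 0" by (simp add: P_def cyl_def er0 inner_add_left)
  have side: "(X - P) \<bullet> b = (X - p) \<bullet> b" for X using Pb by (simp add: inner_diff_left)
  have Pn: "norm (P - p) = norm x" by (simp add: P_def norm_cyl)
  have Fin: "finite \<F>" using faces by (simp add: boundary_faces_def)
  have Fcl: "closed H" if "H \<in> \<F>" for H
    using faces that by (intro closed_compact_polyhedron) (auto simp: boundary_faces_def closed_face_def)
  have "closed (\<Union>(\<F> - {F}))" using Fin Fcl by (intro closed_Union) auto
  moreover have "P \<notin> \<Union>(\<F> - {F})" using faces F P unfolding boundary_faces_def P_def by blast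
  ultimately obtain d where d: "0 < d" "ball P d \<subseteq> - \<Union>(\<F> - {F})"
    using open_contains_ball[of "- \<Union>(\<F> - {F})"] by (metis ComplI open_Compl)
  define e where "e = min d (min (fst x) (\<rho> - norm x))"
  have e: "0 < e" "e \<le> d" "e \<le> fst x" "e \<le> \<rho> - norm x" using d x by (auto simp: e_def)
  have inball: "X \<in> ball p \<rho>" if "X \<in> ball P e" for X
    using that e Pn dist_triangle[of p X P] by (simp add: dist_norm norm_minus_commute)
  have front: "X \<in> F" if "X \<in> frontier \<Omega>" "X \<in> ball P e" for X
  proof -
    have "X \<in> ball P d" using that(2) e by simp
    then have "X \<notin> \<Union>(\<F> - {F})" using d by blast
    moreover have "X \<in> \<Union>\<F>" using that(1) faces by (simp add: boundary_faces_def)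
    ultimately show ?thesis by blast
  qed
  have plane: "(X - p) \<bullet> b = 0 \<longleftrightarrow> X \<in> frontier \<Omega>" if X: "X \<in> ball P e" for X
  proof
    assume "X \<in> frontier \<Omega>"
    then obtain y where "X = cyl 0 y" using front X inball Fl by blast
    then show "(X - p) \<bullet> b = 0" by (simp add: cyl_def er0 inner_add_left)
  next
    assume z: "(X - p) \<bullet> b = 0"
    have "X - p = ((X - p) \<bullet> t) *\<^sub>R t + ((X - p) \<bullet> a) *\<^sub>R a"
      using frame_expansion[of "X - p" 0] z by (simp add: er0)
    then have "X = cyl 0 ((X - p) \<bullet> a, (X - p) \<bullet> t)" by (simp add: cyl_def er0 algebra_simps)
    moreover have "0 \<le> (X - p) \<bullet> a"
    proof -
      have "(P - p) \<bullet> a = fst x" by (simp add: P_def cyl_def er0 inner_add_left)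
      moreover have "(P - X) \<bullet> a \<le> norm (P - X) * norm a" by (rule norm_cauchy_schwarz)
      ultimately show ?thesis using X e frame(2) by (simp add: dist_norm inner_diff_left)
    qed
    ultimately have "X \<in> F" using Fl inball[OF X] by force
    then show "X \<in> frontier \<Omega>" using faces F by (auto simp: boundary_faces_def)
  qed
  have upper: "X \<in> \<Omega>" if X: "X \<in> ball P e" "0 < (X - p) \<bullet> b" for X
  proof -
    obtain r \<phi> z where Y: "0 < r" "pi / 2 - pi / 2 < \<phi>" "\<phi> < pi / 2 + pi / 2" "X = cyl \<phi> (r, z)"
      using half_space_polar[of X "pi / 2"] X(2) by (metis er0(2))
    have "norm (r, z) < \<rho>" using inball[OF X(1)] norm_cyl[of \<phi> "(r, z)"] Y(4) by (simp add: dist_norm norm_minus_commute)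
    then show ?thesis unfolding Y(4) using Y \<theta> by (intro wedge) auto
  qed
  let ?L = "{X \<in> ball P e. (X - p) \<bullet> b < 0}"
  have disj: "?L \<inter> \<Omega> = {}"
  proof (rule ccontr)
    assume ne: "?L \<inter> \<Omega> \<noteq> {}"
    have "(X - p) \<bullet> b = b \<bullet> X - b \<bullet> p" for X
      by (simp add: inner_diff_left inner_commute[of b])
    then have "?L = ball P e \<inter> {X. b \<bullet> X < b \<bullet> p}" by auto
    then have "convex ?L" by (simp add: convex_Int convex_halfspace_lt)
    then have "connected ?L" by (rule convex_connected)
    moreover have "?L \<inter> frontier \<Omega> = {}" using plane by fastforce
    ultimately have L: "?L \<subseteq> \<Omega>" using ne connected_Int_frontier[of ?L \<Omega>] by blast
    have "ball P e \<subseteq> K"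
    proof
      fix X assume X: "X \<in> ball P e"
      consider "(X - p) \<bullet> b < 0" | "(X - p) \<bullet> b > 0" | "(X - p) \<bullet> b = 0" by linarith
      then show "X \<in> K"
      proof cases
        case 1 then show ?thesis using L X K interior_subset by blast
      next
        case 2 then show ?thesis using upper[OF X] K interior_subset by blast
      next
        case 3
        then have "X \<in> frontier \<Omega>" using plane[OF X] by simp
        then have "X \<in> closure \<Omega>" by (simp add: frontier_def)
        also have "closure \<Omega> \<subseteq> K" using K by (metis closure_minimal interior_subset)
        finally show ?thesis .
      qed
    qed
    then have "P \<in> \<Omega>" using K e by (metis centre_in_ball interior_maximal open_ball subsetD)
    moreover have "P \<in> frontier \<Omega>" using plane[of P] Pb e by simp
    ultimately show False using \<Omega>(1) by (simp add: frontier_def interior_open)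
  qed
  have "\<Omega> \<inter> ball P e = {X \<in> ball P e. (X - P) \<bullet> - b < 0}"
  proof safe
    fix X assume X: "X \<in> \<Omega>" "X \<in> ball P e"
    have "X \<notin> frontier \<Omega>" using X \<Omega>(1) by (simp add: frontier_def interior_open)
    then have "(X - p) \<bullet> b \<noteq> 0" using plane[OF X(2)] by simp
    moreover have "\<not> (X - p) \<bullet> b < 0" using disj X by blast
    ultimately show "(X - P) \<bullet> - b < 0" by (simp add: side)
  next
    fix X assume "X \<in> ball P e" "(X - P) \<bullet> - b < 0"
    then show "X \<in> \<Omega>" using upper by (simp add: side)
  qed
  then show ?thesis unfolding P_def[symmetric] using e frame by (intro outer_normal_eqI) auto
qed

end

section \<open>Transfer to the polyhedral domain\<close>

context polyhedral_wedge begin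

lemma gradient_in_approach:
  assumes \<phi>: "0 < \<phi>" "\<phi> < \<theta>" and x: "x \<in> region"
    and \<omega>: "\<omega> = 0 \<and> \<delta> = \<phi> \<or> \<omega> = \<theta> \<and> \<delta> = \<theta> - \<phi>" and \<delta>: "\<delta> \<le> \<theta> - pi / 2"
    and s: "sqrt ((cos \<delta> - l)\<^sup>2 + (sin \<delta>)\<^sup>2) < (1 + \<alpha>) * (if \<delta> \<le> pi / 2 then sin \<delta> else 1)"
  shows "ennreal (norm (w (cyl \<phi> x))) \<le> nontangential_max \<alpha> \<Omega> w (cyl \<omega> (l * fst x, snd x))"
proof -
  have "cyl \<phi> (fst x, snd x) \<in> approach_region \<alpha> \<Omega> (cyl \<omega> (l * fst x, snd x))"
    using x by (intro approach_regionI[OF \<phi> _ _ \<omega> \<delta> s]) (auto simp: region_def)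
  then show ?thesis unfolding nontangential_max_def by (intro SUP_upper) simp
qed

text \<open>As \<open>\<theta> \<ge> \<pi>\<close>, every angle is at distance at most \<open>\<theta> - \<pi>/2\<close> from one of the two faces along the arc, and
  \<open>approach_slopes\<close> applies there.\<close>
lemma gradient_majorant:
  obtains n :: nat where "0 < n"
    "\<And>w x \<phi>. x \<in> region \<Longrightarrow> 0 < \<phi> \<Longrightarrow> \<phi> < \<theta> \<Longrightarrow> ennreal (norm (w (cyl \<phi> x))) \<le>
       (\<Sum>(\<omega>, j)\<in>{0, \<theta>} \<times> {1..n}. nontangential_max \<alpha> \<Omega> w (cyl \<omega> (real j / n * fst x, snd x)))"
proof -
  obtain n :: nat and \<delta>\<^sub>0 where n: "n > 0" and
    *: "\<And>\<delta>. 0 < \<delta> \<Longrightarrow> \<delta> < 2 * pi - pi/2 \<Longrightarrow> \<exists>j\<in>{1..n}. sqrt ((cos \<delta> - real j / n)\<^sup>2 + (sin \<delta>)\<^sup>2)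
        < (1 + \<alpha>) * (if \<delta> \<le> pi / 2 then sin \<delta> else 1)"
    by (rule approach_slopes[OF \<alpha>]) blast
  show ?thesis
  proof (rule that[OF n])
    fix w :: "real^3 \<Rightarrow> real^3" and x \<phi> assume x: "x \<in> region" and \<phi>: "0 < \<phi>" "\<phi> < \<theta>"
    define \<omega> \<delta> where "\<omega> = (if \<phi> \<le> \<theta> - pi / 2 then 0 else \<theta>)" "\<delta> = (if \<phi> \<le> \<theta> - pi / 2 then \<phi> else \<theta> - \<phi>)"
    have c: "\<omega> = 0 \<and> \<delta> = \<phi> \<or> \<omega> = \<theta> \<and> \<delta> = \<theta> - \<phi>" by (auto simp: \<omega>_\<delta>_def)
    have \<delta>: "0 < \<delta>" "\<delta> \<le> \<theta> - pi / 2" using \<phi> \<theta> by (auto simp: \<omega>_\<delta>_def)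
    then obtain j where j: "j \<in> {1..n}" "sqrt ((cos \<delta> - real j / n)\<^sup>2 + (sin \<delta>)\<^sup>2)
        < (1 + \<alpha>) * (if \<delta> \<le> pi / 2 then sin \<delta> else 1)"
      using *[of \<delta>] \<theta> by auto
    have "ennreal (norm (w (cyl \<phi> x))) \<le> nontangential_max \<alpha> \<Omega> w (cyl \<omega> (real j / n * fst x, snd x))"
      by (rule gradient_in_approach[OF \<phi> x c \<delta>(2) j(2)])
    also have "\<dots> = (\<lambda>(\<omega>, j). nontangential_max \<alpha> \<Omega> w (cyl \<omega> (real j / n * fst x, snd x))) (\<omega>, j)" by simp
    also have "\<dots> \<le> (\<Sum>(\<omega>, j)\<in>{0, \<theta>} \<times> {1..n}. nontangential_max \<alpha> \<Omega> w (cyl \<omega> (real j / n * fst x, snd x)))"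
      using j by (intro member_le_sum) (auto simp: \<omega>_\<delta>_def)
    finally show "ennreal (norm (w (cyl \<phi> x))) \<le>
       (\<Sum>(\<omega>, j)\<in>{0, \<theta>} \<times> {1..n}. nontangential_max \<alpha> \<Omega> w (cyl \<omega> (real j / n * fst x, snd x)))" .
  qed
qed

lemma ray_to_boundary:
  assumes x: "x \<in> region" and front: "cyl \<omega> x \<in> frontier \<Omega>"
    and \<omega>: "\<omega> = 0 \<and> F = at_right 0 \<or> \<omega> = \<theta> \<and> F = at_left \<theta>"
  shows "filterlim (\<lambda>\<phi>. cyl \<phi> x) (at (cyl \<omega> x) within approach_region \<alpha> \<Omega> (cyl \<omega> x)) F"
  unfolding filterlim_at
proof
  obtain \<delta>\<^sub>0 where d0: "\<delta>\<^sub>0 > 0" "\<delta>\<^sub>0 \<le> pi / 2"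
    "\<And>\<delta>. 0 < \<delta> \<Longrightarrow> \<delta> \<le> \<delta>\<^sub>0 \<Longrightarrow> sqrt ((cos \<delta> - 1)\<^sup>2 + (sin \<delta>)\<^sup>2) < (1 + \<alpha>) * sin \<delta>"
    by (rule approach_slopes[OF \<alpha>]) blast
  have \<theta>2: "\<delta>\<^sub>0 \<le> \<theta> - pi / 2" using d0 \<theta> by linarith
  have in_approach: "cyl \<phi> x \<in> approach_region \<alpha> \<Omega> (cyl \<omega> x) \<and> cyl \<phi> x \<noteq> cyl \<omega> x"
    if "0 < \<phi>" "\<phi> < \<theta>" "\<omega> = 0 \<and> \<delta> = \<phi> \<or> \<omega> = \<theta> \<and> \<delta> = \<theta> - \<phi>" "\<delta> \<le> \<delta>\<^sub>0" for \<phi> \<delta>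
  proof
    have \<delta>: "0 < \<delta>" "\<delta> \<le> pi / 2" "\<delta> \<le> \<theta> - pi / 2" using that d0 \<theta>2 by auto
    have "sqrt ((cos \<delta> - 1)\<^sup>2 + (sin \<delta>)\<^sup>2) < (1 + \<alpha>) * (if \<delta> \<le> pi / 2 then sin \<delta> else 1)"
      using d0(3)[OF \<delta>(1) that(4)] \<delta> by simp
    from approach_regionI[OF that(1,2) _ _ that(3) \<delta>(3) this, of "fst x" "snd x"]
    show A: "cyl \<phi> x \<in> approach_region \<alpha> \<Omega> (cyl \<omega> x)" using x by (simp add: region_def)
    show "cyl \<phi> x \<noteq> cyl \<omega> x"
      using A front \<Omega>(1) by (auto simp: approach_region_def frontier_def interior_open)
  qed
  have \<theta>0: "0 < \<theta>" using \<theta> pi_gt_zero by linarith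
  show "\<forall>\<^sub>F \<phi> in F. cyl \<phi> x \<in> approach_region \<alpha> \<Omega> (cyl \<omega> x) \<and> cyl \<phi> x \<noteq> cyl \<omega> x"
    using \<omega>
  proof
    assume w: "\<omega> = 0 \<and> F = at_right 0"
    have "\<forall>\<^sub>F \<phi> in at_right 0. \<phi> \<in> {0<..<min \<delta>\<^sub>0 \<theta>}" using d0 \<theta>0 by (intro eventually_at_right_real) auto
    moreover have "cyl \<phi> x \<in> approach_region \<alpha> \<Omega> (cyl \<omega> x) \<and> cyl \<phi> x \<noteq> cyl \<omega> x"
      if "\<phi> \<in> {0<..<min \<delta>\<^sub>0 \<theta>}" for \<phi>
      using that w by (intro in_approach[of \<phi> \<phi>]) auto
    ultimately show ?thesis using w by (auto elim!: eventually_mono)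
  next
    assume w: "\<omega> = \<theta> \<and> F = at_left \<theta>"
    have "\<forall>\<^sub>F \<phi> in at_left \<theta>. \<phi> \<in> {max 0 (\<theta> - \<delta>\<^sub>0)<..<\<theta>}" using d0 \<theta>0 by (intro eventually_at_left_real) auto
    moreover have "cyl \<phi> x \<in> approach_region \<alpha> \<Omega> (cyl \<omega> x) \<and> cyl \<phi> x \<noteq> cyl \<omega> x"
      if "\<phi> \<in> {max 0 (\<theta> - \<delta>\<^sub>0)<..<\<theta>}" for \<phi>
      using that w by (intro in_approach[of \<phi> "\<theta> - \<phi>"]) auto
    ultimately show ?thesis using w by (auto elim!: eventually_mono)
  qed
  have "isCont (\<lambda>\<phi>. cyl \<phi> x) \<omega>"
    using cyl_vector_derivatives(3)[of x \<omega>] has_vector_derivative_continuous by blast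
  then have "((\<lambda>\<phi>. cyl \<phi> x) \<longlongrightarrow> cyl \<omega> x) (at \<omega>)" by (simp add: isCont_def)
  then show "((\<lambda>\<phi>. cyl \<phi> x) \<longlongrightarrow> cyl \<omega> x) F" using \<omega> by (auto intro: tendsto_within_subset filterlim_at_split[THEN iffD1, THEN conjunct1] simp: filterlim_at_split)
qed

lemma
  assumes faces: "boundary_faces \<Omega> \<F>" and H: "H \<in> \<F>" "affine hull H = range (cyl \<omega>)"
    and Hin: "\<And>x. 0 \<le> fst x \<Longrightarrow> norm x < \<rho> \<Longrightarrow> cyl \<omega> x \<in> H"
  shows face_integral_le: "f \<in> borel_measurable borel \<Longrightarrow>
      (\<integral>\<^sup>+x\<in>region. f (cyl \<omega> x) \<partial>lborel) \<le> (\<integral>\<^sup>+P\<in>frontier \<Omega>. f P \<partial>surface_measure \<F>)"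
    and face_AE: "AE P in surface_measure \<F>. Pr P \<Longrightarrow> AE x in lborel. x \<in> region \<longrightarrow> Pr (cyl \<omega> x)"
proof -
  have fin: "finite \<F>" and cl: "\<And>F. F \<in> \<F> \<Longrightarrow> closed F" and ad: "\<And>F. F \<in> \<F> \<Longrightarrow> aff_dim F = 2"
    using faces closed_compact_polyhedron by (auto simp: boundary_faces_def closed_face_def)
  note surf = nn_integral_surface_measure[OF fin cl ad]
  have reg: "cyl \<omega> x \<in> H" if "x \<in> region" for x
    using that \<rho> by (intro Hin) (auto simp: region_def)
  have Hf: "H \<subseteq> frontier \<Omega>" using faces H by (auto simp: boundary_faces_def)
  have le: "(\<integral>\<^sup>+x\<in>region. f (cyl \<omega> x) \<partial>lborel) \<le> (\<integral>\<^sup>+P\<in>frontier \<Omega>. f P \<partial>surface_measure \<F>)"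
    if f[measurable]: "f \<in> borel_measurable borel" for f
  proof -
    let ?f = "\<lambda>P. f P * indicator (frontier \<Omega>) P"
    have [measurable]: "?f \<in> borel_measurable borel" by measurable
    have "(\<integral>\<^sup>+x\<in>region. f (cyl \<omega> x) \<partial>lborel) \<le> (\<integral>\<^sup>+x. ?f (cyl \<omega> x) * indicator H (cyl \<omega> x) \<partial>lborel)"
      using reg Hf by (intro nn_integral_mono) (auto simp: indicator_def)
    also have "\<dots> = (\<integral>\<^sup>+y. ?f (plane_chart H y) * indicator H (plane_chart H y) \<partial>lborel)"
      by (rule nn_integral_face[symmetric, OF ad[OF H(1)] cl[OF H(1)] H(2)]) measurable
    also have "\<dots> \<le> (\<Sum>F\<in>\<F>. \<integral>\<^sup>+y. ?f (plane_chart F y) * indicator F (plane_chart F y) \<partial>lborel)"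
      using H fin by (intro member_le_sum[of H \<F>]) auto
    also have "\<dots> = (\<integral>\<^sup>+P. ?f P \<partial>surface_measure \<F>)" by (rule surf[symmetric]) auto
    finally show ?thesis .
  qed
  show "f \<in> borel_measurable borel \<Longrightarrow>
      (\<integral>\<^sup>+x\<in>region. f (cyl \<omega> x) \<partial>lborel) \<le> (\<integral>\<^sup>+P\<in>frontier \<Omega>. f P \<partial>surface_measure \<F>)" by (rule le)
  assume "AE P in surface_measure \<F>. Pr P"
  then obtain Z where Z: "{P \<in> space (surface_measure \<F>). \<not> Pr P} \<subseteq> Z" "emeasure (surface_measure \<F>) Z = 0" "Z \<in> sets (surface_measure \<F>)"
    by (rule AE_E)
  have Zb[measurable]: "Z \<in> sets borel" using Z(3) sets_surface_measure[OF fin cl ad] by simp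
  have Zn: "\<not> Pr P \<Longrightarrow> P \<in> Z" for P using Z(1) space_surface_measure[OF fin cl ad] by auto
  have [measurable]: "region \<in> sets borel"
  proof -
    have "region = {x. 0 < fst x} \<inter> {x. norm x < \<rho> / 2}" by (auto simp: region_def)
    moreover have "open \<dots>" by (intro open_Int open_Collect_less continuous_intros)
    ultimately show ?thesis by simp
  qed
  have "(\<integral>\<^sup>+x\<in>region. indicator Z (cyl \<omega> x) \<partial>lborel) \<le> (\<integral>\<^sup>+P\<in>frontier \<Omega>. indicator Z P \<partial>surface_measure \<F>)"
    by (rule le) measurable
  also have "\<dots> \<le> (\<integral>\<^sup>+P. indicator Z P \<partial>surface_measure \<F>)" by (intro nn_integral_mono) (auto simp: indicator_def)
  also have "\<dots> = 0" using Z by simp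
  finally have "(\<integral>\<^sup>+x. indicator Z (cyl \<omega> x) * indicator region x \<partial>lborel) = 0" by simp
  then have "AE x in lborel. indicator Z (cyl \<omega> x) * indicator region x = (0 :: ennreal)"
    by (subst (asm) nn_integral_0_iff_AE) auto
  then show "AE x in lborel. x \<in> region \<longrightarrow> Pr (cyl \<omega> x)"
  proof eventually_elim
    case (elim x)
    then show ?case using Zn by (auto simp: indicator_def split: if_splits)
  qed
qed

end

theorem mainTheorem3:
  fixes \<alpha> \<theta> :: real
    and \<Omega> D N F G e :: "(real^3) set"
    and \<F> \<N> :: "(real^3) set set"
  assumes "\<alpha> > 0"
    and "compact_polyhedral_domain \<Omega>"
    and "boundary_faces \<Omega> \<F>"
    and "\<N> \<subseteq> \<F>" and "N = \<Union>\<N>"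
    and "D = frontier \<Omega> - N" and "D \<noteq> {}"
    and "F \<in> \<F>" and "F \<subseteq> N"
    and "G \<in> \<F>" and "rel_interior G \<subseteq> D"
    and "shared_edge F G e"
    and "dihedral_angle \<Omega> F G e \<theta>" and "pi \<le> \<theta>" and "\<theta> < 2 * pi"
  shows "\<exists>f g. W12_boundary \<Omega> \<F> f \<and> L2_on (surface_measure \<F>) N g \<and>
           \<not> (\<exists>u. mixed_solution \<alpha> \<Omega> \<F> D N f g u)"
proof -
  note faces = assms(3)
  obtain K where K: "closed K" "\<Omega> = interior K"
    using assms(2) closed_compact_polyhedron unfolding compact_polyhedral_domain_def by blast
  obtain t a b where frame: "norm t = 1" "norm a = 1" "norm b = 1" "t \<bullet> a = 0" "t \<bullet> b = 0" "a \<bullet> b = 0"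
    and near: "\<forall>p\<in>rel_interior e. \<exists>\<epsilon>>0.
          e \<inter> ball p \<epsilon> = {p + s *\<^sub>R t | s. True} \<inter> ball p \<epsilon> \<and>
          F \<inter> ball p \<epsilon> = {p + s *\<^sub>R t + r *\<^sub>R a | s r. r \<ge> 0} \<inter> ball p \<epsilon> \<and>
          G \<inter> ball p \<epsilon> =
            {p + s *\<^sub>R t + r *\<^sub>R (cos \<theta> *\<^sub>R a + sin \<theta> *\<^sub>R b) | s r. r \<ge> 0} \<inter> ball p \<epsilon> \<and>
          {p + s *\<^sub>R t + r *\<^sub>R (cos \<phi> *\<^sub>R a + sin \<phi> *\<^sub>R b) | s r \<phi>. r > 0 \<and> 0 < \<phi> \<and> \<phi> < \<theta>}
            \<inter> ball p \<epsilon> \<subseteq> \<Omega>"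
    using assms(13) unfolding dihedral_angle_def by - (elim conjE exE, rule that, assumption+)
  obtain x y where "e = closed_segment x y" using assms(12) by (auto simp: shared_edge_def)
  then have "rel_interior e \<noteq> {}" by (simp add: rel_interior_eq_empty)
  then obtain p where "p \<in> rel_interior e" by blast
  with near obtain \<rho> where \<rho>: "0 < \<rho>"
    and Fb: "F \<inter> ball p \<rho> = {p + s *\<^sub>R t + r *\<^sub>R a | s r. r \<ge> 0} \<inter> ball p \<rho>"
    and Gb: "G \<inter> ball p \<rho> =
            {p + s *\<^sub>R t + r *\<^sub>R (cos \<theta> *\<^sub>R a + sin \<theta> *\<^sub>R b) | s r. r \<ge> 0} \<inter> ball p \<rho>"
    and Wb: "{p + s *\<^sub>R t + r *\<^sub>R (cos \<phi> *\<^sub>R a + sin \<phi> *\<^sub>R b) | s r \<phi>. r > 0 \<and> 0 < \<phi> \<and> \<phi> < \<theta>}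
            \<inter> ball p \<rho> \<subseteq> \<Omega>"
    by - (drule bspec, assumption, elim conjE exE, rule that, assumption+)
  interpret orthonormal_frame p t a b by unfold_locales (rule frame)+
  have bp: "cyl \<phi> x \<in> ball p \<rho> \<longleftrightarrow> norm x < \<rho>" for \<phi> x
    using norm_cyl[of \<phi> x] by (simp add: dist_norm norm_minus_commute)
  interpret polyhedral_wedge p t a b \<Omega> \<alpha> \<theta> \<rho>
  proof
    show "open \<Omega>" by (simp add: K)
    show "frontier \<Omega> \<noteq> {}" using assms(6,7) by auto
    fix \<phi> and x :: "real \<times> real" assume "0 < fst x" "0 < \<phi>" "\<phi> < \<theta>" "norm x < \<rho>"
    then have "cyl \<phi> x \<in> {p + s *\<^sub>R t + r *\<^sub>R (cos \<phi> *\<^sub>R a + sin \<phi> *\<^sub>R b) | s r \<phi>. r > 0 \<and> 0 < \<phi> \<and> \<phi> < \<theta>} \<inter> ball p \<rho>"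
      using bp[of \<phi> x] unfolding cyl_def radial_def by blast
    then show "cyl \<phi> x \<in> \<Omega>" using Wb by blast
  qed (use assms \<rho> in auto)
  have Fl: "F \<inter> ball p \<rho> = {cyl 0 y | y. 0 \<le> fst y} \<inter> ball p \<rho>"
    unfolding Fb by (force simp: cyl_def radial_def)
  have Gl: "G \<inter> ball p \<rho> = {cyl \<theta> y | y. 0 \<le> fst y} \<inter> ball p \<rho>"
    unfolding Gb by (force simp: cyl_def radial_def)
  have Fin: "cyl 0 x \<in> F" if "0 \<le> fst x" "norm x < \<rho>" for x using Fl bp[of 0 x] that by blast
  have Gin: "cyl \<theta> x \<in> G" if "0 \<le> fst x" "norm x < \<rho>" for x using Gl bp[of \<theta> x] that by blast
  have fin: "finite \<F>" and cl: "\<And>F. F \<in> \<F> \<Longrightarrow> closed F" and ad: "\<And>F. F \<in> \<F> \<Longrightarrow> aff_dim F = 2"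
    using faces closed_compact_polyhedron by (auto simp: boundary_faces_def closed_face_def)
  note surf = nn_integral_surface_measure[OF fin cl ad]
  have hullF: "affine hull F = range (cyl 0)" by (rule affine_hull_face[OF ad[OF assms(8)] \<rho> Fin])
  have hullG: "affine hull G = range (cyl \<theta>)" by (rule affine_hull_face[OF ad[OF assms(10)] \<rho> Gin])
  have regn: "0 < fst x" "norm x < \<rho>" "norm x < \<rho> / 2" if "x \<in> region" for x using that \<rho> by (auto simp: region_def)
  have Fri: "cyl 0 x \<in> rel_interior F" if "0 < fst x" "norm x < \<rho>" for x
    by (rule face_rel_interior[OF hullF Fin that])
  have Gri: "cyl \<theta> x \<in> rel_interior G" if "0 < fst x" "norm x < \<rho>" for x
    by (rule face_rel_interior[OF hullG Gin that])
  (* small enough for the box of side 2 L around p to stay in the region of radius \<rho> / 2 *)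
  define L where "L = \<rho> / 8"
  have L: "0 < L" "4 * L < \<rho>" using \<rho> by (auto simp: L_def)
  define g where "g P = (if P \<in> F \<inter> ball p \<rho> then neumann_datum \<beta> (L / 8) ((P - p) \<bullet> a, (P - p) \<bullet> t) else 0)" for P
  have er0: "radial 0 = a" by (simp add: radial_def)
  have g0: "g (cyl 0 x) = neumann_datum \<beta> (L / 8) x" if "norm x < \<rho>" "0 < fst x" for x
    using that Fin[of x] bp[of 0 x] cyl_coordinates[of 0 x] by (simp add: g_def er0)
  have gm[measurable]: "g \<in> borel_measurable borel"
  proof -
    have [measurable]: "F \<inter> ball p \<rho> \<in> sets borel" using cl[OF assms(8)] by (intro sets.Int) simp_all
    have [measurable]: "(\<lambda>P. ((P - p) \<bullet> a, (P - p) \<bullet> t)) \<in> borel_measurable borel"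
      by (intro borel_measurable_continuous_onI continuous_intros)
    show ?thesis unfolding g_def[abs_def] by measurable
  qed
  have gF: "P \<in> rel_interior F" if nz: "g P \<noteq> 0" for P
  proof -
    have P: "P \<in> F \<inter> ball p \<rho>" using nz by (auto simp: g_def split: if_splits)
    then obtain x where x: "P = cyl 0 x" "0 \<le> fst x" using Fl by blast
    have n: "norm x < \<rho>" using P x bp by blast
    have "fst x \<noteq> 0"
    proof
      assume "fst x = 0"
      then have "g P = 0" using P cyl_coordinates[of 0 x] by (simp add: g_def neumann_datum_def x er0)
      with nz show False by simp
    qed
    then show ?thesis unfolding x(1) using x n by (intro Fri) auto
  qed
  have gother: "g P * indicator H P = 0" if "H \<in> \<F>" "H \<noteq> F" for H P
  proof -
    have "H \<inter> rel_interior F = {}" using faces that assms(8) unfolding boundary_faces_def by blast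
    then show ?thesis using gF[of P] by (auto simp: indicator_def)
  qed
  have Ncl: "closed N" unfolding assms(5) using fin cl assms(4) by (intro closed_Union) (auto intro: finite_subset)
  have g2: "(\<integral>\<^sup>+P. ennreal ((g P)\<^sup>2) \<partial>surface_measure \<F>) < \<infinity>"
  proof -
    have m: "(\<lambda>P. ennreal ((g P)\<^sup>2)) \<in> borel_measurable borel" by measurable
    have "(\<integral>\<^sup>+P. ennreal ((g P)\<^sup>2) \<partial>surface_measure \<F>) =
        (\<Sum>H\<in>\<F>. \<integral>\<^sup>+y. ennreal ((g (plane_chart H y))\<^sup>2) * indicator H (plane_chart H y) \<partial>lborel)"
      by (rule surf[OF _ _ m])
    also have "\<dots> = (\<Sum>H\<in>{F}. \<integral>\<^sup>+y. ennreal ((g (plane_chart H y))\<^sup>2) * indicator H (plane_chart H y) \<partial>lborel)"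
    proof (rule sum.mono_neutral_right[OF fin])
      show "\<forall>H\<in>\<F> - {F}. (\<integral>\<^sup>+y. ennreal ((g (plane_chart H y))\<^sup>2) * indicator H (plane_chart H y) \<partial>lborel) = 0"
      proof
        fix H assume H: "H \<in> \<F> - {F}"
        have "ennreal ((g P)\<^sup>2) * indicator H P = 0" for P
          using gother[of H P] H by (auto simp: indicator_def split: if_splits)
        then show "(\<integral>\<^sup>+y. ennreal ((g (plane_chart H y))\<^sup>2) * indicator H (plane_chart H y) \<partial>lborel) = 0"
          by (simp only: nn_integral_const mult_zero_left)
      qed
    qed (use assms(8) in auto)
    also have "\<dots> = (\<integral>\<^sup>+x. ennreal ((g (cyl 0 x))\<^sup>2) * indicator F (cyl 0 x) \<partial>lborel)"
      using nn_integral_face[OF ad[OF assms(8)] cl[OF assms(8)] hullF m] by simp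
    also have "\<dots> \<le> (\<integral>\<^sup>+x. ennreal ((neumann_datum \<beta> (L / 8) x)\<^sup>2) \<partial>lborel)"
      using cyl_coordinates[of 0] by (intro nn_integral_mono) (auto simp: g_def er0 indicator_def)
    also have "\<dots> < \<infinity>" using \<beta>(1) L by (intro neumann_datum_square_integrable) auto
    finally show ?thesis .
  qed
  have gL2: "L2_on (surface_measure \<F>) N g"
  proof -
    have sets: "sets (surface_measure \<F>) = sets borel" by (rule sets_surface_measure[OF fin cl ad])
    have meq: "borel_measurable (surface_measure \<F>) = (borel_measurable borel :: (real^3 \<Rightarrow> real) set)"
      by (rule measurable_cong_sets) (simp_all add: sets)
    have [measurable]: "N \<in> sets borel" using Ncl by simp
    have "integrable (surface_measure \<F>) (\<lambda>P. indicat_real N P *\<^sub>R (norm (g P))\<^sup>2)"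
    proof (rule integrableI_bounded)
      show "(\<lambda>P. indicat_real N P *\<^sub>R (norm (g P))\<^sup>2) \<in> borel_measurable (surface_measure \<F>)"
        unfolding meq by measurable
      have "(\<integral>\<^sup>+P. ennreal (norm (indicat_real N P *\<^sub>R (norm (g P))\<^sup>2)) \<partial>surface_measure \<F>) \<le> (\<integral>\<^sup>+P. ennreal ((g P)\<^sup>2) \<partial>surface_measure \<F>)"
        by (intro nn_integral_mono) (auto simp: indicator_def)
      then show "(\<integral>\<^sup>+P. ennreal (norm (indicat_real N P *\<^sub>R (norm (g P))\<^sup>2)) \<partial>surface_measure \<F>) < \<infinity>"
        using g2 by (rule le_less_trans)
    qed
    moreover have "set_borel_measurable (surface_measure \<F>) N g"
      unfolding set_borel_measurable_def meq by measurable
    ultimately show ?thesis by (simp add: L2_on_def set_integrable_def)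
  qed
  have "\<not> mixed_solution \<alpha> \<Omega> \<F> D N (\<lambda>_. 0) g u" for u
  proof
    assume "mixed_solution \<alpha> \<Omega> \<F> D N (\<lambda>_. 0) g u"
    then have h: "harmonic_on u \<Omega>"
      and dir: "AE P in surface_measure \<F>. P \<in> D \<longrightarrow> (u \<longlongrightarrow> 0) (at P within approach_region \<alpha> \<Omega> P)"
      and neu: "AE P in surface_measure \<F>. P \<in> N \<longrightarrow>
        ((\<lambda>X. outer_normal \<Omega> P \<bullet> grad u X) \<longlongrightarrow> g P) (at P within approach_region \<alpha> \<Omega> P)"
      and max: "(\<integral>\<^sup>+P\<in>frontier \<Omega>. (nontangential_max \<alpha> \<Omega> (grad u) P)\<^sup>2 \<partial>surface_measure \<F>) < \<infinity>"
      by (auto simp: mixed_solution_def)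
    have dir': "AE x in lborel. x \<in> region \<longrightarrow> cyl \<theta> x \<in> D \<longrightarrow>
        (u \<longlongrightarrow> 0) (at (cyl \<theta> x) within approach_region \<alpha> \<Omega> (cyl \<theta> x))"
      by (rule face_AE[OF faces assms(10) hullG _ dir]) (rule Gin)
    have neu': "AE x in lborel. x \<in> region \<longrightarrow> cyl 0 x \<in> N \<longrightarrow>
        ((\<lambda>X. outer_normal \<Omega> (cyl 0 x) \<bullet> grad u X) \<longlongrightarrow> g (cyl 0 x)) (at (cyl 0 x) within approach_region \<alpha> \<Omega> (cyl 0 x))"
      by (rule face_AE[OF faces assms(8) hullF _ neu]) (rule Fin)
    let ?M = "nontangential_max \<alpha> \<Omega> (grad u)"
    note Mm[measurable] = measurable_nontangential_max[of \<alpha> \<Omega> "grad u"]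
    obtain n :: nat where n: "0 < n" and maj:
      "\<And>x \<phi>. x \<in> region \<Longrightarrow> 0 < \<phi> \<Longrightarrow> \<phi> < \<theta> \<Longrightarrow> ennreal (norm (grad u (cyl \<phi> x))) \<le>
        (\<Sum>(\<omega>, j)\<in>{0, \<theta>} \<times> {1..n}. ?M (cyl \<omega> (real j / n * fst x, snd x)))"
      by (rule gradient_majorant) blast
    define m where "m i x = ?M (cyl (fst i) (real (snd i) / n * fst x, snd x))" for i :: "real \<times> nat" and x :: "real \<times> real"
    define I where "I = {0, \<theta>} \<times> {1..n}"
    define Sx where "Sx x = (\<Sum>i\<in>I. m i x)" for x
    define S where "S x = enn2real (Sx x)" for x
    have maj': "ennreal (norm (grad u (cyl \<phi> x))) \<le> Sx x" if "x \<in> region" "0 < \<phi>" "\<phi> < \<theta>" for x \<phi>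
      using maj[OF that] by (simp add: Sx_def m_def I_def case_prod_unfold)
    have mm[measurable]: "m i \<in> borel_measurable borel" for i
    proof -
      have "(\<lambda>x :: real \<times> real. (real (snd i) / n * fst x, snd x)) \<in> borel_measurable borel"
        by (intro borel_measurable_continuous_onI continuous_intros)
      from measurable_compose[OF measurable_compose[OF this measurable_cyl] Mm] show ?thesis
        by (simp add: m_def[abs_def])
    qed
    have [measurable]: "Sx \<in> borel_measurable borel" unfolding Sx_def[abs_def] by measurable
    have Sm[measurable]: "S \<in> borel_measurable borel" unfolding S_def[abs_def] by measurable
    have rm[measurable]: "region \<in> sets borel"
    proof -
      have "region = {x. 0 < fst x} \<inter> {x. norm x < \<rho> / 2}" by (auto simp: region_def)
      moreover have "open \<dots>" by (intro open_Int open_Collect_less continuous_intros)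
      ultimately show ?thesis by simp
    qed
    have Mfin: "(\<integral>\<^sup>+x\<in>region. (?M (cyl \<omega> x))\<^sup>2 \<partial>lborel) < \<infinity>" if "\<omega> = 0 \<or> \<omega> = \<theta>" for \<omega>
    proof -
      have M2: "(\<lambda>P. (?M P)\<^sup>2) \<in> borel_measurable borel" by measurable
      have "(\<integral>\<^sup>+x\<in>region. (?M (cyl \<omega> x))\<^sup>2 \<partial>lborel) \<le> (\<integral>\<^sup>+P\<in>frontier \<Omega>. (?M P)\<^sup>2 \<partial>surface_measure \<F>)"
        using that face_integral_le[OF faces assms(8) hullF Fin M2] face_integral_le[OF faces assms(10) hullG Gin M2]
        by auto
      then show ?thesis using max by (rule le_less_trans)
    qed
    have mfin: "(\<integral>\<^sup>+x\<in>region. (m i x)\<^sup>2 \<partial>lborel) < \<infinity>" if i: "i \<in> I" for i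
    proof -
      define l where "l = real (snd i) / n"
      have l: "0 < l" "l \<le> 1" using i n by (auto simp: l_def I_def)
      have scaled: "(l * fst x, snd x) \<in> region" if "x \<in> region" for x
      proof -
        have "norm (l * fst x, snd x) \<le> norm (fst x, snd x)"
          unfolding norm_Pair using l
          by (intro real_sqrt_le_mono add_right_mono power_mono) (auto simp: abs_mult mult_left_le_one_le)
        then show ?thesis using that l by (simp add: region_def)
      qed
      let ?f = "\<lambda>x. (?M (cyl (fst i) x))\<^sup>2 * indicator region x"
      have fm: "?f \<in> borel_measurable borel" by measurable
      have "(\<integral>\<^sup>+x\<in>region. (m i x)\<^sup>2 \<partial>lborel) \<le> (\<integral>\<^sup>+x. ?f (l * fst x, snd x) \<partial>lborel)"
        using scaled by (intro nn_integral_mono) (auto simp: m_def l_def indicator_def)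
      also have "\<dots> = ennreal (1 / l) * (\<integral>\<^sup>+x. ?f x \<partial>lborel)" by (rule nn_integral_scale_fst[OF fm l(1)])
      also have "\<dots> < \<infinity>" using Mfin[of "fst i"] i by (auto simp: ennreal_mult_less_top I_def)
      finally show ?thesis .
    qed
    have Sfin: "(\<integral>\<^sup>+x\<in>region. (Sx x)\<^sup>2 \<partial>lborel) < \<infinity>"
      unfolding Sx_def by (rule square_integrable_sum) (use mfin in \<open>auto simp: I_def\<close>)
    have Sfinite: "AE x in lborel. x \<in> region \<longrightarrow> Sx x < \<infinity>"
    proof -
      have "AE x in lborel. (Sx x)\<^sup>2 * indicator region x \<noteq> \<infinity>"
        by (rule nn_integral_noteq_infinite) (use Sfin in auto)
      then show ?thesis
      proof eventually_elim
        case (elim x)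
        then show ?case by (auto simp: less_top ennreal_mult_eq_top_iff power2_eq_square ennreal_top_mult split: split_indicator_asm)
      qed
    qed
    show False
    proof (rule gradient_not_square_integrable[OF h Sm _ _ _ _ L])
      show "0 \<le> S x" for x by (simp add: S_def)
      show "AE x in lborel. x \<in> region \<longrightarrow> (\<forall>\<phi>. 0 < \<phi> \<longrightarrow> \<phi> < \<theta> \<longrightarrow> norm (grad u (cyl \<phi> x)) \<le> S x)"
        using Sfinite
      proof eventually_elim
        case (elim x)
        show ?case
        proof (intro impI allI)
          fix \<phi> assume x: "x \<in> region" "0 < \<phi>" "\<phi> < \<theta>"
          then have "Sx x = ennreal (S x)" using elim by (simp add: S_def)
          then have "ennreal (norm (grad u (cyl \<phi> x))) \<le> ennreal (S x)" using maj'[OF x] by simp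
          then show "norm (grad u (cyl \<phi> x)) \<le> S x" by (subst (asm) ennreal_le_iff) (simp_all add: S_def)
        qed
      qed
      show "AE x in lborel. x \<in> region \<longrightarrow> ((\<lambda>\<phi>. u (cyl \<phi> x)) \<longlongrightarrow> 0) (at_left \<theta>)"
        using dir'
      proof eventually_elim
        case (elim x)
        show ?case
        proof
          assume x: "x \<in> region"
          have P: "cyl \<theta> x \<in> D" using Gri[OF regn(1,2)[OF x]] assms(11) by blast
          then have fr: "cyl \<theta> x \<in> frontier \<Omega>" using assms(6) by auto
          show "((\<lambda>\<phi>. u (cyl \<phi> x)) \<longlongrightarrow> 0) (at_left \<theta>)"
            by (rule filterlim_compose[OF _ ray_to_boundary[OF x fr]]) (use elim x P in auto)
        qed
      qed
      show "AE x in lborel. x \<in> region \<longrightarrow> ((\<lambda>\<phi>. - b \<bullet> grad u (cyl \<phi> x)) \<longlongrightarrow> neumann_datum \<beta> (L / 8) x) (at_right 0)"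
        using neu'
      proof eventually_elim
        case (elim x)
        show ?case
        proof
          assume x: "x \<in> region"
          have P: "cyl 0 x \<in> F" using Fin[of x] regn[OF x] by simp
          then have fr: "cyl 0 x \<in> frontier \<Omega>" using faces assms(8) by (auto simp: boundary_faces_def)
          have nrm: "outer_normal \<Omega> (cyl 0 x) = - b"
            by (rule outer_normal_face[OF faces assms(8) K Fl Fri[OF regn(1,2)[OF x]] regn(1,2)[OF x]])
          have "((\<lambda>X. - b \<bullet> grad u X) \<longlongrightarrow> neumann_datum \<beta> (L / 8) x) (at (cyl 0 x) within approach_region \<alpha> \<Omega> (cyl 0 x))"
            using elim x P assms(9) g0[OF regn(2,1)[OF x]] nrm by auto
          then show "((\<lambda>\<phi>. - b \<bullet> grad u (cyl \<phi> x)) \<longlongrightarrow> neumann_datum \<beta> (L / 8) x) (at_right 0)"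
            by (rule filterlim_compose[OF _ ray_to_boundary[OF x fr]]) simp
        qed
      qed
      have "(\<integral>\<^sup>+x\<in>half_box L. ennreal ((S x)\<^sup>2) \<partial>lborel) \<le> (\<integral>\<^sup>+x\<in>region. (Sx x)\<^sup>2 \<partial>lborel)"
      proof (rule nn_integral_mono)
        fix x :: "real \<times> real"
        have "x \<in> region" if "x \<in> half_box L"
        proof -
          have "norm x \<le> \<bar>fst x\<bar> + \<bar>snd x\<bar>" using norm_Pair_le[of "fst x" "snd x"] by simp
          also have "\<dots> \<le> 2 * L" using that by (auto simp: half_box_def)
          finally show ?thesis using that L by (auto simp: region_def half_box_def)
        qed
        moreover have "ennreal ((S x)\<^sup>2) \<le> (Sx x)\<^sup>2"
          unfolding S_def by (cases "Sx x") (auto simp: ennreal_power)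
        ultimately show "ennreal ((S x)\<^sup>2) * indicator (half_box L) x \<le> (Sx x)\<^sup>2 * indicator region x"
          by (auto simp: indicator_def)
      qed
      then show "(\<integral>\<^sup>+x\<in>half_box L. ennreal ((S x)\<^sup>2) \<partial>lborel) < \<infinity>" using Sfin by (rule le_less_trans)
    qed
  qed
  then show ?thesis using W12_boundary_zero gL2 by blast
qed

end
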